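(* Let $\mathfrak g$ be a Lie algebra over a field $\mathbb{K}$ of characteristic zero and $\psi\in\wedge^3\mathfrak g^*$ a $3$-cocycle of $\mathfrak g$ with coefficients in the trivial module $\mathbb K$. Then the graded vector space $\bigoplus_{n\ge0}\mathrm{Hom}(\wedge^n\mathfrak g^*,\mathfrak g)$ (with $\mathrm{Hom}(\wedge^n\mathfrak g^*,\mathfrak g)$ in degree $n$) carries an $L_\infty$-algebra structure given by $l_1=0$, $l_2=\llbracket\ ,\ \rrbracket$, $l_3=\llbracket\ ,\ ,\ \rrbracket$ and trivial higher brackets, where the brackets are those defined in the context for the coadjoint module $M=\mathfrak g^*$ and $H=\psi^\sharp:\wedge^2\mathfrak g\to\mathfrak g^*$, $\psi^\sharp(x,y)=\psi(x,y,-)$, which is a $2$-cocycle of $\mathfrak g$ with coefficients in the coadjoint representation $\mathfrak g^*$. An element $\mathbf r\in\wedge^2\mathfrak g$ is a $\psi$-twisted triangular $r$-matrix if and only if $\mathbf r^\sharp:\mathfrak g^*\to\mathfrak g$ is a Maurer-Cartan element in this $L_\infty$-algebra.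
   Context: The coadjoint action is $x\bullet\alpha=\mathrm{ad}^*_x\alpha$, $(\mathrm{ad}^*_x\alpha)(y)=-\alpha([x,y])$. Elements $\mathbf r\in\wedge^2\mathfrak g$ are viewed as skew-symmetric tensors in $\mathfrak g\otimes\mathfrak g$ and $\mathbf r^\sharp(\alpha)=\mathbf r(\alpha,-)$. $\mathbf r$ is a $\psi$-twisted triangular $r$-matrix if $[\mathbf r_{12},\mathbf r_{13}]+[\mathbf r_{12},\mathbf r_{23}]+[\mathbf r_{13},\mathbf r_{23}]=-(\wedge^3\mathbf r^\sharp)(\psi)$, where $\big((\wedge^3\mathbf r^\sharp)(\psi)\big)(\alpha,\beta,\gamma)=\psi(\mathbf r^\sharp\alpha,\mathbf r^\sharp\beta,\mathbf r^\sharp\gamma)$ for $\alpha,\beta,\gamma\in\mathfrak g^*$, and for $\mathbf r=\sum a_i\otimes b_i$, $[\mathbf r_{12},\mathbf r_{13}]=\sum[a_i,a_j]\otimes b_i\otimes b_j$, $[\mathbf r_{12},\mathbf r_{23}]=\sum a_i\otimes[b_i,a_j]\otimes b_j$, $[\mathbf r_{13},\mathbf r_{23}]=\sum a_i\otimes a_j\otimes[b_i,b_j]$. $L_\infty$-algebra: a graded vector space $L=\bigoplus_i L_i$ with multilinear maps $l_k:L^{\otimes k}\to L$ of degree $2-k$ ($k\ge1$) such that (i) $l_k(x_{\sigma(1)},\dots,x_{\sigma(k)})=(-1)^\sigma\epsilon(\sigma)\,l_k(x_1,\dots,x_k)$ for $\sigma\in S_k$, where $(-1)^\sigma$ is the signature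 and $\epsilon(\sigma)$ the Koszul sign; (ii) for each $n\ge1$, $\sum_{i+j=n+1}\sum_\sigma(-1)^\sigma\epsilon(\sigma)(-1)^{i(j-1)}l_j(l_i(x_{\sigma(1)},\dots,x_{\sigma(i)}),x_{\sigma(i+1)},\dots,x_{\sigma(n)})=0$, with $\sigma$ running over $(i,n-i)$-unshuffles, $i\ge 1$. A Maurer-Cartan element is $\alpha\in L_1$ with $l_1(\alpha)+\frac1{2!}l_2(\alpha,\alpha)-\frac1{3!}l_3(\alpha,\alpha,\alpha)-\cdots=0$; when only $l_2,l_3$ are nonzero this reads $\frac12 l_2(\alpha,\alpha)-\frac16 l_3(\alpha,\alpha,\alpha)=0$. Brackets, for a $\mathfrak g$-module $M$ (action $x\bullet u$) and a Chevalley-Eilenberg $2$-cocycle $H:\wedge^2\mathfrak g\to M$: $Sh(a,b,c)$ denotes permutations of $\{1,\dots,a+b+c\}$ increasing on each of the three consecutive blocks of sizes $a,b,c$ (similarly $Sh(a,b)$); a sum over $Sh(a,b,-1)$ is zero. For $P\in\mathrm{Hom}(\wedge^pM,\mathfrak g)$, $Q\in\mathrm{Hom}(\wedge^qM,\mathfrak g)$, $R\in\mathrm{Hom}(\wedge^rM,\mathfrak g)$: $$\begin{aligned}\llbracket P,Q\rrbracket(u_1,\dots,u_{p+q})=&\sum_{\sigma\in Sh(q,1,p-1)}(-1)^\sigma P\big(Q(u_{\sigma(1)},\dots,u_{\sigma(q)})\bullet u_{\sigma(q+1)},u_{\sigma(q+2)},\dots,u_{\sigma(p+q)}\big)\\&-(-1)^{pq}\sum_{\sigma\in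 Sh(p,1,q-1)}(-1)^\sigma Q\big(P(u_{\sigma(1)},\dots,u_{\sigma(p)})\bullet u_{\sigma(p+1)},u_{\sigma(p+2)},\dots,u_{\sigma(p+q)}\big)\\&+(-1)^{pq}\sum_{\sigma\in Sh(p,q)}(-1)^\sigma\big[P(u_{\sigma(1)},\dots,u_{\sigma(p)}),Q(u_{\sigma(p+1)},\dots,u_{\sigma(p+q)})\big],\end{aligned}$$ $$\begin{aligned}&\llbracket P,Q,R\rrbracket(u_1,\dots,u_{p+q+r-1})\\&=(-1)^{pqr}\,\frac12\bigg\{\sum_{\sigma\in Sh(q,r,p-1)}(-1)^\sigma P\big(H(Q(u_{\sigma(1)},\dots,u_{\sigma(q)}),R(u_{\sigma(q+1)},\dots,u_{\sigma(q+r)})),u_{\sigma(q+r+1)},\dots,u_{\sigma(p+q+r-1)}\big)\\&-(-1)^{qr}\sum_{\sigma\in Sh(r,q,p-1)}(-1)^\sigma P\big(H(R(u_{\sigma(1)},\dots,u_{\sigma(r)}),Q(u_{\sigma(r+1)},\dots,u_{\sigma(q+r)})),u_{\sigma(q+r+1)},\dots,u_{\sigma(p+q+r-1)}\big)\\&-(-1)^{pq}\sum_{\sigma\in Sh(p,r,q-1)}(-1)^\sigma Q\big(H(P(u_{\sigma(1)},\dots,u_{\sigma(p)}),R(u_{\sigma(p+1)},\dots,u_{\sigma(p+r)})),u_{\sigma(p+r+1)},\dots,u_{\sigma(p+q+r-1)}\big)\\&+(-1)^{p(q+r)}\sum_{\sigma\in Sh(r,p,q-1)}(-1)^\sigma Q\big(H(R(u_{\sigma(1)},\dots,u_{\sigma(r)}),P(u_{\sigma(r+1)},\dots,u_{\sigma(p+r)})),u_{\sigma(p+r+1)},\dots,u_{\sigma(p+q+r-1)}\big)\\&+(-1)^{(p+q)r}\sum_{\sigma\in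 Sh(p,q,r-1)}(-1)^\sigma R\big(H(P(u_{\sigma(1)},\dots,u_{\sigma(p)}),Q(u_{\sigma(p+1)},\dots,u_{\sigma(p+q)})),u_{\sigma(p+q+1)},\dots,u_{\sigma(p+q+r-1)}\big)\\&-(-1)^{pq+qr+rp}\sum_{\sigma\in Sh(q,p,r-1)}(-1)^\sigma R\big(H(Q(u_{\sigma(1)},\dots,u_{\sigma(q)}),P(u_{\sigma(q+1)},\dots,u_{\sigma(p+q)})),u_{\sigma(p+q+1)},\dots,u_{\sigma(p+q+r-1)}\big)\bigg\}.\end{aligned}$$
   Formalization: The factor (-1)^{pqr} of the ternary bracket is replaced, in terms with outermost degree a and other degrees b,c, by -(-1)^{a+bc}; with the printed factor the n=5 identity fails for every nonzero ψ. Both agree for p=q=r=1, so the Maurer-Cartan equation is unchanged. *)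

theory Defs
  imports
    Complex_Main
    "HOL-Library.Function_Algebras"
    "HOL-Combinatorics.Permutations"
begin

section \<open>Alternating multilinear maps\<close>

definition tuples :: "'m set \<Rightarrow> nat \<Rightarrow> 'm list set" where
  "tuples M n = {us. set us \<subseteq> M \<and> length us = n}"

definition multilinear_on ::
  "('k \<Rightarrow> 'm \<Rightarrow> 'm) \<Rightarrow> 'm set \<Rightarrow> ('k \<Rightarrow> 'w \<Rightarrow> 'w) \<Rightarrow> nat
    \<Rightarrow> ('m::ab_group_add list \<Rightarrow> 'w::ab_group_add) \<Rightarrow> bool" where
  "multilinear_on sM M sW n f \<longleftrightarrow>
     (\<forall>us\<in>tuples M n. \<forall>i<n. \<forall>u\<in>M. \<forall>v\<in>M.
        f (us[i := u + v]) = f (us[i := u]) + f (us[i := v])) \<and>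
     (\<forall>us\<in>tuples M n. \<forall>i<n. \<forall>u\<in>M. \<forall>c.
        f (us[i := sM c u]) = sW c (f (us[i := u])))"

text \<open>
  \<open>alt_maps sM M sW W n\<close> is \<open>Hom(\<Lambda>\<^sup>n M, W)\<close>. Its elements are functions on lists that vanish
  away from \<open>M\<^sup>n\<close>, so that the spaces for different \<open>n\<close> are independent subspaces of one function
  type and \<open>\<Oplus>\<^sub>n Hom(\<Lambda>\<^sup>n M, W)\<close> is their internal direct sum; \<open>n = 0\<close> gives \<open>W\<close> via
  \<open>f \<mapsto> f []\<close>.
\<close>

definition alt_maps ::
  "('k \<Rightarrow> 'm \<Rightarrow> 'm) \<Rightarrow> 'm set \<Rightarrow> ('k \<Rightarrow> 'w \<Rightarrow> 'w) \<Rightarrow> 'w set \<Rightarrow> nat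
    \<Rightarrow> ('m::ab_group_add list \<Rightarrow> 'w::ab_group_add) set" where
  "alt_maps sM M sW W n = {f.
     (\<forall>us\<in>tuples M n. f us \<in> W) \<and>
     (\<forall>us. us \<notin> tuples M n \<longrightarrow> f us = 0) \<and>
     multilinear_on sM M sW n f \<and>
     (\<forall>us\<in>tuples M n. \<forall>i j. i < j \<and> j < n \<and> us ! i = us ! j \<longrightarrow> f us = 0)}"

definition pointwise :: "('k \<Rightarrow> 'w \<Rightarrow> 'w) \<Rightarrow> 'k \<Rightarrow> ('a \<Rightarrow> 'w) \<Rightarrow> 'a \<Rightarrow> 'w" where
  "pointwise s c f = (\<lambda>x. s c (f x))"


section \<open>Lie algebras, their duals and Chevalley--Eilenberg cocycles\<close>

locale lie_algebra = vector_space scale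
  for scale :: "'k::field \<Rightarrow> 'g::ab_group_add \<Rightarrow> 'g" +
  fixes br :: "'g \<Rightarrow> 'g \<Rightarrow> 'g"
  assumes linear_left: "Vector_Spaces.linear scale scale (\<lambda>x. br x y)"
    and linear_right: "Vector_Spaces.linear scale scale (br x)"
    and br_self: "br x x = 0"
    and jacobi: "br x (br y z) + br y (br z x) + br z (br x y) = 0"

definition dual :: "('k::field \<Rightarrow> 'g::ab_group_add \<Rightarrow> 'g) \<Rightarrow> ('g \<Rightarrow> 'k) set" where
  "dual scale = {\<alpha>. Vector_Spaces.linear scale (*) \<alpha>}"

definition coad :: "('g \<Rightarrow> 'g \<Rightarrow> 'g) \<Rightarrow> 'g \<Rightarrow> ('g \<Rightarrow> 'k::field) \<Rightarrow> 'g \<Rightarrow> 'k" where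
  "coad br x \<alpha> = (\<lambda>y. - \<alpha> (br x y))"

text \<open>
  Positions are counted from \<open>0\<close>, hence the sign \<open>(-1)\<^sup>i\<close> instead of \<open>(-1)\<^sup>i\<^sup>+\<^sup>1\<close> in the first sum.
\<close>

definition ce_differential ::
  "('g \<Rightarrow> 'g \<Rightarrow> 'g) \<Rightarrow> ('k::field \<Rightarrow> 'm \<Rightarrow> 'm) \<Rightarrow> ('g \<Rightarrow> 'm \<Rightarrow> 'm) \<Rightarrow> nat
    \<Rightarrow> ('g list \<Rightarrow> 'm::ab_group_add) \<Rightarrow> 'g list \<Rightarrow> 'm" where
  "ce_differential br sM act n f xs = (if length xs = Suc n then
     (\<Sum>i\<le>n. sM ((-1) ^ i) (act (xs ! i) (f (nths xs (- {i})))))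
     + (\<Sum>(i, j)\<in>{(i, j). i < j \<and> j \<le> n}.
          sM ((-1) ^ (i + j)) (f (br (xs ! i) (xs ! j) # nths xs (- {i, j}))))
     else 0)"

definition ce_cocycles ::
  "('k::field \<Rightarrow> 'g \<Rightarrow> 'g) \<Rightarrow> ('g \<Rightarrow> 'g \<Rightarrow> 'g) \<Rightarrow> ('k \<Rightarrow> 'm \<Rightarrow> 'm) \<Rightarrow> 'm set \<Rightarrow> ('g \<Rightarrow> 'm \<Rightarrow> 'm)
    \<Rightarrow> nat \<Rightarrow> ('g::ab_group_add list \<Rightarrow> 'm::ab_group_add) set" where
  "ce_cocycles scale br sM M act n =
     {f \<in> alt_maps scale UNIV sM M n. ce_differential br sM act n f = 0}"

definition trivial_cocycles ::
  "('k::field \<Rightarrow> 'g \<Rightarrow> 'g) \<Rightarrow> ('g \<Rightarrow> 'g \<Rightarrow> 'g) \<Rightarrow> nat \<Rightarrow> ('g::ab_group_add list \<Rightarrow> 'k) set" where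
  "trivial_cocycles scale br n = ce_cocycles scale br (*) UNIV (\<lambda>x c. 0) n"

definition coadjoint_cocycles ::
  "('k::field \<Rightarrow> 'g \<Rightarrow> 'g) \<Rightarrow> ('g \<Rightarrow> 'g \<Rightarrow> 'g) \<Rightarrow> nat
    \<Rightarrow> ('g::ab_group_add list \<Rightarrow> 'g \<Rightarrow> 'k) set" where
  "coadjoint_cocycles scale br n =
     ce_cocycles scale br (pointwise (*)) (dual scale) (coad br) n"

definition psi_sharp :: "('g list \<Rightarrow> 'k::field) \<Rightarrow> 'g list \<Rightarrow> 'g \<Rightarrow> 'k" where
  "psi_sharp \<psi> xs = (if length xs = 2 then (\<lambda>z. \<psi> (xs @ [z])) else 0)"


section \<open>\<open>L\<^sub>\<infinity>\<close>-algebras\<close>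

text \<open>
  Permutations of \<open>{0..<a+b+c}\<close> that increase on each of the consecutive blocks of sizes \<open>a\<close>, \<open>b\<close>,
  \<open>c\<close>. The last size is an integer because \<open>c = -1\<close> occurs and stands for an empty sum.
\<close>

definition Sh3 :: "nat \<Rightarrow> nat \<Rightarrow> int \<Rightarrow> (nat \<Rightarrow> nat) set" where
  "Sh3 a b c = (if c < 0 then {} else {\<sigma>. \<sigma> permutes {..<a + b + nat c} \<and>
     strict_mono_on {..<a} \<sigma> \<and>
     strict_mono_on {a..<a + b} \<sigma> \<and>
     strict_mono_on {a + b..<a + b + nat c} \<sigma>})"

definition Sh2 :: "nat \<Rightarrow> nat \<Rightarrow> (nat \<Rightarrow> nat) set" where
  "Sh2 a b = {\<sigma>. \<sigma> permutes {..<a + b} \<and>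
     strict_mono_on {..<a} \<sigma> \<and> strict_mono_on {a..<a + b} \<sigma>}"

definition block :: "'a list \<Rightarrow> (nat \<Rightarrow> nat) \<Rightarrow> nat \<Rightarrow> nat \<Rightarrow> 'a list" where
  "block us \<sigma> i j = map (\<lambda>k. us ! \<sigma> k) [i..<j]"

text \<open>
  The sign with \<open>x\<^sub>0 \<cdots> x\<^sub>n\<^sub>-\<^sub>1 = koszul_sign d n \<sigma> \<cdot> x\<^bsub>\<sigma> 0\<^esub> \<cdots> x\<^bsub>\<sigma> (n-1)\<^esub>\<close> in the graded commutative
  algebra on homogeneous \<open>x\<^sub>i\<close> of degree \<open>d i\<close>.
\<close>

definition koszul_sign :: "(nat \<Rightarrow> int) \<Rightarrow> nat \<Rightarrow> (nat \<Rightarrow> nat) \<Rightarrow> int" where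
  "koszul_sign d n \<sigma> =
     (\<Prod>(i, j)\<in>{(i, j). i < j \<and> j < n \<and> \<sigma> j < \<sigma> i}.
        if odd (d (\<sigma> i) * d (\<sigma> j)) then -1 else 1)"

locale L_infinity_algebra = vector_space scale
  for scale :: "'k::field \<Rightarrow> 'v::ab_group_add \<Rightarrow> 'v" +
  fixes L :: "int \<Rightarrow> 'v set" and l :: "nat \<Rightarrow> 'v list \<Rightarrow> 'v"
  assumes subspace_L: "subspace (L i)"
    and direct_sum: "finite I \<Longrightarrow> (\<And>i. i \<in> I \<Longrightarrow> x i \<in> L i) \<Longrightarrow> (\<Sum>i\<in>I. x i) = 0
      \<Longrightarrow> \<forall>i\<in>I. x i = 0"
    and multilinear: "k \<ge> 1 \<Longrightarrow> multilinear_on scale (span (\<Union>i. L i)) scale k (l k)"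
    and degree: "k \<ge> 1 \<Longrightarrow> length xs = k \<Longrightarrow> (\<And>i. i < k \<Longrightarrow> xs ! i \<in> L (d i))
      \<Longrightarrow> l k xs \<in> L ((\<Sum>i<k. d i) + 2 - int k)"
    and antisymmetric: "k \<ge> 1 \<Longrightarrow> length xs = k \<Longrightarrow> (\<And>i. i < k \<Longrightarrow> xs ! i \<in> L (d i))
      \<Longrightarrow> \<sigma> permutes {..<k}
      \<Longrightarrow> l k (block xs \<sigma> 0 k) = scale (of_int (sign \<sigma> * koszul_sign d k \<sigma>)) (l k xs)"
    and higher_jacobi: "n \<ge> 1 \<Longrightarrow> length xs = n \<Longrightarrow> (\<And>i. i < n \<Longrightarrow> xs ! i \<in> L (d i))
      \<Longrightarrow> (\<Sum>(i, j)\<in>{(i, j). 1 \<le> i \<and> 1 \<le> j \<and> i + j = n + 1}. \<Sum>\<sigma>\<in>Sh2 i (n - i).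
             scale (of_int (sign \<sigma> * koszul_sign d n \<sigma> * (-1) ^ (i * (j - 1))))
               (l j (l i (block xs \<sigma> 0 i) # block xs \<sigma> i n))) = 0"

text \<open>
  \<open>l\<^sub>1(\<alpha>) + 1/2! l\<^sub>2(\<alpha>,\<alpha>) - 1/3! l\<^sub>3(\<alpha>,\<alpha>,\<alpha>) - \<cdots> = 0\<close>, with the usual continuation of the signs
  \<open>+,+,-,-,+,+,\<dots>\<close>. Finiteness keeps the library's convention that infinite sums are \<open>0\<close> from
  producing spurious solutions.
\<close>

definition maurer_cartan ::
  "('k::field_char_0 \<Rightarrow> 'v::ab_group_add \<Rightarrow> 'v) \<Rightarrow> (int \<Rightarrow> 'v set) \<Rightarrow> (nat \<Rightarrow> 'v list \<Rightarrow> 'v)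
    \<Rightarrow> 'v \<Rightarrow> bool" where
  "maurer_cartan scale L l \<alpha> \<longleftrightarrow> \<alpha> \<in> L 1 \<and>
     finite {k. 1 \<le> k \<and> l k (replicate k \<alpha>) \<noteq> 0} \<and>
     (\<Sum>k\<in>{k. 1 \<le> k \<and> l k (replicate k \<alpha>) \<noteq> 0}.
        scale ((-1) ^ ((k - 1) * (k - 2) div 2) / fact k) (l k (replicate k \<alpha>))) = 0"


section \<open>The brackets on \<open>\<Oplus>\<^sub>n Hom(\<Lambda>\<^sup>n M, \<gg>)\<close>\<close>

definition insert_act ::
  "('k::field \<Rightarrow> 'g \<Rightarrow> 'g) \<Rightarrow> ('g \<Rightarrow> 'm \<Rightarrow> 'm) \<Rightarrow> nat \<Rightarrow> nat
    \<Rightarrow> ('m list \<Rightarrow> 'g) \<Rightarrow> ('m list \<Rightarrow> 'g) \<Rightarrow> 'm list \<Rightarrow> 'g::ab_group_add" where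
  "insert_act scale act p q P Q us =
     (\<Sum>\<sigma>\<in>Sh3 q 1 (int p - 1). scale (of_int (sign \<sigma>))
        (P (act (Q (block us \<sigma> 0 q)) (us ! \<sigma> q) # block us \<sigma> (q + 1) (p + q))))"

definition insert_H ::
  "('k::field \<Rightarrow> 'g \<Rightarrow> 'g) \<Rightarrow> ('g list \<Rightarrow> 'm) \<Rightarrow> nat \<Rightarrow> nat \<Rightarrow> nat
    \<Rightarrow> ('m list \<Rightarrow> 'g) \<Rightarrow> ('m list \<Rightarrow> 'g) \<Rightarrow> ('m list \<Rightarrow> 'g) \<Rightarrow> 'm list \<Rightarrow> 'g::ab_group_add" where
  "insert_H scale H p q r P Q R us =
     (\<Sum>\<sigma>\<in>Sh3 q r (int p - 1). scale (of_int (sign \<sigma>))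
        (P (H [Q (block us \<sigma> 0 q), R (block us \<sigma> q (q + r))]
            # block us \<sigma> (q + r) (p + q + r - 1))))"

definition bracket2 ::
  "('k::field \<Rightarrow> 'g \<Rightarrow> 'g) \<Rightarrow> ('g \<Rightarrow> 'g \<Rightarrow> 'g) \<Rightarrow> 'm set \<Rightarrow> ('g \<Rightarrow> 'm \<Rightarrow> 'm) \<Rightarrow> nat \<Rightarrow> nat
    \<Rightarrow> ('m list \<Rightarrow> 'g) \<Rightarrow> ('m list \<Rightarrow> 'g) \<Rightarrow> 'm list \<Rightarrow> 'g::ab_group_add" where
  "bracket2 scale br M act p q P Q us = (if us \<in> tuples M (p + q) then
     insert_act scale act p q P Q us
     - scale ((-1) ^ (p * q)) (insert_act scale act q p Q P us)
     + scale ((-1) ^ (p * q)) (\<Sum>\<sigma>\<in>Sh2 p q. scale (of_int (sign \<sigma>))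
         (br (P (block us \<sigma> 0 p)) (Q (block us \<sigma> p (p + q)))))
     else 0)"

text \<open>
  In the literature the six terms of the ternary bracket carry the common factor \<open>(-1)\<^sup>p\<^sup>q\<^sup>r\<close>. With
  that factor the fifth higher Jacobi identity fails: for the abelian Lie algebra \<open>K\<^sup>3\<close>, with
  \<open>\<psi> = det\<close>, \<open>H\<close> the cross product, \<open>A : \<gg>\<^sup>* \<rightarrow> \<gg>\<close> the identity matrix and \<open>x, y \<in> \<gg>\<close>, its left-hand
  side at \<open>(x, y, A, A, A)\<close> is the map \<open>u \<mapsto> -12 (x \<times> y) \<times> u\<close>. The factor used here is
  \<open>outer_sign p q r\<close>, where \<open>p\<close> is the degree of the outermost map of the term and \<open>q\<close>, \<open>r\<close> are the
  degrees of the other two. It agrees with \<open>(-1)\<^sup>p\<^sup>q\<^sup>r\<close> unless \<open>p\<close> and \<open>q r\<close> are both even, in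
  particular whenever \<open>p = q = r = 1\<close>, the only case that enters the Maurer--Cartan equation.
\<close>

definition outer_sign :: "nat \<Rightarrow> nat \<Rightarrow> nat \<Rightarrow> 'k::field" where
  "outer_sign p q r = - ((-1) ^ (p + q * r))"

definition bracket3 ::
  "('k::field \<Rightarrow> 'g \<Rightarrow> 'g) \<Rightarrow> 'm set \<Rightarrow> ('g list \<Rightarrow> 'm) \<Rightarrow> nat \<Rightarrow> nat \<Rightarrow> nat
    \<Rightarrow> ('m list \<Rightarrow> 'g) \<Rightarrow> ('m list \<Rightarrow> 'g) \<Rightarrow> ('m list \<Rightarrow> 'g) \<Rightarrow> 'm list \<Rightarrow> 'g::ab_group_add" where
  "bracket3 scale M H p q r P Q R us = (if us \<in> tuples M (p + q + r - 1) then
     scale (1 / 2) (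
       scale (outer_sign p q r)
         (insert_H scale H p q r P Q R us
          - scale ((-1) ^ (q * r)) (insert_H scale H p r q P R Q us))
       + scale (outer_sign q p r)
         (- scale ((-1) ^ (p * q)) (insert_H scale H q p r Q P R us)
          + scale ((-1) ^ (p * (q + r))) (insert_H scale H q r p Q R P us))
       + scale (outer_sign r p q)
         (scale ((-1) ^ ((p + q) * r)) (insert_H scale H r p q R P Q us)
          - scale ((-1) ^ (p * q + q * r + r * p)) (insert_H scale H r q p R Q P us)))
     else 0)"

definition component :: "nat \<Rightarrow> ('m list \<Rightarrow> 'g) \<Rightarrow> 'm list \<Rightarrow> 'g::zero" where
  "component n P us = (if length us = n then P us else 0)"

text \<open>
  Multilinear extension of the brackets from homogeneous elements to the direct sum: in each arity
  only finitely many tuples of degrees contribute.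
\<close>

definition total_bracket2 ::
  "('k::field \<Rightarrow> 'g \<Rightarrow> 'g) \<Rightarrow> ('g \<Rightarrow> 'g \<Rightarrow> 'g) \<Rightarrow> 'm set \<Rightarrow> ('g \<Rightarrow> 'm \<Rightarrow> 'm)
    \<Rightarrow> ('m list \<Rightarrow> 'g) \<Rightarrow> ('m list \<Rightarrow> 'g) \<Rightarrow> 'm list \<Rightarrow> 'g::ab_group_add" where
  "total_bracket2 scale br M act P Q us =
     (\<Sum>(p, q)\<in>{(p, q). p + q = length us}.
        bracket2 scale br M act p q (component p P) (component q Q) us)"

definition total_bracket3 ::
  "('k::field \<Rightarrow> 'g \<Rightarrow> 'g) \<Rightarrow> 'm set \<Rightarrow> ('g list \<Rightarrow> 'm)
    \<Rightarrow> ('m list \<Rightarrow> 'g) \<Rightarrow> ('m list \<Rightarrow> 'g) \<Rightarrow> ('m list \<Rightarrow> 'g) \<Rightarrow> 'm list \<Rightarrow> 'g::ab_group_add" where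
  "total_bracket3 scale M H P Q R us =
     (\<Sum>(p, q, r)\<in>{(p, q, r). p + q + r = length us + 1}.
        bracket3 scale M H p q r (component p P) (component q Q) (component r R) us)"

definition brackets ::
  "('k::field \<Rightarrow> 'g \<Rightarrow> 'g) \<Rightarrow> ('g \<Rightarrow> 'g \<Rightarrow> 'g) \<Rightarrow> 'm set \<Rightarrow> ('g \<Rightarrow> 'm \<Rightarrow> 'm) \<Rightarrow> ('g list \<Rightarrow> 'm)
    \<Rightarrow> nat \<Rightarrow> ('m list \<Rightarrow> 'g) list \<Rightarrow> 'm list \<Rightarrow> 'g::ab_group_add" where
  "brackets scale br M act H k Ps =
     (if k = 2 then total_bracket2 scale br M act (Ps ! 0) (Ps ! 1)
      else if k = 3 then total_bracket3 scale M H (Ps ! 0) (Ps ! 1) (Ps ! 2)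
      else 0)"

definition hom_graded ::
  "('k::field \<Rightarrow> 'g \<Rightarrow> 'g) \<Rightarrow> int \<Rightarrow> (('g \<Rightarrow> 'k) list \<Rightarrow> 'g::ab_group_add) set" where
  "hom_graded scale i =
     (if i < 0 then {0} else alt_maps (pointwise (*)) (dual scale) scale UNIV (nat i))"

definition coadjoint_brackets ::
  "('k::field \<Rightarrow> 'g \<Rightarrow> 'g) \<Rightarrow> ('g \<Rightarrow> 'g \<Rightarrow> 'g) \<Rightarrow> ('g list \<Rightarrow> 'k)
    \<Rightarrow> nat \<Rightarrow> (('g \<Rightarrow> 'k) list \<Rightarrow> 'g) list \<Rightarrow> ('g \<Rightarrow> 'k) list \<Rightarrow> 'g::ab_group_add" where
  "coadjoint_brackets scale br \<psi> = brackets scale br (dual scale) (coad br) (psi_sharp \<psi>)"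


section \<open>Twisted triangular \<open>r\<close>-matrices\<close>

text \<open>
  A tensor is identified with the multilinear form on \<open>\<gg>\<^sup>*\<close> that it defines; over a field this is
  injective on \<open>\<gg> \<otimes> \<gg>\<close> and \<open>\<gg> \<otimes> \<gg> \<otimes> \<gg>\<close> in every dimension. A list of pairs \<open>(a\<^sub>i, b\<^sub>i)\<close> presents
  the tensor \<open>\<Sum> a\<^sub>i \<otimes> b\<^sub>i\<close>.
\<close>

definition pure2 ::
  "('k::field \<Rightarrow> 'g::ab_group_add \<Rightarrow> 'g) \<Rightarrow> 'g \<Rightarrow> 'g \<Rightarrow> ('g \<Rightarrow> 'k) \<Rightarrow> ('g \<Rightarrow> 'k) \<Rightarrow> 'k" where
  "pure2 scale a b \<alpha> \<beta> = (if \<alpha> \<in> dual scale \<and> \<beta> \<in> dual scale then \<alpha> a * \<beta> b else 0)"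

definition pure3 ::
  "('k::field \<Rightarrow> 'g::ab_group_add \<Rightarrow> 'g) \<Rightarrow> 'g \<Rightarrow> 'g \<Rightarrow> 'g
    \<Rightarrow> ('g \<Rightarrow> 'k) \<Rightarrow> ('g \<Rightarrow> 'k) \<Rightarrow> ('g \<Rightarrow> 'k) \<Rightarrow> 'k" where
  "pure3 scale a b c \<alpha> \<beta> \<gamma> =
     (if \<alpha> \<in> dual scale \<and> \<beta> \<in> dual scale \<and> \<gamma> \<in> dual scale then \<alpha> a * \<beta> b * \<gamma> c else 0)"

definition tensor2 ::
  "('k::field \<Rightarrow> 'g::ab_group_add \<Rightarrow> 'g) \<Rightarrow> ('g \<times> 'g) list
    \<Rightarrow> ('g \<Rightarrow> 'k) \<Rightarrow> ('g \<Rightarrow> 'k) \<Rightarrow> 'k" where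
  "tensor2 scale ts = (\<Sum>(a, b)\<leftarrow>ts. pure2 scale a b)"

definition wedge2 ::
  "('k::field \<Rightarrow> 'g::ab_group_add \<Rightarrow> 'g) \<Rightarrow> (('g \<Rightarrow> 'k) \<Rightarrow> ('g \<Rightarrow> 'k) \<Rightarrow> 'k) set" where
  "wedge2 scale = {r \<in> range (tensor2 scale). \<forall>\<alpha> \<beta>. r \<beta> \<alpha> = - r \<alpha> \<beta>}"

definition r12_r13 ::
  "('k::field \<Rightarrow> 'g::ab_group_add \<Rightarrow> 'g) \<Rightarrow> ('g \<Rightarrow> 'g \<Rightarrow> 'g) \<Rightarrow> ('g \<times> 'g) list
    \<Rightarrow> ('g \<Rightarrow> 'k) \<Rightarrow> ('g \<Rightarrow> 'k) \<Rightarrow> ('g \<Rightarrow> 'k) \<Rightarrow> 'k" where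
  "r12_r13 scale br ts =
     (\<Sum>(a, b)\<leftarrow>ts. \<Sum>(a', b')\<leftarrow>ts. pure3 scale (br a a') b b')"

definition r12_r23 ::
  "('k::field \<Rightarrow> 'g::ab_group_add \<Rightarrow> 'g) \<Rightarrow> ('g \<Rightarrow> 'g \<Rightarrow> 'g) \<Rightarrow> ('g \<times> 'g) list
    \<Rightarrow> ('g \<Rightarrow> 'k) \<Rightarrow> ('g \<Rightarrow> 'k) \<Rightarrow> ('g \<Rightarrow> 'k) \<Rightarrow> 'k" where
  "r12_r23 scale br ts =
     (\<Sum>(a, b)\<leftarrow>ts. \<Sum>(a', b')\<leftarrow>ts. pure3 scale a (br b a') b')"

definition r13_r23 ::
  "('k::field \<Rightarrow> 'g::ab_group_add \<Rightarrow> 'g) \<Rightarrow> ('g \<Rightarrow> 'g \<Rightarrow> 'g) \<Rightarrow> ('g \<times> 'g) list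
    \<Rightarrow> ('g \<Rightarrow> 'k) \<Rightarrow> ('g \<Rightarrow> 'k) \<Rightarrow> ('g \<Rightarrow> 'k) \<Rightarrow> 'k" where
  "r13_r23 scale br ts =
     (\<Sum>(a, b)\<leftarrow>ts. \<Sum>(a', b')\<leftarrow>ts. pure3 scale a a' (br b b'))"

text \<open>
  \<open>r(\<alpha>, -)\<close> as an element of \<open>\<gg>\<close> rather than of the bidual; see \<open>sharp_tensor2\<close> below.
\<close>

definition sharp ::
  "('k::field \<Rightarrow> 'g::ab_group_add \<Rightarrow> 'g) \<Rightarrow> (('g \<Rightarrow> 'k) \<Rightarrow> ('g \<Rightarrow> 'k) \<Rightarrow> 'k)
    \<Rightarrow> ('g \<Rightarrow> 'k) \<Rightarrow> 'g" where
  "sharp scale r \<alpha> = (THE y. \<forall>\<beta>\<in>dual scale. \<beta> y = r \<alpha> \<beta>)"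

definition sharp_hom ::
  "('k::field \<Rightarrow> 'g::ab_group_add \<Rightarrow> 'g) \<Rightarrow> (('g \<Rightarrow> 'k) \<Rightarrow> ('g \<Rightarrow> 'k) \<Rightarrow> 'k)
    \<Rightarrow> ('g \<Rightarrow> 'k) list \<Rightarrow> 'g" where
  "sharp_hom scale r us = (if us \<in> tuples (dual scale) 1 then sharp scale r (us ! 0) else 0)"

text \<open>
  The left-hand side does not depend on the presentation of \<open>r\<close>; see \<open>cyb_cong\<close> below.
\<close>

definition twisted_triangular ::
  "('k::field \<Rightarrow> 'g::ab_group_add \<Rightarrow> 'g) \<Rightarrow> ('g \<Rightarrow> 'g \<Rightarrow> 'g) \<Rightarrow> ('g list \<Rightarrow> 'k)
    \<Rightarrow> (('g \<Rightarrow> 'k) \<Rightarrow> ('g \<Rightarrow> 'k) \<Rightarrow> 'k) \<Rightarrow> bool" where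
  "twisted_triangular scale br \<psi> r \<longleftrightarrow> r \<in> wedge2 scale \<and>
     (\<exists>ts. r = tensor2 scale ts \<and>
       (\<forall>\<alpha>\<in>dual scale. \<forall>\<beta>\<in>dual scale. \<forall>\<gamma>\<in>dual scale.
          (r12_r13 scale br ts + r12_r23 scale br ts + r13_r23 scale br ts) \<alpha> \<beta> \<gamma>
          = - \<psi> [sharp scale r \<alpha>, sharp scale r \<beta>, sharp scale r \<gamma>]))"


subsection \<open>The notions above are well defined\<close>

lemma dual_separates:
  assumes "vector_space scale" and "\<And>\<alpha>. \<alpha> \<in> dual scale \<Longrightarrow> \<alpha> x = \<alpha> y"
  shows "x = y"
proof (rule ccontr)
  assume "x \<noteq> y"
  interpret vector_space scale by fact
  interpret field: vector_space "(*) :: 'a \<Rightarrow> 'a \<Rightarrow> 'a"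
    by unfold_locales (auto simp: algebra_simps)
  interpret vector_space_pair scale "(*) :: 'a \<Rightarrow> 'a \<Rightarrow> 'a" ..
  have "independent {x - y}"
    using \<open>x \<noteq> y\<close> by (simp add: dependent_single)
  from linear_independent_extend[OF this, of "\<lambda>_. 1"] obtain \<alpha>
    where \<alpha>: "Vector_Spaces.linear scale (*) \<alpha>" "\<alpha> (x - y) = 1" by auto
  then have "\<alpha> x = \<alpha> y" using assms(2) by (simp add: dual_def)
  with \<alpha> show False by (simp add: linear_diff)
qed

lemma dual_simps:
  assumes "\<alpha> \<in> dual scale"
  shows "\<alpha> (x + y) = \<alpha> x + \<alpha> y" "\<alpha> (scale c x) = c * \<alpha> x" "\<alpha> 0 = 0"
proof -
  interpret Vector_Spaces.linear scale "(*)" \<alpha> using assms by (simp add: dual_def)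
  show "\<alpha> (x + y) = \<alpha> x + \<alpha> y" "\<alpha> (scale c x) = c * \<alpha> x" "\<alpha> 0 = 0"
    by (rule add scale zero)+
qed

lemma tensor2_apply:
  "tensor2 scale ts \<alpha> \<beta> = (\<Sum>(a, b)\<leftarrow>ts. pure2 scale a b \<alpha> \<beta>)"
  by (induction ts) (auto simp: tensor2_def)

lemma dual_sum_list:
  assumes "\<beta> \<in> dual scale"
  shows "\<beta> (\<Sum>t\<leftarrow>ts. f t) = (\<Sum>t\<leftarrow>ts. \<beta> (f t))"
  by (induction ts) (simp_all add: dual_simps[OF assms])

lemma sharp_tensor2:
  assumes "vector_space scale" and "\<alpha> \<in> dual scale"
  shows "sharp scale (tensor2 scale ts) \<alpha> = (\<Sum>(a, b)\<leftarrow>ts. scale (\<alpha> a) b)"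
  unfolding sharp_def
proof (rule the_equality)
  show *: "\<forall>\<beta>\<in>dual scale. \<beta> (\<Sum>(a, b)\<leftarrow>ts. scale (\<alpha> a) b) = tensor2 scale ts \<alpha> \<beta>"
    using assms(2)
    by (auto simp: dual_sum_list tensor2_apply pure2_def dual_simps case_prod_unfold)
  show "y = (\<Sum>(a, b)\<leftarrow>ts. scale (\<alpha> a) b)"
    if "\<forall>\<beta>\<in>dual scale. \<beta> y = tensor2 scale ts \<alpha> \<beta>" for y
    using that * by (intro dual_separates[OF assms(1)]) simp
qed

lemma sum_list_fun_apply: "(\<Sum>x\<leftarrow>xs. f x) \<alpha> = (\<Sum>x\<leftarrow>xs. f x \<alpha>)"
  by (induction xs) auto

context lie_algebra
begin

lemma br_sum_list:
  "br (\<Sum>x\<leftarrow>xs. f x) (\<Sum>y\<leftarrow>ys. g y) = (\<Sum>x\<leftarrow>xs. \<Sum>y\<leftarrow>ys. br (f x) (g y))"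
proof -
  interpret r: Vector_Spaces.linear scale scale "br x" for x by (rule linear_right)
  interpret l: Vector_Spaces.linear scale scale "\<lambda>x. br x y" for y by (rule linear_left)
  have "br x (\<Sum>y\<leftarrow>ys. g y) = (\<Sum>y\<leftarrow>ys. br x (g y))" for x
    by (induction ys) (auto simp: r.add r.zero)
  then show ?thesis by (induction xs) (auto simp: l.add l.zero sum_list_addf)
qed

lemma br_scale: "br (scale c x) (scale d y) = scale (c * d) (br x y)"
proof -
  interpret r: Vector_Spaces.linear scale scale "br x" for x by (rule linear_right)
  interpret l: Vector_Spaces.linear scale scale "\<lambda>x. br x y" for y by (rule linear_left)
  show ?thesis by (simp add: r.scale l.scale mult.commute)
qed

lemma cyb_apply:
  fixes ts
  assumes "\<alpha> \<in> dual scale" "\<beta> \<in> dual scale" "\<gamma> \<in> dual scale"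
  defines "lcon \<equiv> \<lambda>\<delta>. \<Sum>t\<leftarrow>ts. scale (\<delta> (fst t)) (snd t)"
    and "rcon \<equiv> \<lambda>\<delta>. \<Sum>t\<leftarrow>ts. scale (\<delta> (snd t)) (fst t)"
  shows "r12_r13 scale br ts \<alpha> \<beta> \<gamma> = \<alpha> (br (rcon \<beta>) (rcon \<gamma>))"
    and "r12_r23 scale br ts \<alpha> \<beta> \<gamma> = \<beta> (br (lcon \<alpha>) (rcon \<gamma>))"
    and "r13_r23 scale br ts \<alpha> \<beta> \<gamma> = \<gamma> (br (lcon \<alpha>) (lcon \<beta>))"
  using assms(1-3)
  by (simp_all add: lcon_def rcon_def br_sum_list br_scale dual_sum_list dual_simps
      r12_r13_def r12_r23_def r13_r23_def sum_list_fun_apply case_prod_unfold pure3_def ac_simps)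

lemma cyb_cong:
  assumes "tensor2 scale ts = tensor2 scale ts'"
    and "\<alpha> \<in> dual scale" "\<beta> \<in> dual scale" "\<gamma> \<in> dual scale"
  shows "r12_r13 scale br ts \<alpha> \<beta> \<gamma> = r12_r13 scale br ts' \<alpha> \<beta> \<gamma>"
    and "r12_r23 scale br ts \<alpha> \<beta> \<gamma> = r12_r23 scale br ts' \<alpha> \<beta> \<gamma>"
    and "r13_r23 scale br ts \<alpha> \<beta> \<gamma> = r13_r23 scale br ts' \<alpha> \<beta> \<gamma>"
proof -
  have vs: "vector_space scale" ..
  have l: "(\<Sum>t\<leftarrow>ts. scale (\<delta> (fst t)) (snd t)) = (\<Sum>t\<leftarrow>ts'. scale (\<delta> (fst t)) (snd t))"
    if "\<delta> \<in> dual scale" for \<delta>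
    using sharp_tensor2[OF vs that, of ts] sharp_tensor2[OF vs that, of ts'] assms(1)
    by (simp add: case_prod_unfold)
  have r: "(\<Sum>t\<leftarrow>ts. scale (\<delta> (snd t)) (fst t)) = (\<Sum>t\<leftarrow>ts'. scale (\<delta> (snd t)) (fst t))"
    if "\<delta> \<in> dual scale" for \<delta>
  proof (rule dual_separates[OF vs])
    fix \<epsilon> assume "\<epsilon> \<in> dual scale"
    then have "\<epsilon> (\<Sum>t\<leftarrow>us. scale (\<delta> (snd t)) (fst t)) = tensor2 scale us \<epsilon> \<delta>" for us
      using that
      by (simp add: dual_sum_list dual_simps tensor2_apply pure2_def case_prod_unfold mult.commute)
    then show "\<epsilon> (\<Sum>t\<leftarrow>ts. scale (\<delta> (snd t)) (fst t)) = \<epsilon> (\<Sum>t\<leftarrow>ts'. scale (\<delta> (snd t)) (fst t))"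
      using assms(1) by simp
  qed
  show "r12_r13 scale br ts \<alpha> \<beta> \<gamma> = r12_r13 scale br ts' \<alpha> \<beta> \<gamma>"
    and "r12_r23 scale br ts \<alpha> \<beta> \<gamma> = r12_r23 scale br ts' \<alpha> \<beta> \<gamma>"
    and "r13_r23 scale br ts \<alpha> \<beta> \<gamma> = r13_r23 scale br ts' \<alpha> \<beta> \<gamma>"
    using assms(2-4) by (simp_all add: cyb_apply l r)
qed

end

end

theory Submission
  imports Defs "HOL-Library.Product_Plus"
begin

text \<open>
  An element of \<open>Hom(\<Lambda>\<^sup>n M, \<gg>)\<close> is a \<open>\<gg>\<close>-valued polynomial function on the odd vector space with
  odd coordinate \<open>u \<in> M\<close>. On such functions an \<open>M\<close>-valued one \<open>v\<close> acts by a derivation \<open>D\<^sub>v\<close> with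
  \<open>D\<^sub>v u = v\<close>, and the graded commutator of \<open>D\<^sub>v\<close> and \<open>D\<^sub>w\<close> is \<open>D\<close> of that of \<open>v\<close> and \<open>w\<close>
  as vector fields; the binary bracket consists of \<open>D\<close> of
  \<open>Q \<bullet> u\<close> applied to \<open>P\<close>, its mirror image and \<open>[P, Q]\<close>, and the ternary one of the terms \<open>D\<close> of
  \<open>H(Q, R)\<close> applied to \<open>P\<close>. Adjoin a formal parameter \<open>\<eta>\<^sub>i\<close> for each argument \<open>x\<^sub>i\<close>, of
  such a grade that \<open>P = \<Sum> \<eta>\<^sub>i x\<^sub>i\<close> is homogeneous. The higher Jacobi identities are then the
  coefficients at products of distinct \<open>\<eta>\<^sub>i\<close> of three identities in the single element \<open>P\<close>. With
  \<open>V = P \<bullet> u\<close> and \<open>W = H(P, P)\<close> these follow from the commutators of \<open>D\<^sub>V\<close> and \<open>D\<^sub>W\<close>, where the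
  Jacobi identity, the module axiom and the cocycle condition enter as \<open>[[P, P], P] = 0\<close>,
  \<open>2 P \<bullet> V = [P, P] \<bullet> u\<close> and \<open>P \<bullet> W = H([P, P], P)\<close>. Evaluating the brackets at
  \<open>r\<^sup>\<sharp>\<close> and pairing with a third covector turns the Maurer--Cartan equation into the twisted
  Yang--Baxter equation.
\<close>

section \<open>Signed sums over shuffles\<close>

text \<open>There is no basis and no finiteness assumption, so a form is a function of words in two
  kinds of letters, parameters and vectors. Products and insertions are then signed sums over the
  ways to split a word, and taking the coefficient at a product of parameters means evaluating at a
  word that begins with them.

  The main obstacle is the signs. Extracting a coefficient must act as a graded derivation on each
  bracket. This dictates how the relative signs of the terms depend on the grades, and
  \<open>outer_sign\<close> is this dependence for the ternary bracket, read off on forms without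
  parameters.

  Only compositions of brackets of arity 2 or 3 can be non-zero, so the higher Jacobi identities
  have content just for 3, 4 and 5 arguments. Polarising meets each choice of labels 2 or 6 times,
  whence the factors 1/2 and -1/6 in \<open>E2\<close> and \<open>E3\<close>; the minus sign is that
  of \<open>L3\<close>. On the diagonal the derivations along V and W are each odd, so their squares
  are half commutators, while they commute with one another. Characteristic zero is used to cancel 2
  and 3.\<close>

type_synonym grade = "int \<times> int"

text \<open>
  The first component of a grade counts formal parameters, the second one is the degree of forms;
  letters of grades \<open>\<gamma>\<close> and \<open>\<delta>\<close> commute up to \<open>(-1)\<close> to the power \<open>eps \<gamma> \<delta>\<close>. Keeping the two signs
  apart (instead of using the total degree) makes the sign of a permutation of parameters
  exactly \<open>sign \<sigma> * koszul_sign d n \<sigma>\<close>, so that no shift of degrees is needed.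
\<close>

definition eps :: "grade \<Rightarrow> grade \<Rightarrow> int" where
  "eps \<gamma> \<delta> = fst \<gamma> * fst \<delta> + snd \<gamma> * snd \<delta>"

definition sg :: "int \<Rightarrow> 'a::ab_group_add \<Rightarrow> 'a" where
  "sg n x = (if odd n then - x else x)"

lemma eps_simps:
  "eps (\<gamma> + \<delta>) \<kappa> = eps \<gamma> \<kappa> + eps \<delta> \<kappa>" "eps \<kappa> (\<gamma> + \<delta>) = eps \<kappa> \<gamma> + eps \<kappa> \<delta>"
  "eps (\<gamma> - \<delta>) \<kappa> = eps \<gamma> \<kappa> - eps \<delta> \<kappa>" "eps \<kappa> (\<gamma> - \<delta>) = eps \<kappa> \<gamma> - eps \<kappa> \<delta>"
  "eps 0 \<kappa> = 0" "eps \<kappa> 0 = 0"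
  by (simp_all add: eps_def algebra_simps)

lemma eps_commute: "eps \<gamma> \<delta> = eps \<delta> \<gamma>"
  by (simp add: eps_def mult.commute)

lemma sg_0 [simp]: "sg 0 x = x"
  and sg_1 [simp]: "sg 1 x = - x"
  and sg_zero [simp]: "sg n 0 = 0"
  and sg_eq_0 [simp]: "sg n x = 0 \<longleftrightarrow> x = 0"
  by (simp_all add: sg_def)

lemma sg_simps:
  "sg (m + n) x = sg m (sg n x)" "sg (m - n) x = sg m (sg n x)" "sg (- n) x = sg n x"
  "sg n (x + y) = sg n x + sg n y" "sg n (x - y) = sg n x - sg n y" "sg n (- x) = - sg n x"
  by (auto simp: sg_def)

lemma sg_self [simp]: "sg n (sg n x) = x"
  by (simp add: sg_def)

lemma sg_commute: "sg m (sg n x) = sg n (sg m x)"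
  by (simp add: sg_def)

lemma sg_self' [simp]: "sg m (sg n (sg m x)) = sg n x"
  by (simp add: sg_def)

lemma sg_apply: "sg n f x = sg n (f x)"
  by (simp add: sg_def)

lemmas sg_norm = sg_simps sg_commute eps_simps

abbreviation degs :: "('x \<Rightarrow> grade) \<Rightarrow> 'x list \<Rightarrow> grade" where
  "degs dg xs \<equiv> (\<Sum>x\<leftarrow>xs. dg x)"

text \<open>
  The sums run over all ways to split a word into two or three subwords, weighted by the sign of the
  shuffle; the recursion decides which subword receives the first letter.
\<close>

primrec sh :: "('x \<Rightarrow> grade) \<Rightarrow> 'x list \<Rightarrow> ('x list \<Rightarrow> 'x list \<Rightarrow> 'w) \<Rightarrow> 'w::ab_group_add" where
  "sh dg [] f = f [] []"
| "sh dg (x # xs) f = sh dg xs (\<lambda>a. f (x # a))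
     + sh dg xs (\<lambda>a b. sg (eps (dg x) (degs dg a)) (f a (x # b)))"

primrec sh3 ::
  "('x \<Rightarrow> grade) \<Rightarrow> 'x list \<Rightarrow> ('x list \<Rightarrow> 'x list \<Rightarrow> 'x list \<Rightarrow> 'w) \<Rightarrow> 'w::ab_group_add" where
  "sh3 dg [] f = f [] [] []"
| "sh3 dg (x # xs) f = sh3 dg xs (\<lambda>a. f (x # a))
     + sh3 dg xs (\<lambda>a b c. sg (eps (dg x) (degs dg a)) (f a (x # b) c))
     + sh3 dg xs (\<lambda>a b c. sg (eps (dg x) (degs dg a + degs dg b)) (f a b (x # c)))"

lemma sh3_cong:
  assumes "\<And>a b c. degs dg a + degs dg b + degs dg c = degs dg xs
    \<Longrightarrow> set a \<union> set b \<union> set c = set xs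
    \<Longrightarrow> length a + length b + length c = length xs \<Longrightarrow> f a b c = g a b c"
  shows "sh3 dg xs f = sh3 dg xs g"
  using assms
proof (induction xs arbitrary: f g)
  case (Cons x xs)
  have "sh3 dg xs (\<lambda>a. f (x # a)) = sh3 dg xs (\<lambda>a. g (x # a))"
    by (rule Cons.IH) (auto intro!: Cons.prems simp: add.assoc)
  moreover have "sh3 dg xs (\<lambda>a b c. sg (eps (dg x) (degs dg a)) (f a (x # b) c))
      = sh3 dg xs (\<lambda>a b c. sg (eps (dg x) (degs dg a)) (g a (x # b) c))"
    by (rule Cons.IH, rule arg_cong[where f = "sg _"])
      (auto intro!: Cons.prems simp: ac_simps)
  moreover have "sh3 dg xs (\<lambda>a b c. sg (eps (dg x) (degs dg a + degs dg b)) (f a b (x # c)))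
      = sh3 dg xs (\<lambda>a b c. sg (eps (dg x) (degs dg a + degs dg b)) (g a b (x # c)))"
    by (rule Cons.IH, rule arg_cong[where f = "sg _"])
      (auto intro!: Cons.prems simp: ac_simps)
  ultimately show ?case by simp
qed simp

lemma sh3_add: "sh3 dg xs (\<lambda>a b c. f a b c + g a b c) = sh3 dg xs f + sh3 dg xs g"
  by (induction xs arbitrary: f g) (simp_all add: sg_simps)

lemma sh3_zero [simp]: "sh3 dg xs (\<lambda>a b c. 0) = 0"
  by (induction xs) simp_all

lemma sh3_hom:
  assumes "\<And>x y. h (x + y) = h x + h y"
  shows "h (sh3 dg xs f) = sh3 dg xs (\<lambda>a b c. h (f a b c))"
proof (induction xs arbitrary: f)
  case (Cons x xs)
  have "h 0 = 0" using assms[of 0 0] by simp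
  then have "h (- y) = - h y" for y using assms[of y "- y"] by (simp add: eq_neg_iff_add_eq_0 add.commute)
  then have "h (sg n y) = sg n (h y)" for n y by (simp add: sg_def)
  then show ?case by (simp add: assms Cons.IH)
qed simp

lemma sh3_sg: "sh3 dg xs (\<lambda>a b c. sg n (f a b c)) = sg n (sh3 dg xs f)"
  by (rule sh3_hom[symmetric]) (simp add: sg_simps)

text \<open>A third part that stays empty causes no sign. This is how \<open>sh_cong\<close> and
  \<open>sh_hom\<close> are inherited from \<open>sh3\<close>.\<close>

lemma sh_eq_sh3: "sh dg xs f = sh3 dg xs (\<lambda>a b c. if c = [] then f a b else 0)"
  by (induction xs arbitrary: f) (simp_all add: if_distrib[of "sg _"] cong: if_cong)

lemma sh_cong:
  assumes "\<And>a b. degs dg a + degs dg b = degs dg xs \<Longrightarrow> set a \<union> set b = set xs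
    \<Longrightarrow> length a + length b = length xs \<Longrightarrow> f a b = g a b"
  shows "sh dg xs f = sh dg xs g"
  unfolding sh_eq_sh3 by (rule sh3_cong) (use assms in auto)

lemma sh_add: "sh dg xs (\<lambda>a b. f a b + g a b) = sh dg xs f + sh dg xs g"
  by (induction xs arbitrary: f g) (simp_all add: sg_simps)

lemma sh_zero [simp]: "sh dg xs (\<lambda>a b. 0) = 0"
  by (induction xs) simp_all

lemma sh_hom:
  assumes "\<And>x y. h (x + y) = h x + h y"
  shows "h (sh dg xs f) = sh dg xs (\<lambda>a b. h (f a b))"
proof -
  have "h 0 = 0" using assms[of 0 0] by simp
  then show ?thesis by (simp add: sh_eq_sh3 sh3_hom[of h, OF assms] if_distrib[of h] cong: if_cong)
qed

lemma sh_sg: "sh dg xs (\<lambda>a b. sg n (f a b)) = sg n (sh dg xs f)"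
  by (rule sh_hom[symmetric]) (simp add: sg_simps)

lemma sh_minus: "sh dg xs (\<lambda>a b. - f a b) = - sh dg xs f"
  by (rule sh_hom[symmetric]) simp

lemma sh_diff: "sh dg xs (\<lambda>a b. f a b - g a b) = sh dg xs f - sh dg xs g"
  using sh_add[of dg xs f "\<lambda>a b. - g a b"] by (simp add: sh_minus)

lemma sh_map: "sh dg (map h xs) f = sh (dg \<circ> h) xs (\<lambda>a b. f (map h a) (map h b))"
  by (induction xs arbitrary: f) (simp_all add: comp_def)

lemma sh3_map:
  "sh3 dg (map h xs) f = sh3 (dg \<circ> h) xs (\<lambda>a b c. f (map h a) (map h b) (map h c))"
  by (induction xs arbitrary: f) (simp_all add: comp_def)

text \<open>Graded cocommutativity of splitting: the two summands of the recursion change places,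
  and the first letter then jumps over the other part.\<close>

lemma sh_flip:
  "sh dg xs f = sh dg xs (\<lambda>b a. sg (eps (degs dg a) (degs dg b)) (f a b))"
proof (induction xs arbitrary: f)
  case (Cons x xs)
  let ?e = "\<lambda>a b. eps (degs dg a) (degs dg b)"
  have "sh dg xs (\<lambda>a. f (x # a)) = sh dg xs (\<lambda>b a. sg (?e a b) (f (x # a) b))"
    by (rule Cons.IH)
  also have "\<dots> = sh dg xs (\<lambda>b a. sg (eps (dg x) (degs dg b)) (sg (?e (x # a) b) (f (x # a) b)))"
    by (simp add: sg_simps eps_simps)
  finally have 1: "sh dg xs (\<lambda>a. f (x # a)) = \<dots>" .
  have "sh dg xs (\<lambda>a b. sg (eps (dg x) (degs dg a)) (f a (x # b)))
      = sh dg xs (\<lambda>b a. sg (?e a b) (sg (eps (dg x) (degs dg a)) (f a (x # b))))"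
    by (rule Cons.IH)
  also have "\<dots> = sh dg xs (\<lambda>b a. sg (?e a (x # b)) (f a (x # b)))"
    by (simp add: sg_simps eps_simps sg_commute eps_commute[of "dg x"])
  finally have 2: "sh dg xs (\<lambda>a b. sg (eps (dg x) (degs dg a)) (f a (x # b))) = \<dots>" .
  show ?case by (simp only: sh.simps 1 2 add.commute)
qed (simp add: eps_simps)

text \<open>Coassociativity: here and in \<open>sh_sh_right\<close> a split of one half is absorbed
  into a split into three parts, so that iterated products in either bracketing have a common
  form.\<close>

lemma sh_sh_left: "sh dg xs (\<lambda>ab c. sh dg ab (\<lambda>a b. f a b c)) = sh3 dg xs f"
proof (induction xs arbitrary: f)
  case (Cons x xs)
  have "sh dg xs (\<lambda>ab c. sg (eps (dg x) (degs dg ab)) (sh dg ab (\<lambda>a b. f a b (x # c))))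
      = sh dg xs (\<lambda>ab c. sh dg ab
          (\<lambda>a b. sg (eps (dg x) (degs dg a + degs dg b)) (f a b (x # c))))"
    by (auto intro!: sh_cong simp flip: sh_sg)
  then show ?case by (simp add: sh_add Cons.IH)
qed simp

lemma sh_sh_right: "sh dg xs (\<lambda>a bc. sh dg bc (\<lambda>b c. f a b c)) = sh3 dg xs f"
proof (induction xs arbitrary: f)
  case (Cons x xs)
  have "sh dg xs (\<lambda>a bc. sg (eps (dg x) (degs dg a)) (sh dg (x # bc) (\<lambda>b c. f a b c)))
      = sh dg xs (\<lambda>a bc. sh dg bc (\<lambda>b c. sg (eps (dg x) (degs dg a)) (f a (x # b) c)))
      + sh dg xs (\<lambda>a bc. sh dg bc
          (\<lambda>b c. sg (eps (dg x) (degs dg a + degs dg b)) (f a b (x # c))))"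
    unfolding sh_add[symmetric]
    by (auto intro!: sh_cong simp: sg_simps eps_simps sh_add simp flip: sh_sg)
  then show ?case by (simp add: Cons.IH)
qed simp

section \<open>Insertion calculus for graded alternating maps\<close>

text \<open>The carrier is kept along with the scaling because a module such as the dual occupies
  only part of its type.\<close>

type_synonym ('k, 'w) space = "('k \<Rightarrow> 'w \<Rightarrow> 'w) \<times> 'w set"

definition is_space :: "('k::field, 'w::ab_group_add) space \<Rightarrow> bool" where
  "is_space S \<longleftrightarrow> vector_space (fst S) \<and> module.subspace (fst S) (snd S)"

lemma is_spaceD:
  assumes "is_space S"
  shows "0 \<in> snd S" "x \<in> snd S \<Longrightarrow> y \<in> snd S \<Longrightarrow> x + y \<in> snd S" "x \<in> snd S \<Longrightarrow> - x \<in> snd S"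
    "x \<in> snd S \<Longrightarrow> fst S c x \<in> snd S" "x \<in> snd S \<Longrightarrow> sg n x \<in> snd S"
    "fst S c (x + y) = fst S c x + fst S c y" "fst S c 0 = 0" "fst S c (- x) = - fst S c x"
    "fst S c (sg n x) = sg n (fst S c x)" "fst S 1 x = x"
proof -
  interpret vector_space "fst S" using assms by (simp add: is_space_def)
  have "subspace (snd S)" using assms by (simp add: is_space_def)
  then show "0 \<in> snd S" "x \<in> snd S \<Longrightarrow> y \<in> snd S \<Longrightarrow> x + y \<in> snd S"
    "x \<in> snd S \<Longrightarrow> - x \<in> snd S" "x \<in> snd S \<Longrightarrow> fst S c x \<in> snd S"
    "x \<in> snd S \<Longrightarrow> sg n x \<in> snd S"
    by (simp_all add: subspace_0 subspace_add subspace_neg subspace_scale sg_def)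
  show "fst S c (x + y) = fst S c x + fst S c y" "fst S c 0 = 0" "fst S c (- x) = - fst S c x"
    "fst S c (sg n x) = sg n (fst S c x)" "fst S 1 x = x"
    by (simp_all add: scale_right_distrib sg_def)
qed

definition bilin ::
  "('k, 'u::ab_group_add) space \<Rightarrow> ('k, 'v::ab_group_add) space \<Rightarrow> ('k, 'w::ab_group_add) space
    \<Rightarrow> ('u \<Rightarrow> 'v \<Rightarrow> 'w) \<Rightarrow> bool" where
  "bilin S T U b \<longleftrightarrow>
     (\<forall>x\<in>snd S. \<forall>y\<in>snd T. b x y \<in> snd U \<and>
        (\<forall>x'\<in>snd S. b (x + x') y = b x y + b x' y) \<and> (\<forall>y'\<in>snd T. b x (y + y') = b x y + b x y') \<and>
        (\<forall>c. b (fst S c x) y = fst U c (b x y) \<and> b x (fst T c y) = fst U c (b x y)))"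

lemma bilinD:
  assumes "bilin S T U b" "is_space S" "is_space T" "x \<in> snd S" "y \<in> snd T"
  shows "b x y \<in> snd U" "x' \<in> snd S \<Longrightarrow> b (x + x') y = b x y + b x' y"
    "y' \<in> snd T \<Longrightarrow> b x (y + y') = b x y + b x y'"
    "b (fst S c x) y = fst U c (b x y)" "b x (fst T c y) = fst U c (b x y)"
    "b 0 y = 0" "b x 0 = 0" "b (- x) y = - b x y" "b x (- y) = - b x y"
    "b (sg n x) y = sg n (b x y)" "b x (sg n y) = sg n (b x y)"
proof -
  show "b x y \<in> snd U" "b (fst S c x) y = fst U c (b x y)" "b x (fst T c y) = fst U c (b x y)"
    using assms by (simp_all add: bilin_def)
  show l: "b (x + x') y = b x y + b x' y" if "x' \<in> snd S" for x'
    using assms that by (simp add: bilin_def)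
  show r: "b x (y + y') = b x y + b x y'" if "y' \<in> snd T" for y'
    using assms that by (simp add: bilin_def)
  have l0: "b 0 y = 0"
    using assms unfolding bilin_def by (metis add.right_neutral add_left_cancel is_spaceD(1))
  have r0: "b x 0 = 0"
    using assms unfolding bilin_def by (metis add.right_neutral add_left_cancel is_spaceD(1))
  have "b x y + b (- x) y = 0" "b x y + b x (- y) = 0"
    using l[of "- x"] r[of "- y"] l0 r0 assms by (simp_all add: is_spaceD)
  then show "b (- x) y = - b x y" "b x (- y) = - b x y"
    by (simp_all add: add_eq_0_iff)
  then show "b (sg n x) y = sg n (b x y)" "b x (sg n y) = sg n (b x y)"
    by (simp_all add: sg_def)
  show "b 0 y = 0" "b x 0 = 0" by (fact l0 r0)+
qed

text \<open>Contraction with the first letter: for a parameter it is the left partial derivative,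
  that is, extraction of a coefficient; for a vector it is the interior product.\<close>

definition cut :: "'x \<Rightarrow> ('x list \<Rightarrow> 'w) \<Rightarrow> 'x list \<Rightarrow> 'w" where
  "cut x F = (\<lambda>ws. F (x # ws))"

lemma cut_apply: "cut x F ws = F (x # ws)"
  by (simp add: cut_def)

lemma cut_simps [simp]:
  "cut x (F + G) = cut x F + cut x G" "cut x (F - G) = cut x F - cut x G"
  "cut x (- F) = - cut x F" "cut x (sg n F) = sg n (cut x F)"
  "cut x (pointwise s c F) = pointwise s c (cut x F)"
  by (auto simp: cut_def fun_eq_iff sg_apply pointwise_def)

abbreviation nu :: grade where "nu \<equiv> (0, 1)"

locale insertion_calculus =
  fixes d :: "nat \<Rightarrow> int" and MS :: "('k::field, 'm::ab_group_add) space"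
  assumes MS: "is_space MS"
begin

text \<open>
  The letter \<open>Inl i\<close> is the parameter \<open>\<eta>\<^sub>i\<close>; its grade makes the product of \<open>\<eta>\<^sub>i\<close> with a form of
  degree \<open>d i\<close> have grade \<open>(1, 0)\<close> for every \<open>i\<close>. A letter \<open>Inr v\<close> is a vector.
\<close>

definition dg :: "nat + 'm \<Rightarrow> grade" where
  "dg w = (case w of Inl i \<Rightarrow> (1, - d i) | Inr _ \<Rightarrow> nu)"

lemma dg_simps [simp]: "dg (Inl i) = (1, - d i)" "dg (Inr v) = nu"
  by (simp_all add: dg_def)

text \<open>
  \<open>Om S \<gamma> F\<close>: as a function of words, \<open>F\<close> is \<open>S\<close>-valued, homogeneous of grade \<open>\<gamma>\<close>, graded alternating
  and linear in the vectors. \<open>pr b\<close> is the wedge product along \<open>b\<close>. The argument \<open>v\<close> of \<open>D\<close> occupies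
  one vector slot, so \<open>D v\<close> has grade \<open>\<gamma> - nu\<close> if \<open>v\<close> has grade \<open>\<gamma>\<close>.
\<close>

definition Om ::
  "('k, 'w::ab_group_add) space \<Rightarrow> grade \<Rightarrow> ((nat + 'm) list \<Rightarrow> 'w) \<Rightarrow> bool" where
  "Om S \<gamma> F \<longleftrightarrow> is_space S \<and> (\<forall>ws. F ws \<in> snd S) \<and>
     (\<forall>ws. F ws \<noteq> 0 \<longrightarrow> degs dg ws = \<gamma> \<and> Inr -` set ws \<subseteq> snd MS) \<and>
     (\<forall>a x y b. F (a @ x # y # b) = sg (eps (dg x) (dg y)) (F (a @ y # x # b))) \<and>
     (\<forall>a b. \<forall>u\<in>snd MS. \<forall>v\<in>snd MS. \<forall>c.
        F (a @ Inr (fst MS c u + v) # b) = fst S c (F (a @ Inr u # b)) + F (a @ Inr v # b))"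

definition pr :: "('u \<Rightarrow> 'v \<Rightarrow> 'w) \<Rightarrow> ((nat + 'm) list \<Rightarrow> 'u) \<Rightarrow> ((nat + 'm) list \<Rightarrow> 'v)
    \<Rightarrow> (nat + 'm) list \<Rightarrow> 'w::ab_group_add" where
  "pr b F G = (\<lambda>ws. sh dg ws (\<lambda>x y. b (F x) (G y)))"

definition D :: "((nat + 'm) list \<Rightarrow> 'm) \<Rightarrow> ((nat + 'm) list \<Rightarrow> 'w)
    \<Rightarrow> (nat + 'm) list \<Rightarrow> 'w::ab_group_add" where
  "D v F = (\<lambda>ws. sh dg ws (\<lambda>x y. F (Inr (v x) # y)))"

lemma OmD:
  assumes "Om S \<gamma> F"
  shows "is_space S" "F ws \<in> snd S" "F ws \<noteq> 0 \<Longrightarrow> degs dg ws = \<gamma>"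
    "F ws \<noteq> 0 \<Longrightarrow> Inr v \<in> set ws \<Longrightarrow> v \<in> snd MS"
    "F (a @ x # y # b) = sg (eps (dg x) (dg y)) (F (a @ y # x # b))"
    "F (x # y # b) = sg (eps (dg x) (dg y)) (F (y # x # b))"
    "u \<in> snd MS \<Longrightarrow> v \<in> snd MS \<Longrightarrow>
       F (a @ Inr (fst MS c u + v) # b) = fst S c (F (a @ Inr u # b)) + F (a @ Inr v # b)"
    "u \<in> snd MS \<Longrightarrow> v \<in> snd MS \<Longrightarrow>
       F (Inr (fst MS c u + v) # b) = fst S c (F (Inr u # b)) + F (Inr v # b)"
proof -
  show "is_space S" "F ws \<in> snd S" "F ws \<noteq> 0 \<Longrightarrow> degs dg ws = \<gamma>"
    "F ws \<noteq> 0 \<Longrightarrow> Inr v \<in> set ws \<Longrightarrow> v \<in> snd MS"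
    using assms unfolding Om_def by blast+
  show sym: "F (a @ x # y # b) = sg (eps (dg x) (dg y)) (F (a @ y # x # b))" for a
    using assms unfolding Om_def by blast
  show lin: "u \<in> snd MS \<Longrightarrow> v \<in> snd MS \<Longrightarrow>
       F (a @ Inr (fst MS c u + v) # b) = fst S c (F (a @ Inr u # b)) + F (a @ Inr v # b)" for a
    using assms unfolding Om_def by blast
  show "F (x # y # b) = sg (eps (dg x) (dg y)) (F (y # x # b))" using sym[of "[]"] by simp
  show "u \<in> snd MS \<Longrightarrow> v \<in> snd MS \<Longrightarrow>
       F (Inr (fst MS c u + v) # b) = fst S c (F (Inr u # b)) + F (Inr v # b)"
    using lin[of "[]"] by simp
qed

lemma Om_linear:
  assumes "Om S \<gamma> F"
  shows "u \<in> snd MS \<Longrightarrow> v \<in> snd MS \<Longrightarrow> F (Inr (u + v) # b) = F (Inr u # b) + F (Inr v # b)"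
    "F (Inr 0 # b) = 0"
    "u \<in> snd MS \<Longrightarrow> F (Inr (fst MS c u) # b) = fst S c (F (Inr u # b))"
    "u \<in> snd MS \<Longrightarrow> F (Inr (- u) # b) = - F (Inr u # b)"
    "u \<in> snd MS \<Longrightarrow> F (Inr (sg n u) # b) = sg n (F (Inr u # b))"
proof -
  note S = is_spaceD[OF OmD(1)[OF assms]] and M = is_spaceD[OF MS]
  show add: "F (Inr (u + v) # b) = F (Inr u # b) + F (Inr v # b)"
    if "u \<in> snd MS" "v \<in> snd MS" for u v
    using OmD(8)[OF assms that, of 1 b] S(10) M(10) by simp
  show z: "F (Inr 0 # b) = 0" using add[of 0 0] M(1) by simp
  show "u \<in> snd MS \<Longrightarrow> F (Inr (fst MS c u) # b) = fst S c (F (Inr u # b))"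
    using OmD(8)[OF assms _ M(1), of u c b] z by simp
  show neg: "u \<in> snd MS \<Longrightarrow> F (Inr (- u) # b) = - F (Inr u # b)"
    using add[of u "- u"] z M(3) by (simp add: add_eq_0_iff)
  show "u \<in> snd MS \<Longrightarrow> F (Inr (sg n u) # b) = sg n (F (Inr u # b))"
    using neg by (simp add: sg_def)
qed

lemma Om_cut: "Om S \<gamma> F \<Longrightarrow> Om S (\<gamma> - dg x) (cut x F)"
  unfolding Om_def cut_def
  apply (intro conjI; (elim conjE)?)
      apply blast
     apply blast
    apply (fastforce simp: algebra_simps)
   apply (metis append_Cons)
  apply (metis append_Cons)
  done

lemma OmI:
  assumes "is_space S" "\<And>ws. F ws \<in> snd S" "\<And>ws. F ws \<noteq> 0 \<Longrightarrow> degs dg ws = \<gamma>"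
    "\<And>ws v. F ws \<noteq> 0 \<Longrightarrow> Inr v \<in> set ws \<Longrightarrow> v \<in> snd MS"
    "\<And>a x y b. F (a @ x # y # b) = sg (eps (dg x) (dg y)) (F (a @ y # x # b))"
    "\<And>a b u v c. u \<in> snd MS \<Longrightarrow> v \<in> snd MS \<Longrightarrow>
       F (a @ Inr (fst MS c u + v) # b) = fst S c (F (a @ Inr u # b)) + F (a @ Inr v # b)"
  shows "Om S \<gamma> F"
  unfolding Om_def using assms by blast

lemma Om_add:
  assumes "Om S \<gamma> F" "Om S \<gamma> G"
  shows "Om S \<gamma> (F + G)"
proof (rule OmI)
  note F = OmD[OF assms(1)] and G = OmD[OF assms(2)]
  show "is_space S" by (fact F)
  show "(F + G) ws \<in> snd S" for ws using F(2) G(2) by (simp add: is_spaceD(2)[OF F(1)])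
  show "degs dg ws = \<gamma>" if "(F + G) ws \<noteq> 0" for ws using F(3)[of ws] G(3)[of ws] that by fastforce
  show "v \<in> snd MS" if "(F + G) ws \<noteq> 0" "Inr v \<in> set ws" for ws v
    using F(4)[of ws v] G(4)[of ws v] that by fastforce
  show "(F + G) (a @ x # y # b) = sg (eps (dg x) (dg y)) ((F + G) (a @ y # x # b))" for a x y b
    using F(5)[of a x y b] G(5)[of a x y b] by (simp add: sg_simps)
  show "(F + G) (a @ Inr (fst MS c u + v) # b) = fst S c ((F + G) (a @ Inr u # b)) + (F + G) (a @ Inr v # b)"
    if "u \<in> snd MS" "v \<in> snd MS" for a b u v c
    using F(7)[OF that, of a c b] G(7)[OF that, of a c b] is_spaceD(6)[OF F(1)] by simp
qed

lemma Om_pointwise: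
  assumes "Om S \<gamma> F"
  shows "Om S \<gamma> (pointwise (fst S) c F)"
proof (rule OmI)
  note F = OmD[OF assms] and S = is_spaceD[OF OmD(1)[OF assms]]
  interpret vector_space "fst S" using F(1) by (simp add: is_space_def)
  show "is_space S" by (fact F)
  show "pointwise (fst S) c F ws \<in> snd S" for ws using F(2) S(4) by (simp add: pointwise_def)
  show "degs dg ws = \<gamma>" if "pointwise (fst S) c F ws \<noteq> 0" for ws
    using F(3)[of ws] that by (auto simp: pointwise_def)
  show "v \<in> snd MS" if "pointwise (fst S) c F ws \<noteq> 0" "Inr v \<in> set ws" for ws v
    using F(4)[of ws v] that by (auto simp: pointwise_def)
  show "pointwise (fst S) c F (a @ x # y # b) = sg (eps (dg x) (dg y)) (pointwise (fst S) c F (a @ y # x # b))"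
    for a x y b using F(5)[of a x y b] S(9) by (simp add: pointwise_def)
  show "pointwise (fst S) c F (a @ Inr (fst MS e u + v) # b)
      = fst S e (pointwise (fst S) c F (a @ Inr u # b)) + pointwise (fst S) c F (a @ Inr v # b)"
    if "u \<in> snd MS" "v \<in> snd MS" for a b u v e
    using F(7)[OF that, of a e b] S(6) by (simp add: pointwise_def mult.commute)
qed

lemma Om_uminus:
  assumes "Om S \<gamma> F"
  shows "Om S \<gamma> (- F)"
proof -
  interpret vector_space "fst S" using OmD(1)[OF assms] by (simp add: is_space_def)
  have "- F = pointwise (fst S) (- 1) F" by (simp add: pointwise_def fun_eq_iff)
  then show ?thesis using Om_pointwise[OF assms] by simp
qed

lemma Om_sg: "Om S \<gamma> F \<Longrightarrow> Om S \<gamma> (sg n F)"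
  by (simp add: sg_def Om_uminus)

lemma Om_diff: "Om S \<gamma> F \<Longrightarrow> Om S \<gamma> G \<Longrightarrow> Om S \<gamma> (F - G)"
  using Om_add[of S \<gamma> F "- G"] Om_uminus[of S \<gamma> G] by simp

lemma Om_zero: "is_space S \<Longrightarrow> Om S \<gamma> 0"
  unfolding Om_def by (auto simp: is_spaceD)

lemma cut_cut: "Om S \<gamma> F \<Longrightarrow> cut y (cut x F) = sg (eps (dg x) (dg y)) (cut x (cut y F))"
  unfolding cut_def by (rule ext) (unfold sg_apply, rule OmD(6))

lemma cut_linear:
  assumes "Om S \<gamma> F" "u \<in> snd MS" "v \<in> snd MS"
  shows "cut (Inr (fst MS c u + v)) F = pointwise (fst S) c (cut (Inr u) F) + cut (Inr v) F"
  using OmD(8)[OF assms] by (auto simp: cut_def fun_eq_iff pointwise_def)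

text \<open>The recursion of \<open>sh\<close> on the first letter already is a Leibniz rule.
  Homogeneity replaces the grade of the word passed over by the constant \<alpha>, as
  \<open>F\<close> vanishes on words of any other grade.\<close>

lemma cut_pr:
  assumes "Om S \<alpha> F" "Om T \<beta> G" "bilin S T U b"
  shows "cut x (pr b F G) = pr b (cut x F) G + sg (eps (dg x) \<alpha>) (pr b F (cut x G))"
proof
  fix ws
  note F = OmD[OF assms(1)] and G = OmD[OF assms(2)]
  have "sg (eps (dg x) (degs dg a)) (b (F a) (G (x # c))) = sg (eps (dg x) \<alpha>) (b (F a) (G (x # c)))"
    for a c
    using F(3)[of a] bilinD(6)[OF assms(3) F(1) G(1) F(2)[of a] G(2)[of "x # c"]]
    by (cases "F a = 0") simp_all
  then show "cut x (pr b F G) ws = (pr b (cut x F) G + sg (eps (dg x) \<alpha>) (pr b F (cut x G))) ws"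
    by (simp add: pr_def cut_def sg_apply sh_sg)
qed

text \<open>The letter either enters the word of \<open>v\<close> or remains an argument of
  \<open>F\<close>. In the second case it passes that word and the inserted vector, which accounts
  for \<gamma> + nu.\<close>

lemma cut_D:
  assumes "Om MS \<gamma> v" "Om S \<alpha> F"
  shows "cut x (D v F) = D (cut x v) F + sg (eps (dg x) (\<gamma> + nu)) (D v (cut x F))"
proof
  fix ws
  note v = OmD[OF assms(1)] and F = OmD[OF assms(2)]
  have "sg (eps (dg x) (degs dg a)) (F (Inr (v a) # x # c))
      = sg (eps (dg x) (\<gamma> + nu)) (F (x # Inr (v a) # c))" for a c
  proof (cases "v a = 0")
    case True
    then show ?thesis
      using F(6)[of x "Inr 0" c] Om_linear(2)[OF assms(2)] by simp
  next
    case False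
    then show ?thesis
      using F(6)[of "Inr (v a)" x c] v(3)[of a] by (simp add: sg_norm eps_commute[of nu])
  qed
  then show "cut x (D v F) ws = (D (cut x v) F + sg (eps (dg x) (\<gamma> + nu)) (D v (cut x F))) ws"
    by (simp add: D_def cut_def sg_apply sh_sg)
qed

lemma pr_linear:
  assumes "bilin S T U b" "Om S \<alpha> F" "Om S \<alpha>' F'" "Om T \<beta> G" "Om T \<beta>' G'" "is_space U"
  shows "pr b (F + F') G = pr b F G + pr b F' G" "pr b F (G + G') = pr b F G + pr b F G'"
    "pr b (F - F') G = pr b F G - pr b F' G" "pr b F (G - G') = pr b F G - pr b F G'"
    "pr b (- F) G = - pr b F G" "pr b F (- G) = - pr b F G"
    "pr b (sg n F) G = sg n (pr b F G)" "pr b F (sg n G) = sg n (pr b F G)"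
    "pr b (pointwise (fst S) c F) G = pointwise (fst U) c (pr b F G)"
    "pr b F (pointwise (fst T) c G) = pointwise (fst U) c (pr b F G)"
proof -
  note F = OmD[OF assms(2)] and F' = OmD[OF assms(3)]
    and G = OmD[OF assms(4)] and G' = OmD[OF assms(5)]
  note b = bilinD[OF assms(1) F(1) G(1)]
  have "b (- F' x) (G y) = - b (F' x) (G y)" "b (F x) (- G' y) = - b (F x) (G' y)" for x y
    by (rule b(8)[OF F'(2) G(2)] b(9)[OF F(2) G'(2)])+
  then have diff: "b (F x - F' x) (G y) = b (F x) (G y) - b (F' x) (G y)"
    "b (F x) (G y - G' y) = b (F x) (G y) - b (F x) (G' y)" for x y
    using b(2)[OF F(2) G(2) is_spaceD(3)[OF F(1) F'(2)]]
      b(3)[OF F(2) G(2) is_spaceD(3)[OF G(1) G'(2)]] by simp_all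
  show "pr b (F + F') G = pr b F G + pr b F' G" "pr b F (G + G') = pr b F G + pr b F G'"
    by (simp_all only: pr_def fun_eq_iff plus_fun_apply b(2)[OF F(2) G(2) F'(2)]
        b(3)[OF F(2) G(2) G'(2)] sh_add simp_thms)
  show "pr b (F - F') G = pr b F G - pr b F' G" "pr b F (G - G') = pr b F G - pr b F G'"
    by (simp_all only: pr_def fun_eq_iff fun_diff_def diff sh_diff simp_thms)
  show neg: "pr b (- F) G = - pr b F G" "pr b F (- G) = - pr b F G"
    by (simp_all only: pr_def fun_eq_iff fun_Compl_def b(8)[OF F(2) G(2)] b(9)[OF F(2) G(2)]
        sh_minus simp_thms)
  show "pr b (sg n F) G = sg n (pr b F G)" "pr b F (sg n G) = sg n (pr b F G)"
    using neg by (simp_all add: sg_def)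
  show "pr b (pointwise (fst S) c F) G = pointwise (fst U) c (pr b F G)"
    "pr b F (pointwise (fst T) c G) = pointwise (fst U) c (pr b F G)"
    using b F(2) G(2) is_spaceD(6)[OF assms(6)]
    by (simp_all add: pr_def fun_eq_iff pointwise_def sh_hom[of "fst U c"])
qed

lemma D_linear_right:
  fixes F G :: "(nat + 'm) list \<Rightarrow> 'w::ab_group_add"
  shows "D v (F + G) = D v F + D v G" "D v (F - G) = D v F - D v G" "D v (- F) = - D v F"
    "D v (sg n F) = sg n (D v F)"
    "is_space S \<Longrightarrow> D v (pointwise (fst S) c F) = pointwise (fst S) c (D v F)"
proof -
  show add: "D v (F + G) = D v F + D v G" for F G :: "(nat + 'm) list \<Rightarrow> 'w" by (simp add: D_def fun_eq_iff sh_add)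
  show neg: "D v (- F) = - D v F" for F :: "(nat + 'm) list \<Rightarrow> 'w"
    by (simp add: D_def fun_eq_iff sh_minus)
  show "D v (F - G) = D v F - D v G" using add[of F "- G"] neg by simp
  show "D v (sg n F) = sg n (D v F)" using neg by (simp add: sg_def)
  show "is_space S \<Longrightarrow> D v (pointwise (fst S) c F) = pointwise (fst S) c (D v F)"
    by (simp add: D_def fun_eq_iff pointwise_def is_spaceD sh_hom[of "fst S c"])
qed

lemma D_linear_left:
  assumes "Om S \<alpha> F" "Om MS \<gamma> v" "Om MS \<delta> w"
  shows "D (v + w) F = D v F + D w F" "D (v - w) F = D v F - D w F" "D (- v) F = - D v F"
    "D (sg n v) F = sg n (D v F)"
    "D (pointwise (fst MS) c v) F = pointwise (fst S) c (D v F)"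
proof -
  note v = OmD(2)[OF assms(2)] and w = OmD(2)[OF assms(3)] and F = Om_linear[OF assms(1)]
  show "D (v + w) F = D v F + D w F" by (simp add: D_def fun_eq_iff F v w sh_add)
  show neg: "D (- v) F = - D v F" by (simp add: D_def fun_eq_iff F v sh_minus)
  show "D (v - w) F = D v F - D w F"
    using F(1)[OF v is_spaceD(3)[OF MS w]] F(4)[OF w]
    by (simp add: D_def fun_eq_iff v w is_spaceD(3)[OF MS] sh_diff)
  show "D (sg n v) F = sg n (D v F)" using neg by (simp add: sg_def)
  show "D (pointwise (fst MS) c v) F = pointwise (fst S) c (D v F)"
    using OmD(1)[OF assms(1)]
    by (simp add: D_def fun_eq_iff pointwise_def F v is_spaceD sh_hom[of "fst S c"])
qed

lemma sh_mem:
  assumes "is_space S" "\<And>a b. f a b \<in> snd S"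
  shows "sh dg' ws f \<in> snd S"
  using assms(2) by (induction ws arbitrary: f) (simp_all add: is_spaceD[OF assms(1)])

lemma sh_nonzero:
  assumes "sh dg' ws f \<noteq> 0"
  obtains a b where "f a b \<noteq> 0" "degs dg' a + degs dg' b = degs dg' ws" "set a \<union> set b = set ws"
  using sh_cong[of dg' ws f "\<lambda>a b. 0"] assms by fastforce

lemma pr_Cons:
  assumes "Om S \<alpha> F" "Om T \<beta> G" "bilin S T U b"
  shows "pr b F G (x # ws) = pr b (cut x F) G ws + sg (eps (dg x) \<alpha>) (pr b F (cut x G) ws)"
  using fun_cong[OF cut_pr[OF assms], of x ws]
  by (simp add: cut_apply[of x "pr b F G"] sg_apply del: cut_simps)

lemma D_Cons:
  assumes "Om MS \<gamma> v" "Om S \<alpha> F"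
  shows "D v F (x # ws) = D (cut x v) F ws + sg (eps (dg x) (\<gamma> + nu)) (D v (cut x F) ws)"
  using fun_cong[OF cut_D[OF assms], of x ws]
  by (simp add: cut_apply[of x "D v F"] sg_apply del: cut_simps)

text \<open>Only the empty prefix has content. There two cuts give four terms: those with both
  letters in one factor are handled by \<open>cut_cut\<close>, and the two mixed ones change
  places.\<close>

lemma pr_swap:
  assumes "Om S \<alpha> F" "Om T \<beta> G" "bilin S T U b" "is_space U"
  shows "pr b F G (p @ x # y # q) = sg (eps (dg x) (dg y)) (pr b F G (p @ y # x # q))"
  using assms(1,2)
proof (induction p arbitrary: F G \<alpha> \<beta>)
  case Nil
  note cF = Om_cut[OF Nil(1)] and cG = Om_cut[OF Nil(2)]
  note lin = pr_linear(8,7)[OF assms(3) _ _ _ _ assms(4)]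
  have *: "cut y (cut x (pr b F G))
      = pr b (cut y (cut x F)) G + sg (eps (dg y) \<alpha> + eps (dg x) (dg y)) (pr b (cut x F) (cut y G))
      + sg (eps (dg x) \<alpha>) (pr b (cut y F) (cut x G)) + sg (eps (dg x) \<alpha> + eps (dg y) \<alpha>) (pr b F (cut y (cut x G)))"
    for x y
    by (simp add: cut_pr[OF Nil(1,2) assms(3)] cut_pr[OF cF Nil(2) assms(3)]
        cut_pr[OF Nil(1) cG assms(3)] sg_norm eps_commute[of "dg y" "dg x"] add.assoc)
  have "cut y (cut x (pr b F G)) = sg (eps (dg x) (dg y)) (cut x (cut y (pr b F G)))"
    unfolding * cut_cut[OF Nil(1), of y x] cut_cut[OF Nil(2), of y x]
      lin[OF Om_cut[OF cF] Om_cut[OF cF] Nil(2) Nil(2)] lin[OF Nil(1) Nil(1) Om_cut[OF cG] Om_cut[OF cG]]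
    by (simp add: sg_norm eps_commute[of "dg y" "dg x"] ac_simps)
  then show ?case by (simp add: cut_def fun_eq_iff sg_apply)
next
  case (Cons z p)
  note * = pr_Cons[OF Cons.prems assms(3), of z]
  show ?case
    by (simp add: * sg_simps sg_apply Cons.IH[OF Om_cut[OF Cons.prems(1)] Cons.prems(2)]
        Cons.IH[OF Cons.prems(1) Om_cut[OF Cons.prems(2)]] sg_commute)
qed

lemma pr_slot_linear:
  assumes "Om S \<alpha> F" "Om T \<beta> G" "bilin S T U b" "is_space U" "u \<in> snd MS" "v \<in> snd MS"
  shows "pr b F G (p @ Inr (fst MS c u + v) # q)
    = fst U c (pr b F G (p @ Inr u # q)) + pr b F G (p @ Inr v # q)"
  using assms(1,2)
proof (induction p arbitrary: F G \<alpha> \<beta>)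
  case Nil
  note uv = assms(5,6) and U = is_spaceD[OF assms(4)]
  note cF = Om_cut[OF Nil(1), of "Inr _", simplified] and cG = Om_cut[OF Nil(2), of "Inr _", simplified]
  note pF = Om_pointwise[OF cF] and pG = Om_pointwise[OF cG]
  note l1 = pr_linear(1,9)[OF assms(3) _ _ Nil(2) Nil(2) assms(4)]
    and l2 = pr_linear(2,10)[OF assms(3) Nil(1) Nil(1) _ _ assms(4)]
  have "cut (Inr (fst MS c u + v)) (pr b F G)
      = pointwise (fst U) c (cut (Inr u) (pr b F G)) + cut (Inr v) (pr b F G)"
    unfolding cut_pr[OF Nil(1,2) assms(3)] cut_linear[OF Nil(1) uv] cut_linear[OF Nil(2) uv]
      l1[OF pF cF] l1[OF cF cF] l2[OF pG cG] l2[OF cG cG]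
    by (simp add: fun_eq_iff pointwise_def sg_apply sg_simps U)
  then show ?case by (simp add: cut_def fun_eq_iff pointwise_def)
next
  case (Cons z p)
  note * = pr_Cons[OF Cons.prems assms(3), of z]
  show ?case
    by (simp add: * sg_simps sg_apply Cons.IH[OF Om_cut[OF Cons.prems(1)] Cons.prems(2)]
        Cons.IH[OF Cons.prems(1) Om_cut[OF Cons.prems(2)]] is_spaceD[OF assms(4)])
qed

lemma Om_pr:
  assumes "Om S \<alpha> F" "Om T \<beta> G" "bilin S T U b" "is_space U"
  shows "Om U (\<alpha> + \<beta>) (pr b F G)"
proof (rule OmI)
  note F = OmD[OF assms(1)] and G = OmD[OF assms(2)]
  note b = bilinD[OF assms(3) F(1) G(1) F(2) G(2)]
  show "is_space U" by fact
  show "pr b F G ws \<in> snd U" for ws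
    unfolding pr_def by (rule sh_mem[OF assms(4)]) (rule b)
  fix ws assume "pr b F G ws \<noteq> 0"
  then obtain x y where *: "b (F x) (G y) \<noteq> 0" "degs dg x + degs dg y = degs dg ws"
    "set x \<union> set y = set ws" unfolding pr_def by (rule sh_nonzero)
  have "F x \<noteq> 0" "G y \<noteq> 0" using *(1) bilinD(6,7)[OF assms(3) F(1) G(1) F(2) G(2)] by metis+
  then show "degs dg ws = \<alpha> + \<beta>" and "\<And>v. Inr v \<in> set ws \<Longrightarrow> v \<in> snd MS"
    using F(3,4) G(3,4) *(2,3) by (metis, metis Un_iff)
qed (rule pr_swap[OF assms] pr_slot_linear[OF assms]; assumption)+

lemma D_swap:
  assumes "Om MS \<gamma> v" "Om S \<alpha> F"
  shows "D v F (p @ x # y # q) = sg (eps (dg x) (dg y)) (D v F (p @ y # x # q))"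
  using assms(1,2)
proof (induction p arbitrary: v F \<gamma> \<alpha>)
  case Nil
  note cv = Om_cut[OF Nil(1)] and cF = Om_cut[OF Nil(2)]
  have *: "cut y (cut x (D v F))
      = D (cut y (cut x v)) F + sg (eps (dg y) (\<gamma> + nu) + eps (dg x) (dg y)) (D (cut x v) (cut y F))
      + sg (eps (dg x) (\<gamma> + nu)) (D (cut y v) (cut x F)) + sg (eps (dg x) (\<gamma> + nu) + eps (dg y) (\<gamma> + nu)) (D v (cut y (cut x F)))"
    for x y
    by (simp add: cut_D[OF Nil(1,2)] cut_D[OF cv Nil(2)]
        cut_D[OF Nil(1) cF] sg_norm eps_commute[of "dg y" "dg x"] add.assoc)
  have "cut y (cut x (D v F)) = sg (eps (dg x) (dg y)) (cut x (cut y (D v F)))"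
    unfolding * cut_cut[OF Nil(1), of y x] cut_cut[OF Nil(2), of y x]
      D_linear_right D_linear_left[OF Nil(2) Om_cut[OF cv] Om_cut[OF cv]]
    by (simp add: sg_norm eps_commute[of "dg y" "dg x"] ac_simps)
  then show ?case by (simp add: cut_def fun_eq_iff sg_apply)
next
  case (Cons z p)
  note * = D_Cons[OF Cons.prems, of z]
  show ?case
    by (simp add: * sg_simps sg_apply Cons.IH[OF Om_cut[OF Cons.prems(1)] Cons.prems(2)]
        Cons.IH[OF Cons.prems(1) Om_cut[OF Cons.prems(2)]] sg_commute)
qed

lemma D_slot_linear:
  assumes "Om MS \<gamma> w" "Om S \<alpha> F" "u \<in> snd MS" "v \<in> snd MS"
  shows "D w F (p @ Inr (fst MS c u + v) # q)
    = fst S c (D w F (p @ Inr u # q)) + D w F (p @ Inr v # q)"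
  using assms(1,2)
proof (induction p arbitrary: w F \<gamma> \<alpha>)
  case Nil
  note uv = assms(3,4) and S = is_spaceD[OF OmD(1)[OF Nil(2)]]
  note cw = Om_cut[OF Nil(1), of "Inr _", simplified] and cF = Om_cut[OF Nil(2), of "Inr _", simplified]
  note pw = Om_pointwise[OF cw]
  have "cut (Inr (fst MS c u + v)) (D w F)
      = pointwise (fst S) c (cut (Inr u) (D w F)) + cut (Inr v) (D w F)"
    unfolding cut_D[OF Nil(1,2)] cut_linear[OF Nil(1) uv] cut_linear[OF Nil(2) uv]
      D_linear_left[OF Nil(2) pw cw] D_linear_left(5)[OF Nil(2) cw cw]
      D_linear_right(1) D_linear_right(5)[OF OmD(1)[OF Nil(2)]]
    by (simp add: fun_eq_iff pointwise_def sg_apply sg_simps S)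
  then show ?case by (simp add: cut_def fun_eq_iff pointwise_def)
next
  case (Cons z p)
  note * = D_Cons[OF Cons.prems, of z]
  show ?case
    by (simp add: * sg_simps sg_apply Cons.IH[OF Om_cut[OF Cons.prems(1)] Cons.prems(2)]
        Cons.IH[OF Cons.prems(1) Om_cut[OF Cons.prems(2)]] is_spaceD[OF OmD(1)[OF Cons.prems(2)]])
qed

lemma Om_D:
  assumes "Om MS \<gamma> v" "Om S \<alpha> F"
  shows "Om S (\<gamma> - nu + \<alpha>) (D v F)"
proof (rule OmI)
  note v = OmD[OF assms(1)] and F = OmD[OF assms(2)]
  show "is_space S" by (fact F)
  show "D v F ws \<in> snd S" for ws
    unfolding D_def by (rule sh_mem[OF F(1)]) (rule F)
  fix ws assume "D v F ws \<noteq> 0"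
  then obtain x y where *: "F (Inr (v x) # y) \<noteq> 0" "degs dg x + degs dg y = degs dg ws"
    "set x \<union> set y = set ws" unfolding D_def by (rule sh_nonzero)
  have "v x \<noteq> 0" using *(1) Om_linear(2)[OF assms(2)] by auto
  with F(3)[OF *(1)] v(3)[of x] *(2) have "degs dg ws + nu = \<gamma> + \<alpha>"
    by (simp add: algebra_simps) (metis add.assoc add.commute)
  then show "degs dg ws = \<gamma> - nu + \<alpha>" by (metis add_diff_cancel_right' add_diff_eq diff_add_eq)
  show "\<And>w. Inr w \<in> set ws \<Longrightarrow> w \<in> snd MS"
    using F(4)[OF *(1)] v(4) \<open>v x \<noteq> 0\<close> *(3) by (metis Un_iff list.set_intros(2))
qed (rule D_swap[OF assms] D_slot_linear[OF assms]; assumption)+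

text \<open>
  Here and below identities between functions of words are proved by induction on the word:
  cutting off the first letter is itself a derivation, by \<open>cut_pr\<close> and \<open>cut_D\<close>.
\<close>

lemma D_pr:
  assumes "Om MS \<gamma> v" "Om S \<alpha> F" "Om T \<beta> G" "bilin S T U b" "is_space U"
  shows "D v (pr b F G) = pr b (D v F) G + sg (eps (\<gamma> + nu) \<alpha>) (pr b F (D v G))"
proof
  fix ws
  show "D v (pr b F G) ws = (pr b (D v F) G + sg (eps (\<gamma> + nu) \<alpha>) (pr b F (D v G))) ws"
    using assms(1-3)
  proof (induction ws arbitrary: v F G \<gamma> \<alpha> \<beta>)
    case Nil
    note F = OmD[OF Nil(2)] and G = OmD[OF Nil(3)]
    \<comment> \<open>A homogeneous \<open>F\<close> that is non-zero at the empty word has grade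
      zero, so the sign is trivial whenever it matters.\<close>
    have "sg (eps (\<gamma> + nu) \<alpha>) (b (F []) y) = b (F []) y" if "y \<in> snd T" for y
      using F(3)[of "[]"] bilinD(6)[OF assms(4) F(1) G(1) F(2)[of "[]"] that]
      by (cases "F [] = 0") (simp_all add: eps_simps flip: zero_prod_def)
    then show ?case using G(2) by (simp add: D_def pr_def sg_apply eps_simps flip: zero_prod_def)
  next
    case (Cons x ws)
    note v = Cons.prems(1) and F = Cons.prems(2) and G = Cons.prems(3)
    note cv = Om_cut[OF v, of x] and cF = Om_cut[OF F, of x] and cG = Om_cut[OF G, of x]
    note b = assms(4,5)
    show ?case
      unfolding D_Cons[OF v Om_pr[OF F G b]] cut_pr[OF F G b(1)] D_linear_right
          Cons.IH[OF cv F G] Cons.IH[OF v cF G] Cons.IH[OF v F cG]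
          pr_Cons[OF Om_D[OF v F] G b(1)] pr_Cons[OF F Om_D[OF v G] b(1)]
          cut_D[OF v F] cut_D[OF v G]
          pr_linear(1)[OF b(1) Om_D[OF cv F] Om_sg[OF Om_D[OF v cF]] G G b(2)]
          pr_linear(2)[OF b(1) F F Om_D[OF cv G] Om_sg[OF Om_D[OF v cG]] b(2)]
          pr_linear(7)[OF b(1) Om_D[OF v cF] Om_D[OF v cF] G G b(2)]
          pr_linear(8)[OF b(1) F F Om_D[OF v cG] Om_D[OF v cG] b(2)]
        plus_fun_apply sg_apply
      by (simp add: sg_apply sg_norm eps_commute[of nu "dg x"] eps_commute[of \<gamma> "dg x"] ac_simps)
  qed
qed

text \<open>Apart from \<open>D (D v w) F\<close>, the composition inserts \<open>v\<close> and
  \<open>w\<close> into separate slots of \<open>F\<close>, and this second-order part is graded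
  symmetric. The shift by \<open>nu\<close> appears because each inserted vector moves together with
  its slot.\<close>

lemma D_D:
  assumes "Om MS \<gamma> v" "Om MS \<delta> w" "Om S \<alpha> F"
  defines "e \<equiv> \<lambda>\<gamma> \<delta>. eps (\<gamma> + nu) (\<delta> + nu)"
  shows "D v (D w F) = D (D v w) F + sg (e \<gamma> \<delta>) (D w (D v F) - D (D w v) F)"
proof
  fix ws
  show "D v (D w F) ws = (D (D v w) F + sg (e \<gamma> \<delta>) (D w (D v F) - D (D w v) F)) ws"
    using assms(1-3)
  proof (induction ws arbitrary: v w F \<gamma> \<delta> \<alpha>)
    case Nil
    note v = OmD[OF Nil(1)] and w = OmD[OF Nil(2)] and F = OmD[OF Nil(3)]
    have "F [Inr (w []), Inr (v [])] = sg (e \<gamma> \<delta>) (F [Inr (v []), Inr (w [])])"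
    proof (cases "v [] = 0 \<or> w [] = 0")
      case True
      have "F [x, Inr 0] = 0" for x
        using F(6)[of x "Inr 0" "[]"] Om_linear(2)[OF Nil(3)] by simp
      with True show ?thesis using Om_linear(2)[OF Nil(3)] by auto
    next
      case False
      \<comment> \<open>Non-zero values at the empty word force both grades to be zero; what remains
        is the sign of exchanging two vectors.\<close>
      then have "\<gamma> = 0" "\<delta> = 0" using v(3)[of "[]"] w(3)[of "[]"] by (auto simp del: zero_prod_def)
      then have "e \<gamma> \<delta> = eps nu nu" by (simp add: e_def)
      then show ?thesis using F(6)[of "Inr (w [])" "Inr (v [])" "[]"] by simp
    qed
    then show ?case by (simp add: D_def sg_apply sg_simps eps_simps flip: zero_prod_def)
  next
    case (Cons x ws)
    note v = Cons.prems(1) and w = Cons.prems(2) and F = Cons.prems(3)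
    note cv = Om_cut[OF v, of x] and cw = Om_cut[OF w, of x] and cF = Om_cut[OF F, of x]
    note dv = Om_D[OF v F] and dw = Om_D[OF w F]
    note vw = Om_D[OF v w] and wv = Om_D[OF w v]
    show ?case
      unfolding D_Cons[OF v Om_D[OF w F]] D_Cons[OF w Om_D[OF v F]] cut_D[OF v F] cut_D[OF w F]
          D_Cons[OF Om_D[OF v w] F] D_Cons[OF Om_D[OF w v] F] cut_D[OF v w] cut_D[OF w v]
          D_linear_right
          Cons.IH[OF cv w F] Cons.IH[OF v cw F] Cons.IH[OF v w cF]
          D_linear_left(1)[OF F Om_D[OF cv w] Om_sg[OF Om_D[OF v cw]]]
          D_linear_left(1)[OF F Om_D[OF cw v] Om_sg[OF Om_D[OF w cv]]]
          D_linear_left(4)[OF F Om_D[OF w cv] Om_D[OF w cv]]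
          D_linear_left(4)[OF F Om_D[OF v cw] Om_D[OF v cw]]
          plus_fun_apply fun_diff_def sg_apply
      by (simp add: sg_apply sg_norm e_def eps_commute[of nu "dg x"] eps_commute[of \<gamma> "dg x"] eps_commute[of \<delta> "dg x"] ac_simps)
  qed
qed

end

section \<open>The odd coordinate and triple products\<close>

lemma sh_right_Nil: "sh dg xs (\<lambda>a b. if b = [] then f a else 0) = f xs"
  by (induction xs arbitrary: f) (simp_all cong: if_cong)

text \<open>Additivity is available only on the carrier, so membership of the partial sums is
  carried through the same induction.\<close>

lemma sh_hom_on:
  assumes "is_space S" "\<And>x y. x \<in> snd S \<Longrightarrow> y \<in> snd S \<Longrightarrow> h (x + y) = h x + h y"
    and "\<And>a b. f a b \<in> snd S"
  shows "h (sh dg xs f) = sh dg xs (\<lambda>a b. h (f a b)) \<and> sh dg xs f \<in> snd S"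
  using assms(3)
proof (induction xs arbitrary: f)
  case (Cons x xs)
  note S = is_spaceD[OF assms(1)]
  have h0: "h 0 = 0" using assms(2)[OF S(1) S(1)] by simp
  then have "h (- y) = - h y" if "y \<in> snd S" for y
    using assms(2)[OF that S(3)[OF that]] by (simp add: eq_neg_iff_add_eq_0 add.commute)
  then have "h (sg n y) = sg n (h y)" if "y \<in> snd S" for n y using that by (simp add: sg_def)
  then show ?case using Cons by (simp add: assms(2) S)
qed simp

lemma sh3_swap12:
  "sh3 dg xs f = sh3 dg xs (\<lambda>b a c. sg (eps (degs dg a) (degs dg b)) (f a b c))"
  unfolding sh_sh_left[symmetric] by (subst sh_flip) (rule refl)

lemma sh3_swap23:
  "sh3 dg xs f = sh3 dg xs (\<lambda>a c b. sg (eps (degs dg b) (degs dg c)) (f a b c))"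
  unfolding sh_sh_right[symmetric] by (subst (2) sh_flip) (rule refl)

context insertion_calculus
begin

text \<open>The odd coordinate u, that is, the identity of M regarded as a form of degree one;
  compare \<open>D_base\<close>.\<close>

definition base :: "(nat + 'm) list \<Rightarrow> 'm" where
  "base ws = (if length ws = 1 \<and> ws ! 0 \<in> Inr ` snd MS then projr (ws ! 0) else 0)"

lemma Om_base: "Om MS nu base"
proof (rule OmI)
  note M = is_spaceD[OF MS]
  show "is_space MS" by (fact MS)
  show "base ws \<in> snd MS" for ws using M(1) by (auto simp: base_def)
  show "degs dg ws = nu" if "base ws \<noteq> 0" for ws
    using that by (cases ws) (auto simp: base_def split: if_splits)
  show "v \<in> snd MS" if "base ws \<noteq> 0" "Inr v \<in> set ws" for ws v
    using that by (cases ws) (auto simp: base_def split: if_splits)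
  show "base (a @ x # y # b) = sg (eps (dg x) (dg y)) (base (a @ y # x # b))" for a x y b
    by (simp add: base_def)
  show "base (a @ Inr (fst MS c u + v) # b) = fst MS c (base (a @ Inr u # b)) + base (a @ Inr v # b)"
    if "u \<in> snd MS" "v \<in> snd MS" for a b u v c
    using that M by (auto simp: base_def)
qed

lemma D_base: "Om MS \<gamma> v \<Longrightarrow> D v base = v"
proof
  fix ws assume v: "Om MS \<gamma> v"
  have "base (Inr (v x) # y) = (if y = [] then v x else 0)" for x y
    using OmD(2)[OF v, of x] by (auto simp: base_def)
  then show "D v base ws = v ws" by (simp add: D_def sh_right_Nil)
qed

lemma pr_flip:
  assumes "Om S \<alpha> F" "Om T \<beta> G" "bilin S T U b"
  shows "pr b F G = sg (eps \<alpha> \<beta>) (pr (\<lambda>y x. b x y) G F)"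
proof
  fix ws
  note F = OmD[OF assms(1)] and G = OmD[OF assms(2)]
  have "sg (eps (degs dg x) (degs dg y)) (b (F x) (G y)) = sg (eps \<alpha> \<beta>) (b (F x) (G y))" for x y
    using F(3)[of x] G(3)[of y] bilinD(6,7)[OF assms(3) F(1) G(1) F(2)[of x] G(2)[of y]]
    by (cases "F x = 0 \<or> G y = 0") auto
  then show "pr b F G ws = sg (eps \<alpha> \<beta>) (pr (\<lambda>y x. b x y) G F) ws"
    by (simp add: pr_def sg_apply sh_flip[of dg ws "\<lambda>x y. b (F x) (G y)"] sh_sg)
qed

text \<open>The common form of iterated products in either bracketing. A trilinear identity between
  values thus becomes an identity between products.\<close>

definition tr :: "('u \<Rightarrow> 'v \<Rightarrow> 'x \<Rightarrow> 'w) \<Rightarrow> ((nat + 'm) list \<Rightarrow> 'u) \<Rightarrow> ((nat + 'm) list \<Rightarrow> 'v)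
    \<Rightarrow> ((nat + 'm) list \<Rightarrow> 'x) \<Rightarrow> (nat + 'm) list \<Rightarrow> 'w::ab_group_add" where
  "tr t F G K = (\<lambda>ws. sh3 dg ws (\<lambda>a b c. t (F a) (G b) (K c)))"

lemma pr_pr_right:
  assumes "Om S \<alpha> F" "Om T \<beta> G" "Om T' \<gamma> K" "bilin T T' U b" "bilin S U V b'" "is_space U"
  shows "pr b' F (pr b G K) = tr (\<lambda>x y z. b' x (b y z)) F G K"
proof
  fix ws
  note F = OmD[OF assms(1)] and G = OmD[OF assms(2)] and K = OmD[OF assms(3)]
  have "b' (F x) (sh dg y (\<lambda>a c. b (G a) (K c))) = sh dg y (\<lambda>a c. b' (F x) (b (G a) (K c)))" for x y
    by (rule sh_hom_on[OF assms(6), THEN conjunct1])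
      (rule bilinD(3)[OF assms(5) F(1) assms(6) F(2)] bilinD(1)[OF assms(4) G(1) K(1) G(2) K(2)]; assumption)+
  then show "pr b' F (pr b G K) ws = tr (\<lambda>x y z. b' x (b y z)) F G K ws"
    by (simp add: pr_def tr_def sh_sh_right)
qed

lemma pr_pr_left:
  assumes "Om S \<alpha> F" "Om T \<beta> G" "Om T' \<gamma> K" "bilin S T U b" "bilin U T' V b'" "is_space U"
  shows "pr b' (pr b F G) K = tr (\<lambda>x y z. b' (b x y) z) F G K"
proof
  fix ws
  note F = OmD[OF assms(1)] and G = OmD[OF assms(2)] and K = OmD[OF assms(3)]
  have "b' (sh dg x (\<lambda>a c. b (F a) (G c))) (K y) = sh dg x (\<lambda>a c. b' (b (F a) (G c)) (K y))" for x y
    by (rule sh_hom_on[OF assms(6), of "\<lambda>z. b' z (K y)", THEN conjunct1])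
      (rule bilinD(2)[OF assms(5,6) K(1) _ K(2)] bilinD(1)[OF assms(4) F(1) G(1) F(2) G(2)]; assumption)+
  then show "pr b' (pr b F G) K ws = tr (\<lambda>x y z. b' (b x y) z) F G K ws"
    by (simp add: pr_def tr_def sh_sh_left)
qed

lemma tr_swap12:
  assumes "Om S \<alpha> F" "Om T \<beta> G" "\<And>a b. t 0 (G a) (K b) = 0" "\<And>a b. t (F a) 0 (K b) = 0"
  shows "tr t F G K = sg (eps \<alpha> \<beta>) (tr (\<lambda>y x z. t x y z) G F K)"
proof
  fix ws
  have "sg (eps (degs dg x) (degs dg y)) (t (F x) (G y) (K z)) = sg (eps \<alpha> \<beta>) (t (F x) (G y) (K z))" for x y z
    using OmD(3)[OF assms(1), of x] OmD(3)[OF assms(2), of y] assms(3,4)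
    by (cases "F x = 0 \<or> G y = 0") auto
  then show "tr t F G K ws = sg (eps \<alpha> \<beta>) (tr (\<lambda>y x z. t x y z) G F K) ws"
    by (simp add: tr_def sg_apply sh3_swap12[of dg ws "\<lambda>a b c. t (F a) (G b) (K c)"] sh3_sg)
qed

lemma tr_swap23:
  assumes "Om S \<alpha> G" "Om T \<beta> K" "\<And>a b. t (F a) 0 (K b) = 0" "\<And>a b. t (F a) (G b) 0 = 0"
  shows "tr t F G K = sg (eps \<alpha> \<beta>) (tr (\<lambda>x z y. t x y z) F K G)"
proof
  fix ws
  have "sg (eps (degs dg x) (degs dg y)) (t (F z) (G x) (K y)) = sg (eps \<alpha> \<beta>) (t (F z) (G x) (K y))" for x y z
    using OmD(3)[OF assms(1), of x] OmD(3)[OF assms(2), of y] assms(3,4)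
    by (cases "G x = 0 \<or> K y = 0") auto
  then show "tr t F G K ws = sg (eps \<alpha> \<beta>) (tr (\<lambda>x z y. t x y z) F K G) ws"
    by (simp add: tr_def sg_apply sh3_swap23[of dg ws "\<lambda>a b c. t (F a) (G b) (K c)"] sh3_sg)
qed

lemma tr_add: "tr (\<lambda>x y z. t x y z + t' x y z) F G K = tr t F G K + tr t' F G K"
  by (simp add: tr_def fun_eq_iff sh3_add)

lemma tr_minus: "tr (\<lambda>x y z. - t x y z) F G K = - tr t F G K"
  using tr_add[of t "\<lambda>x y z. - t x y z" F G K] by (simp add: tr_def fun_eq_iff eq_neg_iff_add_eq_0 add.commute)

end

section \<open>The diagonal form of the higher Jacobi identities\<close>

lemma is_space_cancel:
  fixes S :: "('k::field_char_0, 'w::ab_group_add) space"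
  assumes "is_space S"
  shows "x + x = y + y \<longleftrightarrow> x = (y :: 'w)" "x + x + x = y + y + y \<longleftrightarrow> x = y"
proof -
  interpret vector_space "fst S" using assms by (simp add: is_space_def)
  have "x + x = fst S 2 x" "x + x + x = fst S 3 x" for x
    using scale_left_distrib[of 1 1 x] scale_left_distrib[of 2 1 x] by simp_all
  then show "x + x = y + y \<longleftrightarrow> x = y" "x + x + x = y + y + y \<longleftrightarrow> x = y" by simp_all
qed

context lie_algebra
begin

lemma br_bilinear:
  "br (x + y) z = br x z + br y z" "br z (x + y) = br z x + br z y"
  "br (scale c x) z = scale c (br x z)" "br z (scale c x) = scale c (br z x)"
proof -
  interpret r: Vector_Spaces.linear scale scale "br x" for x by (rule linear_right)
  interpret l: Vector_Spaces.linear scale scale "\<lambda>x. br x y" for y by (rule linear_left)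
  show "br (x + y) z = br x z + br y z" "br z (x + y) = br z x + br z y"
    "br (scale c x) z = scale c (br x z)" "br z (scale c x) = scale c (br z x)"
    by (simp_all add: r.add l.add r.scale l.scale)
qed

lemma br_swap: "br y x = - br x y"
proof -
  have "br (x + y) (x + y) = br x y + br y x" by (simp only: br_bilinear) (simp add: br_self)
  then show ?thesis by (simp add: br_self eq_neg_iff_add_eq_0 add.commute)
qed

end

text \<open>Everything about the brackets is proved for an arbitrary module with a 2-cocycle;
  \<open>H_cocycle\<close> is the Chevalley-Eilenberg condition written out.\<close>

locale twisted_module = lie_algebra scale br
  for scale :: "'k::field_char_0 \<Rightarrow> 'g::ab_group_add \<Rightarrow> 'g" and br +
  fixes MS :: "('k, 'm::ab_group_add) space"
    and act :: "'g \<Rightarrow> 'm \<Rightarrow> 'm" and H :: "'g list \<Rightarrow> 'm"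
  assumes MS: "is_space MS"
    and bilin_act: "bilin (scale, UNIV) MS MS act"
    and act_br: "m \<in> snd MS \<Longrightarrow> act (br x y) m = act x (act y m) - act y (act x m)"
    and bilin_H: "bilin (scale, UNIV) (scale, UNIV) MS (\<lambda>x y. H [x, y])"
    and H_swap: "H [y, x] = - H [x, y]"
    and H_cocycle: "act x (H [y, z]) - act y (H [x, z]) + act z (H [x, y])
      - H [br x y, z] + H [br x z, y] - H [br y z, x] = 0"
begin

abbreviation GS where "GS \<equiv> (scale, UNIV :: 'g set)"

lemma GS: "is_space GS"
  by (simp add: is_space_def vector_space_axioms)

lemma bilin_br: "bilin GS GS GS br"
  by (simp add: bilin_def br_bilinear)

end

locale twisted_calculus = twisted_module scale br MS act H + insertion_calculus d MS
  for scale :: "'k::field_char_0 \<Rightarrow> 'g::ab_group_add \<Rightarrow> 'g" and br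
    and MS :: "('k, 'm::ab_group_add) space" and act H d
begin

abbreviation (input) "pa \<equiv> pr act"
abbreviation (input) "pb \<equiv> pr br"
abbreviation (input) "ph \<equiv> pr (\<lambda>x y. H [x, y])"

text \<open>
  The brackets up to a global sign. The signs are chosen such that cutting off a parameter is a
  derivation of \<open>U2\<close> and, with the inserted slot \<open>nu\<close> between the last two arguments, of \<open>U3\<close>.
\<close>

definition U2 where
  "U2 \<gamma> \<delta> F G = sg (eps \<gamma> \<delta>) (D (pa G base) F) - D (pa F base) G + pb F G"

definition U3 where
  "U3 \<gamma> \<delta> \<kappa> F G K = D (ph F G) K
     - sg (eps \<delta> \<kappa> + eps \<kappa> nu + eps \<delta> nu) (D (ph F K) G)
     + sg (eps \<gamma> (\<delta> + \<kappa> + nu) + eps \<kappa> nu) (D (ph G K) F)"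

lemma pr_antisym:
  assumes "Om S \<alpha> F" "Om S \<beta> G" "bilin S S T b" "\<And>x y. b y x = - b x y"
  shows "pr b F G = - sg (eps \<alpha> \<beta>) (pr b G F)"
proof -
  have *: "(\<lambda>y x. b x y) = (\<lambda>y x. - b y x)" by (intro ext) (rule assms(4))
  have "pr (\<lambda>y x. b x y) G F = - pr b G F"
    unfolding * by (rule ext) (simp only: pr_def sh_minus fun_Compl_def)
  then show ?thesis using pr_flip[OF assms(1-3)] by (simp add: sg_simps)
qed

lemma pb_swap: "Om GS \<alpha> F \<Longrightarrow> Om GS \<beta> G \<Longrightarrow> pb F G = - sg (eps \<alpha> \<beta>) (pb G F)"
  by (rule pr_antisym[OF _ _ bilin_br br_swap])

lemma ph_swap: "Om GS \<alpha> F \<Longrightarrow> Om GS \<beta> G \<Longrightarrow> ph F G = - sg (eps \<alpha> \<beta>) (ph G F)"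
  by (rule pr_antisym[OF _ _ bilin_H H_swap])

section \<open>Identities in one element of grade (1, 0)\<close>

context
  fixes P
  assumes P: "Om GS (1, 0) P"
begin

abbreviation (input) "V \<equiv> pa P base"
abbreviation (input) "W \<equiv> ph P P"
abbreviation (input) "B \<equiv> pb P P"

lemma Om_V: "Om MS (1, 1) V" and Om_W: "Om MS (2, 0) W" and Om_B: "Om GS (2, 0) B"
  using Om_pr[OF P Om_base bilin_act MS] Om_pr[OF P P bilin_H MS] Om_pr[OF P P bilin_br GS] by simp_all

lemma Om_DV: "Om GS (2, 0) (D V P)" and Om_DW: "Om GS (3, - 1) (D W P)"
  using Om_D[OF Om_V P] Om_D[OF Om_W P] by simp_all

text \<open>By \<open>eps\<close> = 1 two copies of \<open>P\<close> anticommute, so transposing two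
  arguments of \<open>t\<close> costs a sign and rotating all three costs nothing.\<close>

lemma tr_PPP:
  assumes "\<And>x y. t 0 x y = 0" "\<And>x y. t x 0 y = 0" "\<And>x y. t x y 0 = 0"
  shows "tr (\<lambda>x y z. t y x z) P P P = - tr t P P P" "tr (\<lambda>x y z. t x z y) P P P = - tr t P P P"
  using tr_swap12[OF P P, of "\<lambda>x y z. t y x z" P] tr_swap23[OF P P, of "\<lambda>x y z. t x z y" P]
  by (simp_all add: assms eps_def)

lemmas pb_l = pr_linear[OF bilin_br _ _ _ _ GS]
lemmas ph_l = pr_linear[OF bilin_H _ _ _ _ MS]
lemmas pa_l = pr_linear[OF bilin_act _ _ _ _ MS]

text \<open>The three rotations of the double bracket have the same product, and their sum vanishes
  by the Jacobi identity. It remains to cancel a factor 3.\<close>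

lemma pb_B_P: "pb B P = 0"
proof -
  define t where "t = (\<lambda>x y z. br (br x y) z)"
  note b = bilinD[OF bilin_br GS GS, simplified]
  have t0: "t 0 x y = 0" "t x 0 y = 0" "t x y 0 = 0" for x y by (simp_all add: t_def b)
  have *: "pb B P = tr t P P P" unfolding t_def by (rule pr_pr_left[OF P P P bilin_br bilin_br GS])
  have c1: "tr (\<lambda>x y z. t y z x) P P P = tr t P P P"
    using tr_PPP(1)[of "\<lambda>x y z. t x z y"] tr_PPP(2)[of t] by (simp add: t0)
  have c2: "tr (\<lambda>x y z. t z x y) P P P = tr t P P P"
    using tr_PPP(2)[of "\<lambda>x y z. t y x z"] tr_PPP(1)[of t] by (simp add: t0)
  have "t x y z + t y z x + t z x y = 0" for x y z
    using jacobi[of x y z] by (simp add: t_def br_swap[of "br _ _"] algebra_simps add_eq_0_iff)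
  then have "tr (\<lambda>x y z. t x y z + t y z x + t z x y) P P P = 0" by (simp add: tr_def fun_eq_iff)
  then have "tr t P P P + tr t P P P + tr t P P P = 0" by (simp add: tr_add c1 c2)
  then have "tr t P P P ws = 0" for ws
    using is_space_cancel(2)[OF GS, of "tr t P P P ws" 0] by (simp add: fun_eq_iff)
  then show ?thesis by (simp add: * fun_eq_iff)
qed

text \<open>The two terms of the module axiom differ by an exchange of the copies of
  \<open>P\<close>, so with their opposite signs they add up.\<close>

lemma pa_P_V: "pa P V + pa P V = pa B base"
proof -
  note b = bilinD[OF bilin_act GS MS, simplified]
  have 1: "pa P V = tr (\<lambda>x y z. act x (act y z)) P P base"
    by (rule pr_pr_right[OF P P Om_base bilin_act bilin_act MS])
  have 2: "pa B base = tr (\<lambda>x y z. act (br x y) z) P P base"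
    by (rule pr_pr_left[OF P P Om_base bilin_br bilin_act GS])
  have m: "base c \<in> snd MS" for c using OmD(2)[OF Om_base] .
  have "tr (\<lambda>x y z. act x (act y z)) P P base = - tr (\<lambda>x y z. act y (act x z)) P P base"
    by (subst tr_swap12[OF P P]) (simp_all add: b m eps_def b(7)[OF is_spaceD(1)[OF MS]])
  moreover have "tr (\<lambda>x y z. act (br x y) z) P P base
      = tr (\<lambda>x y z. act x (act y z) + - act y (act x z)) P P base"
    by (simp add: tr_def act_br m)
  ultimately show ?thesis unfolding 1 2 tr_add tr_minus by simp
qed

text \<open>In the cocycle condition the three action terms all become the same product, and so do
  the three bracket terms, by \<open>tr_PPP\<close>; then 3 is cancelled.\<close>

lemma pa_P_W: "pa P W = ph B P"
proof -
  note b = bilinD[OF bilin_act GS MS, simplified] and h = bilinD[OF bilin_H GS GS, simplified]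
    and br = bilinD[OF bilin_br GS GS, simplified]
  define s where "s = (\<lambda>x y z. act x (H [y, z]))"
  define t where "t = (\<lambda>x y z. H [br x y, z])"
  have s0: "s 0 x y = 0" "s x 0 y = 0" "s x y 0 = 0" for x y
    by (simp_all add: s_def b h b(7)[OF is_spaceD(1)[OF MS]])
  have t0: "t 0 x y = 0" "t x 0 y = 0" "t x y 0 = 0" for x y by (simp_all add: t_def br h)
  have 1: "pa P W = tr s P P P" unfolding s_def
    by (rule pr_pr_right[OF P P P bilin_H bilin_act MS])
  have 2: "ph B P = tr t P P P" unfolding t_def
    by (rule pr_pr_left[OF P P P bilin_br bilin_H GS])
  have c: "tr (\<lambda>x y z. s z x y) P P P = tr s P P P"
    using tr_PPP(2)[of "\<lambda>x y z. s y x z"] tr_PPP(1)[of s] by (simp add: s0)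
  have c': "tr (\<lambda>x y z. t y z x) P P P = tr t P P P"
    using tr_PPP(1)[of "\<lambda>x y z. t x z y"] tr_PPP(2)[of t] by (simp add: t0)
  have "s x y z + - s y x z + s z x y = t x y z + - t x z y + t y z x" for x y z
    using H_cocycle[of x y z] by (simp add: s_def t_def algebra_simps)
  then have "tr (\<lambda>x y z. s x y z + - s y x z + s z x y) P P P
      = tr (\<lambda>x y z. t x y z + - t x z y + t y z x) P P P" by simp
  then have "tr s P P P + tr s P P P + tr s P P P = tr t P P P + tr t P P P + tr t P P P"
    using tr_PPP(1)[of s] tr_PPP(2)[of t] unfolding tr_add tr_minus c c' by (simp add: s0 t0)
  then have "tr s P P P ws = tr t P P P ws" for ws
    using is_space_cancel(2)[OF MS] by (metis plus_fun_apply)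
  then show ?thesis by (simp add: 1 2 fun_eq_iff)
qed

lemma fun_double: "F + F = G + G \<longleftrightarrow> F = G" for F G :: "(nat + 'm) list \<Rightarrow> 'g"
  using is_space_cancel(1)[OF GS] by (simp add: fun_eq_iff)

lemma U2_PP: "U2 (1, 0) (1, 0) P P = pb P P - D V P - D V P"
  by (simp add: U2_def eps_def)

lemma U3_PPP: "U3 (1, 0) (1, 0) (1, 0) P P P = D W P + D W P + D W P"
  by (simp add: U3_def eps_def sg_def)

lemma Om_U2_PP: "Om GS (2, 0) (U2 (1, 0) (1, 0) P P)"
  unfolding U2_PP by (intro Om_diff Om_B Om_DV)

text \<open>The inner bracket is B - 2 D V P. The terms with a Lie bracket cancel since
  \<open>D V\<close> is a derivation and [B, P] = 0; the others cancel since the odd derivation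
  \<open>D V\<close> has square \<open>D (D V V)\<close>.\<close>

theorem diagonal_3: "U2 (2, 0) (1, 0) (U2 (1, 0) (1, 0) P P) P = 0"
proof -
  have VV: "D V V = pa (D V P) base - pa P V"
    by (simp add: D_pr[OF Om_V P Om_base bilin_act MS] D_base[OF Om_V] eps_def)
  have "pa (U2 (1, 0) (1, 0) P P) base = pa B base - pa (D V P) base - pa (D V P) base"
    unfolding U2_PP
    by (simp add: pa_l(3)[OF Om_diff[OF Om_B Om_DV] Om_DV Om_base Om_base] pa_l(3)[OF Om_B Om_DV Om_base Om_base])
  then have e: "pa (U2 (1, 0) (1, 0) P P) base = - (D V V + D V V)"
    by (simp add: VV flip: pa_P_V)
  have Om_VV: "Om MS (2, 1) (D V V)" using Om_D[OF Om_V Om_V] by simp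
  \<comment> \<open>The sign exponent is \<open>eps\<close> of (1, 2) with itself, namely 5, so the
    derivation along V is odd.\<close>
  have "D V (D V P) = D (D V V) P - (D V (D V P) - D (D V V) P)"
    by (subst D_D[OF Om_V Om_V P]) (simp add: eps_def sg_def)
  then have VVP: "D V (D V P) + D V (D V P) = D (D V V) P + D (D V V) P"
    by (simp add: algebra_simps)
  have PD: "pb P (D V P) = - pb (D V P) P"
    by (subst pb_swap[OF P Om_DV]) (simp add: eps_def sg_def)
  have VB: "D V B = pb (D V P) P + pb (D V P) P"
    by (simp add: D_pr[OF Om_V P P bilin_br GS] eps_def sg_def PD)
  have eP: "pb (U2 (1, 0) (1, 0) P P) P = - pb (D V P) P - pb (D V P) P"
    unfolding U2_PP
    by (simp add: pb_l(3)[OF Om_diff[OF Om_B Om_DV] Om_DV P P] pb_l(3)[OF Om_B Om_DV P P] pb_B_P)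
  have "D (pa (U2 (1, 0) (1, 0) P P) base) P = - (D (D V V) P + D (D V V) P)"
    unfolding e D_linear_left(3)[OF P Om_add[OF Om_VV Om_VV] Om_VV] D_linear_left(1)[OF P Om_VV Om_VV] ..
  then show ?thesis
    unfolding U2_def[of "(2, 0)"] eP unfolding U2_PP D_linear_right VB
    using VVP by (simp add: eps_def sg_def algebra_simps)
qed

text \<open>The cocycle condition enters through \<open>D W V\<close>, where P acting on W is
  replaced by H(B, P); this matches the B-part of the inner bracket on the left.\<close>

theorem diagonal_4:
  "U3 (2, 0) (1, 0) (1, 0) (U2 (1, 0) (1, 0) P P) P P
   = U2 (3, - 1) (1, 0) (D W P) P + U2 (3, - 1) (1, 0) (D W P) P"
proof -
  have PV: "ph P (D V P) = - ph (D V P) P"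
    by (subst ph_swap[OF P Om_DV]) (simp add: eps_def sg_def)
  have VW: "D V W = ph (D V P) P + ph (D V P) P"
    by (simp add: D_pr[OF Om_V P P bilin_H MS] eps_def sg_def PV)
  have WV: "D W V = pa (D W P) base + ph B P"
    by (simp add: D_pr[OF Om_W P Om_base bilin_act MS] D_base[OF Om_W] eps_def sg_def flip: pa_P_W)
  note Om_h = Om_pr[OF Om_DV P bilin_H MS] and Om_hB = Om_pr[OF Om_B P bilin_H MS]
    and Om_a = Om_pr[OF Om_DW Om_base bilin_act MS]
  \<comment> \<open>Here the exponent is \<open>eps\<close> of (1, 2) and (2, 1), namely 4: the
    derivations along V and W commute without a sign.\<close>
  have "D V (D W P) = D (D V W) P + (D W (D V P) - D (D W V) P)"
    by (subst D_D[OF Om_V Om_W P]) (simp add: eps_def sg_def)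
  then have VWP: "D V (D W P) = D (ph (D V P) P) P + D (ph (D V P) P) P
      + (D W (D V P) - D (pa (D W P) base) P - D (ph B P) P)"
    unfolding VW WV D_linear_left(1)[OF P Om_h Om_h] D_linear_left(1)[OF P Om_a Om_hB]
    by (simp add: algebra_simps)
  have PW: "pb P (D W P) = pb (D W P) P"
    by (subst pb_swap[OF P Om_DW]) (simp add: eps_def sg_def)
  have WB: "D W B = pb (D W P) P + pb (D W P) P"
    by (simp add: D_pr[OF Om_W P P bilin_br GS] eps_def sg_def PW)
  have "ph (U2 (1, 0) (1, 0) P P) P = ph B P - ph (D V P) P - ph (D V P) P"
    unfolding U2_PP
    by (simp add: ph_l(3)[OF Om_diff[OF Om_B Om_DV] Om_DV P P] ph_l(3)[OF Om_B Om_DV P P])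
  then have "D (ph (U2 (1, 0) (1, 0) P P) P) P = D (ph B P) P - D (ph (D V P) P) P - D (ph (D V P) P) P"
    using D_linear_left(2)[OF P Om_diff[OF Om_hB Om_h] Om_h] D_linear_left(2)[OF P Om_hB Om_h] by simp
  then show ?thesis
    unfolding U3_def U2_def[of "(3, - 1)"] VWP
    by (simp add: eps_def sg_def U2_PP D_linear_right WB algebra_simps)
qed

text \<open>The three terms add up to 2 D (H(D W P, P)) P - D W (D W P), and the odd derivation
  \<open>D W\<close> squares to \<open>D (D W W)\<close>.\<close>

theorem diagonal_5: "U3 (3, - 1) (1, 0) (1, 0) (D W P) P P = 0"
proof -
  have PW: "ph P (D W P) = ph (D W P) P"
    by (subst ph_swap[OF P Om_DW]) (simp add: eps_def sg_def)
  have WW: "D W W = ph (D W P) P + ph (D W P) P"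
    by (simp add: D_pr[OF Om_W P P bilin_H MS] eps_def sg_def PW)
  note Om_h = Om_pr[OF Om_DW P bilin_H MS]
  have "D W (D W P) = D (D W W) P - (D W (D W P) - D (D W W) P)"
    by (subst D_D[OF Om_W Om_W P]) (simp add: eps_def sg_def)
  then have "D W (D W P) + D W (D W P) = D (D W W) P + D (D W W) P"
    by (simp add: algebra_simps)
  then have "D W (D W P) = D (ph (D W P) P) P + D (ph (D W P) P) P"
    unfolding fun_double WW D_linear_left(1)[OF P Om_h Om_h] .
  then show ?thesis unfolding U3_def by (simp add: eps_def sg_def)
qed

end

end

section \<open>Polarisation\<close>

context insertion_calculus
begin

abbreviation dgl :: "nat \<Rightarrow> grade" where "dgl i \<equiv> (1, - d i)"

text \<open>The coefficient at a product of parameters, as an iterated left derivative.\<close>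

definition cuts :: "nat list \<Rightarrow> ((nat + 'm) list \<Rightarrow> 'w) \<Rightarrow> (nat + 'm) list \<Rightarrow> 'w" where
  "cuts ls F = (\<lambda>ws. F (map Inl ls @ ws))"

lemma cuts_simps [simp]: "cuts [] F = F" "cuts ls (cut (Inl i) F) = cuts (i # ls) F"
  by (simp_all add: cuts_def cut_def)

lemma Om_cuts: "Om S \<gamma> F \<Longrightarrow> Om S (\<gamma> - degs dgl ls) (cuts ls F)"
proof (induction ls arbitrary: F \<gamma>)
  case (Cons i ls)
  from Cons.IH[OF Om_cut[OF Cons.prems, of "Inl i"]] show ?case
    by (simp add: diff_diff_add)
qed simp

lemma cut_base: "cut (Inl i) base = 0"
  by (auto simp: cut_def base_def fun_eq_iff)

abbreviation label_free :: "(nat + 'm) list \<Rightarrow> bool" where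
  "label_free ws \<equiv> set ws \<subseteq> range Inr"

definition lift :: "('m list \<Rightarrow> 'w) \<Rightarrow> (nat + 'm) list \<Rightarrow> 'w::zero" where
  "lift f ws = (if label_free ws then f (map projr ws) else 0)"

lemma lift_Inr [simp]: "lift f (map Inr us) = f us"
  by (auto simp: lift_def comp_def)

lemma fst_degs: "fst (degs dg ws) = int (length (filter isl ws))"
  by (induction ws) (auto simp: dg_def split: sum.splits)

text \<open>The first component of a grade is the number of parameters in the word.\<close>

lemma Om_label_free:
  assumes "Om S \<gamma> F" "fst \<gamma> \<noteq> 0" "label_free ws"
  shows "F ws = 0"
proof (rule ccontr)
  assume "F ws \<noteq> 0"
  then have "fst (degs dg ws) \<noteq> 0" using OmD(3)[OF assms(1)] assms(2) by simp
  moreover have "filter isl ws = []" using assms(3) by (auto simp: filter_empty_conv)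
  ultimately show False by (simp add: fst_degs)
qed

lemma Om_eq_lift:
  assumes "Om S (0, p) F"
  shows "F = lift (\<lambda>us. F (map Inr us))"
proof
  fix ws
  show "F ws = lift (\<lambda>us. F (map Inr us)) ws"
  proof (cases "label_free ws")
    case True
    then have "map Inr (map projr ws) = ws" by (auto simp: comp_def intro!: map_idI)
    with True show ?thesis by (simp add: lift_def)
  next
    case False
    then obtain x where "x \<in> set ws" "isl x" by (metis isl_def obj_sumE rangeI subsetI)
    then have "filter isl ws \<noteq> []" by (auto simp: filter_empty_conv)
    then have "degs dg ws \<noteq> (0, p)" using fst_degs[of ws] by auto
    then have "F ws = 0" using OmD(3)[OF assms] by blast
    with False show ?thesis by (simp add: lift_def)
  qed
qed

lemma pr_label_free:
  assumes "label_free ws" "bilin S T U b" "is_space S" "is_space T"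
    and "\<And>ws. F ws \<in> snd S" "\<And>ws. G ws \<in> snd T"
    and "(\<forall>ws. label_free ws \<longrightarrow> F ws = 0) \<or> (\<forall>ws. label_free ws \<longrightarrow> G ws = 0)"
  shows "pr b F G ws = 0"
proof -
  note b = bilinD(6,7)[OF assms(2-4) assms(5,6)]
  have "sh dg ws (\<lambda>x y. b (F x) (G y)) = sh dg ws (\<lambda>x y. 0)"
  proof (rule sh_cong)
    fix x y assume "set x \<union> set y = set ws"
    then have "label_free x" "label_free y" using assms(1) by auto
    then show "b (F x) (G y) = 0" using assms(7) b by metis
  qed
  then show ?thesis by (simp add: pr_def)
qed

lemma D_label_free:
  assumes "label_free ws" "Om S \<gamma> F"
    and "(\<forall>ws. label_free ws \<longrightarrow> F ws = 0) \<or> (\<forall>ws. label_free ws \<longrightarrow> v ws = 0)"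
  shows "D v F ws = 0"
proof -
  have "sh dg ws (\<lambda>x y. F (Inr (v x) # y)) = sh dg ws (\<lambda>x y. 0)"
  proof (rule sh_cong)
    fix x y assume "set x \<union> set y = set ws"
    then have "label_free x" "set (Inr (v x) # y) \<subseteq> range Inr" using assms(1) by auto
    then show "F (Inr (v x) # y) = 0" using assms(3) Om_linear(2)[OF assms(2)] by metis
  qed
  then show ?thesis by (simp add: D_def)
qed

end

section \<open>Coefficients of the brackets at products of parameters\<close>

context twisted_calculus
begin

lemma Om_U2:
  assumes "Om GS \<alpha> F" "Om GS \<beta> G"
  shows "Om GS (\<alpha> + \<beta>) (U2 \<alpha> \<beta> F G)"
proof -
  have "Om GS (\<alpha> + \<beta>) (D (pa G base) F)" "Om GS (\<alpha> + \<beta>) (D (pa F base) G)"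
    using Om_D[OF Om_pr[OF assms(2) Om_base bilin_act MS] assms(1)]
      Om_D[OF Om_pr[OF assms(1) Om_base bilin_act MS] assms(2)] by (simp_all add: add.commute)
  then show ?thesis unfolding U2_def
    by (intro Om_add Om_diff Om_sg Om_pr[OF assms bilin_br GS])
qed

lemma Om_U3:
  assumes F: "Om GS \<alpha> F" and G: "Om GS \<beta> G" and K: "Om GS \<kappa> K"
  shows "Om GS (\<alpha> + \<beta> + \<kappa> - nu) (U3 \<alpha> \<beta> \<kappa> F G K)"
proof -
  have "Om GS (\<alpha> + \<beta> + \<kappa> - nu) (D (ph F G) K)" "Om GS (\<alpha> + \<beta> + \<kappa> - nu) (D (ph F K) G)"
    "Om GS (\<alpha> + \<beta> + \<kappa> - nu) (D (ph G K) F)"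
    using Om_D[OF Om_pr[OF F G bilin_H MS] K] Om_D[OF Om_pr[OF F K bilin_H MS] G]
      Om_D[OF Om_pr[OF G K bilin_H MS] F] by (simp_all add: algebra_simps)
  then show ?thesis unfolding U3_def by (intro Om_add Om_diff Om_sg)
qed

lemma U2_scale:
  assumes F: "Om GS \<alpha> F" and G: "Om GS \<beta> G"
  shows "U2 \<alpha> \<beta> (pointwise scale c F) G = pointwise scale c (U2 \<alpha> \<beta> F G)"
proof -
  note pF = Om_pr[OF F Om_base bilin_act MS]
  note a = pr_linear(9)[OF bilin_act F F Om_base Om_base MS, of c, simplified]
    and b = pr_linear(9)[OF bilin_br F F G G GS, of c, simplified]
    and e = D_linear_left(5)[OF G pF pF, of c, simplified]
  show ?thesis
    unfolding U2_def a b e D_linear_right(5)[OF GS, of _ c F, simplified]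
    using is_spaceD(6,8,9)[OF GS]
    by (simp add: fun_eq_iff pointwise_def sg_apply sg_simps algebra_simps scale_right_diff_distrib)
qed

lemma U3_scale:
  assumes F: "Om GS \<alpha> F" and G: "Om GS \<beta> G" and K: "Om GS \<kappa> K"
  shows "U3 \<alpha> \<beta> \<kappa> (pointwise scale c F) G K = pointwise scale c (U3 \<alpha> \<beta> \<kappa> F G K)"
proof -
  note a = pr_linear(9)[OF bilin_H F F G G MS, of c, simplified]
    and b = pr_linear(9)[OF bilin_H F F K K MS, of c, simplified]
    and FG = Om_pr[OF F G bilin_H MS] and FK = Om_pr[OF F K bilin_H MS]
  show ?thesis
    unfolding U3_def a b D_linear_left(5)[OF K FG FG] D_linear_left(5)[OF G FK FK]
      D_linear_right(5)[OF GS, of _ c F, simplified]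
    using is_spaceD(6,8,9)[OF GS]
    by (simp add: fun_eq_iff pointwise_def sg_apply sg_simps algebra_simps scale_right_diff_distrib)
qed

lemma U2_swap:
  assumes F: "Om GS \<alpha> F" and G: "Om GS \<beta> G"
  shows "U2 \<beta> \<alpha> G F = - sg (eps \<alpha> \<beta>) (U2 \<alpha> \<beta> F G)"
  unfolding U2_def pb_swap[OF G F] by (simp add: sg_simps eps_commute[of \<beta>])

lemma D_ph_swap:
  assumes "Om GS \<alpha> F" "Om GS \<beta> G" "Om GS \<kappa> K"
  shows "D (ph G F) K = - sg (eps \<alpha> \<beta>) (D (ph F G) K)"
proof -
  note FG = Om_pr[OF assms(1,2) bilin_H MS]
  show ?thesis
    unfolding ph_swap[OF assms(2,1)] D_linear_left(3)[OF assms(3) Om_sg[OF FG] FG]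
      D_linear_left(4)[OF assms(3) FG FG] by (simp add: eps_commute[of \<beta>])
qed

lemma U3_swap23:
  assumes F: "Om GS \<alpha> F" and G: "Om GS \<beta> G" and K: "Om GS \<kappa> K"
  shows "U3 \<alpha> \<kappa> \<beta> F K G = - sg (eps \<beta> \<kappa> + eps \<kappa> nu + eps \<beta> nu) (U3 \<alpha> \<beta> \<kappa> F G K)"
proof -
  have "D (ph K G) F = - sg (eps \<beta> \<kappa>) (D (ph G K) F)" by (rule D_ph_swap[OF G K F])
  then show ?thesis
    unfolding U3_def by (simp add: sg_norm eps_commute[of \<kappa> \<beta>] algebra_simps)
qed

lemma U3_swap12:
  assumes F: "Om GS \<alpha> F" and G: "Om GS \<beta> G" and K: "Om GS \<kappa> K"
  shows "U3 \<beta> \<alpha> \<kappa> G F K = - sg (eps \<alpha> \<beta>) (U3 \<alpha> \<beta> \<kappa> F G K)"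
proof -
  have "D (ph G F) K = - sg (eps \<alpha> \<beta>) (D (ph F G) K)" by (rule D_ph_swap[OF F G K])
  then show ?thesis
    unfolding U3_def by (simp add: sg_norm eps_commute[of \<beta> \<alpha>] algebra_simps)
qed

text \<open>The letter is a parameter because contraction with a parameter kills
  \<open>base\<close>, whereas contraction with a vector does not.\<close>

lemma cut_U2:
  assumes F: "Om GS \<alpha> F" and G: "Om GS \<beta> G" and x: "x = Inl i"
  shows "cut x (U2 \<alpha> \<beta> F G) = U2 (\<alpha> - dg x) \<beta> (cut x F) G
    + sg (eps (dg x) \<alpha>) (U2 \<alpha> (\<beta> - dg x) F (cut x G))"
proof -
  note pF = Om_pr[OF F Om_base bilin_act MS] and pG = Om_pr[OF G Om_base bilin_act MS]
  have z: "pa K 0 = 0" if "Om GS \<gamma> K" for K \<gamma>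
    using pr_linear(7)[OF bilin_act that that Om_zero[OF MS] Om_zero[OF MS] MS]
      bilinD(7)[OF bilin_act GS MS] is_spaceD(1)[OF MS] by (simp add: pr_def fun_eq_iff)
  have c: "cut x (pa F base) = pa (cut x F) base" "cut x (pa G base) = pa (cut x G) base"
    unfolding cut_pr[OF F Om_base bilin_act] cut_pr[OF G Om_base bilin_act]
    by (simp_all add: x cut_base z[OF F] z[OF G])
  \<comment> \<open>The letter passes both the coordinate \<open>base\<close> and the inserted slot;
    two times \<open>nu\<close> is even.\<close>
  have "sg (eps (dg x) (0, 2)) K = K" for K :: "(nat + 'm) list \<Rightarrow> 'g"
    by (simp add: sg_def eps_def)
  then show ?thesis
    unfolding U2_def cut_simps cut_D[OF pF G] cut_D[OF pG F] c cut_pr[OF F G bilin_br]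
    by (simp add: sg_norm eps_commute[of \<alpha> "dg x"] eps_commute[of \<beta> "dg x"] algebra_simps)
qed

lemma cut_U3:
  assumes F: "Om GS \<alpha> F" and G: "Om GS \<beta> G" and K: "Om GS \<kappa> K"
  shows "cut x (U3 \<alpha> \<beta> \<kappa> F G K) = U3 (\<alpha> - dg x) \<beta> \<kappa> (cut x F) G K
    + sg (eps (dg x) \<alpha>) (U3 \<alpha> (\<beta> - dg x) \<kappa> F (cut x G) K)
    + sg (eps (dg x) (\<alpha> + \<beta> + nu)) (U3 \<alpha> \<beta> (\<kappa> - dg x) F G (cut x K))"
proof -
  note cF = Om_cut[OF F, of x] and cG = Om_cut[OF G, of x] and cK = Om_cut[OF K, of x]
  note h = Om_pr[OF _ _ bilin_H MS]
  show ?thesis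
    unfolding U3_def cut_simps cut_D[OF h[OF F G] K] cut_D[OF h[OF F K] G] cut_D[OF h[OF G K] F]
      cut_pr[OF F G bilin_H] cut_pr[OF F K bilin_H] cut_pr[OF G K bilin_H]
      D_linear_left(1)[OF K h[OF cF G] Om_sg[OF h[OF F cG]]] D_linear_left(4)[OF K h[OF F cG] h[OF F cG]]
      D_linear_left(1)[OF G h[OF cF K] Om_sg[OF h[OF F cK]]] D_linear_left(4)[OF G h[OF F cK] h[OF F cK]]
      D_linear_left(1)[OF F h[OF cG K] Om_sg[OF h[OF G cK]]] D_linear_left(4)[OF F h[OF G cK] h[OF G cK]]
    by (simp add: sg_norm eps_commute[of nu "dg x"] eps_commute[of \<alpha> "dg x"] eps_commute[of \<beta> "dg x"]
        eps_commute[of \<kappa> "dg x"] algebra_simps)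
qed

text \<open>Iterates \<open>cut_U2\<close>: each label is handed to one of the arguments, and the
  sign records that the labels of the second argument pass what is left of the first.\<close>

lemma polar_U2:
  assumes "Om GS \<alpha> F" "Om GS \<beta> G"
  shows "U2 \<alpha> \<beta> F G (map Inl ls @ ws) = sh dgl ls (\<lambda>a b. sg (eps (degs dgl b) (\<alpha> - degs dgl a))
    (U2 (\<alpha> - degs dgl a) (\<beta> - degs dgl b) (cuts a F) (cuts b G) ws))"
  using assms
proof (induction ls arbitrary: F G \<alpha> \<beta>)
  case (Cons i ls)
  note F = Cons.prems(1) and G = Cons.prems(2)
  have "U2 \<alpha> \<beta> F G (map Inl (i # ls) @ ws) = cut (Inl i) (U2 \<alpha> \<beta> F G) (map Inl ls @ ws)"
    by (simp add: cut_apply[of _ "U2 _ _ _ _"])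
  then show ?case
    unfolding cut_U2[OF F G refl] plus_fun_apply sg_apply Cons.IH[OF Om_cut[OF F] G]
      Cons.IH[OF F Om_cut[OF G]] sh_sg[symmetric]
    by (simp add: sg_norm eps_commute[of "degs _ _" "dgl i"] diff_diff_add)
qed (simp add: eps_simps)

lemma polar_U3:
  assumes "Om GS \<alpha> F" "Om GS \<beta> G" "Om GS \<kappa> K"
  shows "U3 \<alpha> \<beta> \<kappa> F G K (map Inl ls @ ws) = sh3 dgl ls (\<lambda>a b c.
    sg (eps (degs dgl b) (\<alpha> - degs dgl a) + eps (degs dgl c) (\<alpha> - degs dgl a + (\<beta> - degs dgl b) + nu))
    (U3 (\<alpha> - degs dgl a) (\<beta> - degs dgl b) (\<kappa> - degs dgl c) (cuts a F) (cuts b G) (cuts c K) ws))"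
  using assms
proof (induction ls arbitrary: F G K \<alpha> \<beta> \<kappa>)
  case (Cons i ls)
  note F = Cons.prems(1) and G = Cons.prems(2) and K = Cons.prems(3)
  have "U3 \<alpha> \<beta> \<kappa> F G K (map Inl (i # ls) @ ws) = cut (Inl i) (U3 \<alpha> \<beta> \<kappa> F G K) (map Inl ls @ ws)"
    by (simp add: cut_apply[of _ "U3 _ _ _ _ _ _"])
  then show ?case
    unfolding cut_U3[OF F G K] plus_fun_apply sg_apply Cons.IH[OF Om_cut[OF F] G K]
      Cons.IH[OF F Om_cut[OF G] K] Cons.IH[OF F G Om_cut[OF K]] sh3_sg[symmetric]
    by (simp add: sg_norm eps_commute[of "degs _ _" "dgl i"] diff_diff_add)
qed (simp add: eps_simps)

text \<open>On a word of vectors this removes all splits of the labels that leave some argument with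
  a parameter count other than zero.\<close>

lemma U2_label_free:
  assumes F: "Om GS \<alpha> F" and G: "Om GS \<beta> G" and "fst \<alpha> \<noteq> 0 \<or> fst \<beta> \<noteq> 0"
    and ws: "label_free ws"
  shows "U2 \<alpha> \<beta> F G ws = 0"
proof -
  note OmF = OmD(2)[OF F] and OmG = OmD(2)[OF G] and u = OmD(2)[OF Om_base]
  have *: "(\<forall>ws. label_free ws \<longrightarrow> F ws = 0) \<or> (\<forall>ws. label_free ws \<longrightarrow> G ws = 0)"
    using Om_label_free[OF F] Om_label_free[OF G] assms(3) by blast
  have "pa F base ws = 0" if "\<forall>ws. label_free ws \<longrightarrow> F ws = 0" "label_free ws" for ws F
    using that(1) pr_label_free[OF that(2) bilin_act GS MS, of F base] u by simp
  then have "D (pa G base) F ws = 0" "D (pa F base) G ws = 0"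
    using * by (auto intro!: D_label_free[OF ws F] D_label_free[OF ws G])
  then show ?thesis
    using pr_label_free[OF ws bilin_br GS GS OmF OmG *] by (simp add: U2_def sg_apply)
qed

lemma U3_label_free:
  assumes F: "Om GS \<alpha> F" and G: "Om GS \<beta> G" and K: "Om GS \<kappa> K"
    and "fst \<alpha> \<noteq> 0 \<or> fst \<beta> \<noteq> 0 \<or> fst \<kappa> \<noteq> 0" and ws: "label_free ws"
  shows "U3 \<alpha> \<beta> \<kappa> F G K ws = 0"
proof -
  have *: "(\<forall>ws. label_free ws \<longrightarrow> F ws = 0) \<or> (\<forall>ws. label_free ws \<longrightarrow> G ws = 0)
      \<or> (\<forall>ws. label_free ws \<longrightarrow> K ws = 0)"
    using Om_label_free[OF F] Om_label_free[OF G] Om_label_free[OF K] assms(4) by blast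
  have h: "ph F G ws = 0" if "(\<forall>ws. label_free ws \<longrightarrow> F ws = 0) \<or> (\<forall>ws. label_free ws \<longrightarrow> G ws = 0)"
    "label_free ws" for F G ws
    using that(1) pr_label_free[OF that(2) bilin_H GS GS, of F G] by simp
  have "D (ph F G) K ws = 0" "D (ph F K) G ws = 0" "D (ph G K) F ws = 0"
    using * by (auto intro!: D_label_free[OF ws F] D_label_free[OF ws G] D_label_free[OF ws K] h)
  then show ?thesis by (simp add: U3_def sg_apply)
qed

end

context insertion_calculus
begin

lemma Om_sum: "is_space S \<Longrightarrow> (\<And>i. i \<in> I \<Longrightarrow> Om S \<gamma> (F i)) \<Longrightarrow> Om S \<gamma> (\<Sum>i\<in>I. F i)"
  by (induction I rule: infinite_finite_induct) (auto simp: Om_zero intro: Om_add)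

lemma cut_sum: "cut x (\<Sum>i\<in>I. F i) = (\<Sum>i\<in>I. cut x (F i))"
  by (induction I rule: infinite_finite_induct) (simp_all add: cut_def fun_eq_iff)

lemma degs_dgl: "degs dgl a = (int (length a), - (\<Sum>i\<leftarrow>a. d i))"
  by (induction a) (auto simp: zero_prod_def)

definition eta :: "nat \<Rightarrow> (nat + 'm) list \<Rightarrow> 'k" where
  "eta i ws = (if ws = [Inl i] then 1 else 0)"

lemma is_space_field: "is_space ((*), UNIV :: 'k set)"
proof -
  interpret vector_space "(*) :: 'k \<Rightarrow> 'k \<Rightarrow> 'k" by unfold_locales (auto simp: algebra_simps)
  show ?thesis by (simp add: is_space_def vector_space_axioms)
qed

lemma Om_eta: "Om ((*), UNIV) (dgl i) (eta i)"
proof (rule OmI)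
  show "is_space ((*), UNIV :: 'k set)" by (rule is_space_field)
qed (auto simp: eta_def append_eq_Cons_conv split: if_splits)

lemma sh_left_Nil: "sh dg' xs (\<lambda>a b. if a = [] then f b else 0) = f xs"
  by (induction xs arbitrary: f) (simp_all add: if_distrib[of "sg _"] eps_simps cong: if_cong)

end

context twisted_calculus
begin

text \<open>The global sign restores the placement of signs in \<open>bracket2\<close>, see
  \<open>bracket2_eq\<close>; being symmetric in p and q, it leaves the rule for exchanging
  arguments unchanged.\<close>

definition L2 where
  "L2 p q P Q = (\<lambda>us. sg (p * q) (U2 (0, p) (0, q) (lift P) (lift Q) (map Inr us)))"

text \<open>The asymmetric summand r absorbs the slot \<open>nu\<close> that \<open>U3\<close> has
  between its last two arguments, so that exchanges obey the plain Koszul rule. Agreement with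
  \<open>bracket3\<close> is \<open>bracket3_eq\<close>.\<close>

definition L3 where
  "L3 p q r P Q R = (\<lambda>us. - sg (p * q + p * r + q * r + r)
     (U3 (0, p) (0, q) (0, r) (lift P) (lift Q) (lift R) (map Inr us)))"

abbreviation hom where "hom p P \<equiv> Om GS (0, p) (lift P)"

lemma L2_swap: "hom p P \<Longrightarrow> hom q Q \<Longrightarrow> L2 q p Q P us = - sg (p * q) (L2 p q P Q us)"
  using U2_swap[of "(0, p)" "lift P" "(0, q)" "lift Q"]
  by (simp add: L2_def eps_def sg_apply mult.commute sg_simps)

lemma L3_swap12:
  "hom p P \<Longrightarrow> hom q Q \<Longrightarrow> hom r R \<Longrightarrow> L3 q p r Q P R us = - sg (p * q) (L3 p q r P Q R us)"
  using U3_swap12[of "(0, p)" "lift P" "(0, q)" "lift Q" "(0, r)" "lift R"]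
  by (simp add: L3_def eps_def sg_def)

lemma L3_swap23:
  "hom p P \<Longrightarrow> hom q Q \<Longrightarrow> hom r R \<Longrightarrow> L3 p r q P R Q us = - sg (q * r) (L3 p q r P Q R us)"
  using U3_swap23[of "(0, p)" "lift P" "(0, q)" "lift Q" "(0, r)" "lift R"]
  by (simp add: L3_def eps_def sg_def)

lemma scale_double: "scale c (v + v) = scale (2 * c) v"
  by (metis mult_2 scale_left_distrib scale_right_distrib)

lemma scale_triple: "scale c (v + v + v) = scale (3 * c) v"
  by (simp add: algebra_simps flip: scale_left_distrib)

lemma scale_half: "scale (- (1/2)) (- (v + v)) = v"
  unfolding scale_minus_right scale_double by simp

lemma scale_sixth: "scale (- (1/6)) (- ((v + v + v) + (v + v + v))) = v"
  unfolding scale_minus_right scale_double scale_triple by simp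

section \<open>The generic element and its coefficients\<close>

context
  fixes n :: nat and x
  assumes x: "hom (d i) (x i)"
begin

definition source where
  "source = (\<Sum>i<n. pr scale (eta i) (lift (x i)))"

lemma bilin_scale: "bilin ((*), UNIV) GS GS scale"
  by (simp add: bilin_def algebra_simps)

lemma Om_source: "Om GS (1, 0) source"
  unfolding source_def
proof (intro Om_sum GS)
  show "Om GS (1, 0) (pr scale (eta i) (lift (x i)))" for i
    using Om_pr[OF Om_eta x bilin_scale GS, of i i] by simp
qed

lemma cut_source: "j < n \<Longrightarrow> cut (Inl j) source = lift (x j)"
proof -
  have 0: "cut (Inl j) (lift f) = 0" for f :: "'m list \<Rightarrow> 'g"
    by (auto simp: cut_def lift_def fun_eq_iff)
  have "pr scale (eta i) 0 = 0" for i by (simp add: pr_def fun_eq_iff)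
  moreover have "pr scale (cut (Inl j) (eta i)) (lift (x i)) = (if i = j then lift (x j) else 0)" for i
  proof -
    have "scale (cut (Inl j) (eta i) a) y = (if a = [] then (if i = j then y else 0) else 0)" for a y
      by (simp add: cut_def eta_def)
    then show ?thesis by (simp add: pr_def sh_left_Nil fun_eq_iff)
  qed
  ultimately have "cut (Inl j) (pr scale (eta i) (lift (x i))) = (if i = j then lift (x j) else 0)" for i
    using cut_pr[OF Om_eta x bilin_scale, of "Inl j" i i] by (simp add: 0)
  then show "j < n \<Longrightarrow> ?thesis" by (simp add: source_def cut_sum)
qed

text \<open>Counting parameters leaves only the splits with i labels for \<open>E\<close> and one
  for the generic element. For these the polarisation sign is exactly the one built into
  \<open>L2\<close>.\<close>

lemma L2_sum:
  assumes E: "Om GS (int i, s) E"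
    and y: "\<And>a. length a = i \<Longrightarrow> set a \<subseteq> {..<n} \<Longrightarrow> cuts a E = lift (y a)"
    and ls: "set ls \<subseteq> {..<n}"
  shows "sh dgl ls (\<lambda>a b. if length a = i \<and> length b = 1
      then L2 (s + (\<Sum>k\<leftarrow>a. d k)) (d (b ! 0)) (y a) (x (b ! 0)) us else 0)
    = U2 (int i, s) (1, 0) E source (map Inl ls @ map Inr us)"
  unfolding polar_U2[OF E Om_source]
proof (rule sh_cong, goal_cases)
  case (1 a b)
  show ?case
  proof (cases "length a = i \<and> length b = 1")
    case True
    then obtain k where b: "b = [k]" by (auto simp: length_Suc_conv)
    with 1 ls have "k < n" "set a \<subseteq> {..<n}" by auto
    with True b y[of a] show ?thesis
      by (simp add: L2_def degs_dgl cut_source sg_def eps_def flip: cuts_simps(2) del: cuts_simps(2))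
  next
    case False
    then have "U2 ((int i, s) - degs dgl a) ((1, 0) - degs dgl b) (cuts a E) (cuts b source) (map Inr us) = 0"
      by (intro U2_label_free Om_cuts E Om_source) (auto simp: degs_dgl)
    with False show ?thesis by auto
  qed
qed

text \<open>As in \<open>L2_sum\<close>, but the two labels going to the generic elements occur in
  both orders with equal contributions, whence the doubling; the minus sign is that of
  \<open>L3\<close>.\<close>

lemma L3_sum:
  fixes us :: "'m list"
  assumes E: "Om GS (int i, s) E"
    and y: "\<And>a. length a = i \<Longrightarrow> set a \<subseteq> {..<n} \<Longrightarrow> cuts a E = lift (y a)"
    and ls: "set ls \<subseteq> {..<n}"
  defines "S \<equiv> sh dgl ls (\<lambda>a b. if length a = i \<and> length b = 2
      then L3 (s + (\<Sum>k\<leftarrow>a. d k)) (d (b ! 0)) (d (b ! 1)) (y a) (x (b ! 0)) (x (b ! 1)) us else 0)"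
  shows "U3 (int i, s) (1, 0) (1, 0) E source source (map Inl ls @ map Inr us) = - (S + S)"
proof -
  define f where "f a k l = L3 (s + (\<Sum>k\<leftarrow>a. d k)) (d k) (d l) (y a) (x k) (x l) us" for a k l
  have "U3 (int i, s) (1, 0) (1, 0) E source source (map Inl ls @ map Inr us)
      = sh3 dgl ls (\<lambda>a b c. if length a = i \<and> length b = 1 \<and> length c = 1 then - f a (b ! 0) (c ! 0) else 0)"
    unfolding polar_U3[OF E Om_source Om_source]
  proof (rule sh3_cong, goal_cases)
    case (1 a b c)
    show ?case
    proof (cases "length a = i \<and> length b = 1 \<and> length c = 1")
      case True
      then obtain k l where b: "b = [k]" "c = [l]" by (auto simp: length_Suc_conv)
      with 1 ls have "k < n" "l < n" "set a \<subseteq> {..<n}" by auto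
      moreover have "cuts [j] source = cut (Inl j) source" for j by (simp add: cuts_def cut_def)
      ultimately show ?thesis using True b y[of a]
        by (cases "even (d k)"; cases "even (d l)"; cases "even s"; cases "even (\<Sum>k\<leftarrow>a. d k)")
          (simp_all add: f_def L3_def degs_dgl cut_source sg_def eps_def)
    next
      case False
      then have "U3 ((int i, s) - degs dgl a) ((1, 0) - degs dgl b) ((1, 0) - degs dgl c)
          (cuts a E) (cuts b source) (cuts c source) (map Inr us) = 0"
        by (intro U3_label_free Om_cuts E Om_source) (auto simp: degs_dgl)
      with False show ?thesis by auto
    qed
  qed
  also have "\<dots> = sh dgl ls (\<lambda>a bc. sh dgl bc
      (\<lambda>b c. if length a = i \<and> length b = 1 \<and> length c = 1 then - f a (b ! 0) (c ! 0) else 0))"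
    by (rule sh_sh_right[symmetric])
  also have "\<dots> = sh dgl ls (\<lambda>a b. if length a = i \<and> length b = 2 then - (f a (b ! 0) (b ! 1) + f a (b ! 0) (b ! 1)) else 0)"
  proof (rule sh_cong, goal_cases)
    case (1 a bc)
    show ?case
    proof (cases "length a = i \<and> length bc = 2")
      case True
      then obtain k l where bc: "bc = [k, l]" by (auto simp: length_Suc_conv numeral_2_eq_2)
      with 1 ls True have a: "set a \<subseteq> {..<n}" by auto
      have "hom (s + (\<Sum>k\<leftarrow>a. d k)) (y a)"
        using Om_cuts[OF E, of a] y[of a] True a by (simp add: degs_dgl)
      \<comment> \<open>The labels k and l commute up to the exponent 1 + d k * d l, which this sign
        compensates exactly.\<close>
      then have "f a l k = - sg (d k * d l) (f a k l)"
        unfolding f_def by (intro L3_swap23 x)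
      with True bc show ?thesis by (simp add: eps_simps eps_def sg_def)
    next
      case False
      have "sh dgl bc (\<lambda>b c. if length a = i \<and> length b = 1 \<and> length c = 1 then - f a (b ! 0) (c ! 0) else 0)
          = sh dgl bc (\<lambda>b c. 0)"
        using False by (intro sh_cong) auto
      with False show ?thesis by auto
    qed
  qed
  also have "\<dots> = - (S + S)"
    unfolding S_def f_def[symmetric] sh_add[symmetric] sh_minus[symmetric]
    by (intro sh_cong) simp
  finally show ?thesis .
qed

definition y2 where "y2 a = L2 (d (a ! 0)) (d (a ! 1)) (x (a ! 0)) (x (a ! 1))"

definition y3 where
  "y3 a = L3 (d (a ! 0)) (d (a ! 1)) (d (a ! 2)) (x (a ! 0)) (x (a ! 1)) (x (a ! 2))"

text \<open>At two labels \<open>U2\<close> of the generic element meets both orders, each giving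
  \<open>L2\<close>; at three labels \<open>U3\<close> meets six, each giving minus
  \<open>L3\<close>. The factors normalise the coefficients to \<open>y2\<close> and
  \<open>y3\<close>.\<close>

definition "E2 = pointwise scale (1/2) (U2 (1, 0) (1, 0) source source)"

definition "E3 = pointwise scale (- (1/6)) (U3 (1, 0) (1, 0) (1, 0) source source source)"

lemma Om_E2: "Om GS (2, 0) E2" and Om_E3: "Om GS (3, - 1) E3"
  using Om_pointwise[OF Om_U2[OF Om_source Om_source], of "1/2"]
    Om_pointwise[OF Om_U3[OF Om_source Om_source Om_source], of "- (1/6)"]
  by (simp_all add: E2_def E3_def)

lemma cuts_source: "length a = 1 \<Longrightarrow> set a \<subseteq> {..<n} \<Longrightarrow> cuts a source = lift (x (a ! 0))"
  by (cases a) (auto simp: cuts_def cut_def simp flip: cut_source)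

text \<open>\<open>L2_sum\<close> is used with the generic element in both places; the two splits of
  a pair of labels agree by \<open>L2_swap\<close>.\<close>

lemma cuts_E2:
  assumes "length a = 2" "set a \<subseteq> {..<n}"
  shows "cuts a E2 = lift (y2 a)"
proof -
  obtain i j where a: "a = [i, j]" using assms(1) by (auto simp: length_Suc_conv numeral_2_eq_2)
  have eq: "cuts a E2 (map Inr us) = y2 a us" for us
  proof -
    have "U2 (1, 0) (1, 0) source source (map Inl a @ map Inr us)
        = L2 (d i) (d j) (x i) (x j) us + L2 (d i) (d j) (x i) (x j) us"
      using L2_sum[of 1 0 source "\<lambda>a. x (a ! 0)" a us] Om_source cuts_source assms(2)
        L2_swap[OF x[of i] x[of j], of us] by (auto simp: a eps_simps eps_def sg_def cong: if_cong split: if_splits)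
    then show ?thesis
      by (simp add: E2_def cuts_def pointwise_def y2_def a scale_double)
  qed
  \<comment> \<open>No parameter is left after two cuts, so agreement on words of vectors determines
    the whole form.\<close>
  have "Om GS (0, \<Sum>k\<leftarrow>a. d k) (cuts a E2)"
    using Om_cuts[OF Om_E2, of a] by (simp add: a algebra_simps)
  from Om_eq_lift[OF this] show ?thesis by (simp add: eq)
qed

text \<open>Three choices for the label of the first argument, each doubled by
  \<open>L3_sum\<close>, contribute equally by graded antisymmetry.\<close>

lemma cuts_E3:
  assumes "length a = 3" "set a \<subseteq> {..<n}"
  shows "cuts a E3 = lift (y3 a)"
proof -
  obtain i j k where a: "a = [i, j, k]" using assms(1) by (auto simp: length_Suc_conv numeral_3_eq_3)
  have eq: "cuts a E3 (map Inr us) = y3 a us" for us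
  proof -
    define v where "v = L3 (d i) (d j) (d k) (x i) (x j) (x k) us"
    have v: "L3 (d j) (d i) (d k) (x j) (x i) (x k) us = - sg (d i * d j) v"
      "L3 (d k) (d i) (d j) (x k) (x i) (x j) us = sg (d i * d k) (sg (d j * d k) v)"
      using L3_swap12[OF x[of i] x[of j] x[of k], of us] L3_swap12[OF x[of i] x[of k] x[of j], of us]
        L3_swap23[OF x[of i] x[of j] x[of k], of us] by (simp_all add: v_def sg_simps)
    have "U3 (1, 0) (1, 0) (1, 0) source source source (map Inl a @ map Inr us)
        = - ((v + v + v) + (v + v + v))"
      using L3_sum[of 1 0 source "\<lambda>a. x (a ! 0)" a us] Om_source cuts_source assms(2) v
      by (auto simp: a eps_simps eps_def sg_def simp flip: v_def cong: if_cong split: if_splits)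
    then show ?thesis
      unfolding E3_def cuts_def pointwise_def by (simp only: scale_sixth) (simp add: y3_def a v_def)
  qed
  have "Om GS (0, (\<Sum>k\<leftarrow>a. d k) - 1) (cuts a E3)"
    using Om_cuts[OF Om_E3, of a] by (simp add: a algebra_simps)
  from Om_eq_lift[OF this] show ?thesis by (simp add: eq)
qed

text \<open>The coefficient of \<open>diagonal_3\<close> at the labels \<open>ls\<close>.\<close>

lemma jacobi_3:
  assumes "set ls \<subseteq> {..<n}"
  shows "sh dgl ls (\<lambda>a b. if length a = 2 \<and> length b = 1
      then L2 (\<Sum>k\<leftarrow>a. d k) (d (b ! 0)) (y2 a) (x (b ! 0)) us else 0) = 0"
proof -
  have "U2 (2, 0) (1, 0) E2 source = 0"
    unfolding E2_def U2_scale[OF Om_U2_PP[OF Om_source] Om_source] diagonal_3[OF Om_source]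
    by (simp add: pointwise_def fun_eq_iff)
  then show ?thesis using L2_sum[of 2 0 E2 y2 ls us] Om_E2 cuts_E2 assms by (simp cong: if_cong)
qed

lemma E3_eq: "E3 = pointwise scale (- (1/2)) (D (ph source source) source)"
  unfolding E3_def U3_PPP[OF Om_source] by (simp add: pointwise_def fun_eq_iff scale_triple)

text \<open>With w = U2 (D W P) P, the 1/2 in \<open>E2\<close> cancels the doubling in
  \<open>diagonal_4\<close>, so \<open>U3\<close> of \<open>E2\<close> is w, while \<open>U2\<close>
  of \<open>E3\<close> is -w/2. At the labels the former is -2 S and the latter T, hence S =
  T.\<close>

lemma jacobi_4:
  assumes "set ls \<subseteq> {..<n}"
  shows "sh dgl ls (\<lambda>a b. if length a = 2 \<and> length b = 2
      then L3 (\<Sum>k\<leftarrow>a. d k) (d (b ! 0)) (d (b ! 1)) (y2 a) (x (b ! 0)) (x (b ! 1)) us else 0)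
    = sh dgl ls (\<lambda>a b. if length a = 3 \<and> length b = 1
      then L2 (- 1 + (\<Sum>k\<leftarrow>a. d k)) (d (b ! 0)) (y3 a) (x (b ! 0)) us else 0)" (is "?S = ?T")
proof -
  let ?w = "U2 (3, - 1) (1, 0) (D (ph source source) source) source"
  have "U3 (2, 0) (1, 0) (1, 0) E2 source source = ?w"
    unfolding E2_def U3_scale[OF Om_U2_PP[OF Om_source] Om_source Om_source] diagonal_4[OF Om_source]
    by (simp add: pointwise_def fun_eq_iff scale_double)
  moreover have "U2 (3, - 1) (1, 0) E3 source = pointwise scale (- (1/2)) ?w"
    unfolding E3_eq by (rule U2_scale[OF Om_DW[OF Om_source] Om_source])
  moreover have "U3 (int 2, 0) (1, 0) (1, 0) E2 source source (map Inl ls @ map Inr us) = - (?S + ?S)"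
    using L3_sum[of 2 0 E2 y2 ls us] Om_E2 cuts_E2 assms by (simp cong: if_cong)
  moreover have "U2 (int 3, - 1) (1, 0) E3 source (map Inl ls @ map Inr us) = ?T"
    by (rule L2_sum[OF _ _ assms, symmetric]) (use Om_E3 cuts_E3 in simp_all)
  ultimately have "?T = scale (- (1/2)) (- (?S + ?S))"
    by (simp add: pointwise_def del: scale_minus_right)
  then show ?thesis by (simp only: scale_half)
qed

lemma jacobi_5:
  assumes "set ls \<subseteq> {..<n}"
  shows "sh dgl ls (\<lambda>a b. if length a = 3 \<and> length b = 2
      then L3 (- 1 + (\<Sum>k\<leftarrow>a. d k)) (d (b ! 0)) (d (b ! 1)) (y3 a) (x (b ! 0)) (x (b ! 1)) us else 0) = 0"
    (is "?S = 0")
proof -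
  have u: "U3 (int 3, - 1) (1, 0) (1, 0) E3 source source = 0"
    unfolding E3_eq of_nat_numeral U3_scale[OF Om_DW[OF Om_source] Om_source Om_source]
    by (simp add: diagonal_5[OF Om_source] pointwise_def fun_eq_iff)
  have "U3 (int 3, - 1) (1, 0) (1, 0) E3 source source (map Inl ls @ map Inr us) = - (?S + ?S)"
    by (rule L3_sum[OF _ _ assms]) (use Om_E3 cuts_E3 in simp_all)
  then have "?S + ?S = 0 + 0" 
    unfolding u zero_fun_apply neg_0_equal_iff_equal by (simp only: add_0)
  then show ?thesis unfolding is_space_cancel(1)[OF GS] .
qed

end

end

section \<open>Shuffle permutations\<close>

definition invs :: "nat \<Rightarrow> (nat \<Rightarrow> nat) \<Rightarrow> (nat \<times> nat) set" where
  "invs n \<sigma> = {(i, j). i < j \<and> j < n \<and> \<sigma> j < \<sigma> i}"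

lemma finite_invs [simp]: "finite (invs n \<sigma>)"
  by (rule finite_subset[of _ "{..<n} \<times> {..<n}"]) (auto simp: invs_def)

text \<open>Without descents the values form a sorted list of all of {..<n}, and there is only one
  such list.\<close>

lemma invs_empty:
  assumes "\<sigma> permutes {..<n}" "\<And>k. Suc k < n \<Longrightarrow> \<sigma> k < \<sigma> (Suc k)"
  shows "\<sigma> = id"
proof -
  have "\<sigma> i \<le> \<sigma> j" if "i \<le> j" "j < n" for i j
    using that
  proof (induction j)
    case (Suc j)
    then show ?case using assms(2)[of j] by (cases "i = Suc j") (auto simp: less_imp_le intro: order.trans)
  qed simp
  then have "sorted (map \<sigma> [0..<n])" by (auto simp: sorted_iff_nth_mono)
  moreover have "distinct (map \<sigma> [0..<n])"
    using permutes_inj[OF assms(1)] by (auto simp: distinct_map inj_on_def)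
  moreover have "set (map \<sigma> [0..<n]) = set [0..<n]"
    using permutes_image[OF assms(1)] by (simp add: lessThan_atLeast0)
  ultimately have "map \<sigma> [0..<n] = [0..<n]"
    by (intro sorted_distinct_set_unique) auto
  then have "\<sigma> i = i" if "i < n" for i
    using that by (metis add_0 length_upt minus_nat.diff_0 nth_map nth_upt)
  with assms(1) show ?thesis by (auto simp: permutes_def fun_eq_iff)
qed

text \<open>Exchanging neighbours preserves the order of every increasing pair except the pair of
  neighbours itself.\<close>

lemma invs_transpose:
  assumes "Suc k < n" "\<sigma> (Suc k) < \<sigma> k"
  defines "t \<equiv> Transposition.transpose k (Suc k)"
  shows "bij_betw (map_prod t t) (invs n (\<sigma> \<circ> t)) (invs n \<sigma> - {(k, Suc k)})"
proof (rule bij_betwI[where g = "map_prod t t"])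
  have t: "t (t i) = i" "t i < n \<longleftrightarrow> i < n" for i
    using assms(1) by (auto simp: t_def transpose_def)
  have lt: "t i < t j" if "i < j" "(i, j) \<noteq> (k, Suc k)" for i j
    using that by (auto simp: t_def transpose_def)
  have tk: "t k = Suc k" "t (Suc k) = k" by (simp_all add: t_def)
  show "map_prod t t \<in> invs n (\<sigma> \<circ> t) \<rightarrow> invs n \<sigma> - {(k, Suc k)}"
  proof
    fix p assume "p \<in> invs n (\<sigma> \<circ> t)"
    then obtain i j where p: "p = (i, j)" "i < j" "j < n" "\<sigma> (t j) < \<sigma> (t i)" by (auto simp: invs_def)
    then have "(i, j) \<noteq> (k, Suc k)" using assms(2) by (auto simp: tk)
    moreover have "(t i, t j) \<noteq> (k, Suc k)" using p(2) t(1) tk by (metis Pair_inject Suc_n_not_le_n less_or_eq_imp_le)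
    ultimately show "map_prod t t p \<in> invs n \<sigma> - {(k, Suc k)}"
      using p lt[of i j] t(2) by (auto simp: invs_def)
  qed
  show "map_prod t t \<in> invs n \<sigma> - {(k, Suc k)} \<rightarrow> invs n (\<sigma> \<circ> t)"
    using lt t by (auto simp: invs_def)
  show "map_prod t t (map_prod t t p) = p" for p by (cases p) (simp add: t)
  then show "map_prod t t (map_prod t t p) = p" for p .
qed

text \<open>Induction on the number of inversions: undoing a descent between neighbours removes
  exactly one.\<close>

lemma sign_invs: "\<sigma> permutes {..<n} \<Longrightarrow> sign \<sigma> = (- 1) ^ card (invs n \<sigma>)"
proof (induction "card (invs n \<sigma>)" arbitrary: \<sigma> rule: less_induct)
  case less
  show ?case
  proof (cases "\<exists>k. Suc k < n \<and> \<sigma> (Suc k) < \<sigma> k")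
    case False
    have "\<sigma> k < \<sigma> (Suc k)" if "Suc k < n" for k
      using False that permutes_inj[OF less.prems] by (metis injD linorder_neqE_nat n_not_Suc_n)
    then have "\<sigma> = id" by (rule invs_empty[OF less.prems])
    moreover have "invs n id = {}" by (auto simp: invs_def)
    ultimately show ?thesis by simp
  next
    case True
    then obtain k where k: "Suc k < n" "\<sigma> (Suc k) < \<sigma> k" by blast
    define t where "t = Transposition.transpose k (Suc k)"
    have "(k, Suc k) \<in> invs n \<sigma>" using k by (simp add: invs_def)
    then have c: "card (invs n \<sigma>) = Suc (card (invs n (\<sigma> \<circ> t)))"
      using bij_betw_same_card[OF invs_transpose[OF k]] unfolding t_def by (metis card_Suc_Diff1 finite_invs)
    have p: "\<sigma> \<circ> t permutes {..<n}"
      unfolding t_def using k(1) by (intro permutes_compose[OF permutes_swap_id less.prems]) auto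
    have "sign (\<sigma> \<circ> t) = sign \<sigma> * sign t"
      by (rule sign_compose) (use less.prems in \<open>auto intro: permutes_imp_permutation simp: t_def permutation_swap_id\<close>)
    moreover have "sign t = - 1" unfolding t_def by (simp add: sign_swap_id)
    ultimately show ?thesis using less.hyps[OF _ p] c by simp
  qed
qed

lemma scale_prod_sg:
  assumes "vector_space s" "finite I"
  shows "s (of_int ((\<Prod>i\<in>I. if odd (h i) then - 1 else 1))) v = sg (\<Sum>i\<in>I. h i) v"
proof -
  interpret vector_space s by fact
  show ?thesis using assms(2)
    by (induction I arbitrary: v) (auto simp: sg_simps sg_def)
qed

lemma scale_sign:
  assumes "vector_space s" "\<sigma> permutes {..<n}"
  shows "s (of_int (sign \<sigma>)) v = sg (\<Sum>p\<in>invs n \<sigma>. 1) v"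
  using scale_prod_sg[OF assms(1) finite_invs, of "\<lambda>_. 1" n \<sigma> v] by (simp add: sign_invs[OF assms(2)])

text \<open>Both signs are products over the inversions, and the joint exponent of a pair is
  \<open>eps\<close> of the grades of the two parameters.\<close>

lemma scale_koszul:
  assumes "vector_space s" "\<sigma> permutes {..<n}"
  shows "s (of_int (sign \<sigma> * koszul_sign d n \<sigma>)) v
    = sg (\<Sum>(i, j)\<in>invs n \<sigma>. 1 + d (\<sigma> i) * d (\<sigma> j)) v"
proof -
  have "sign \<sigma> * koszul_sign d n \<sigma>
      = (\<Prod>p\<in>invs n \<sigma>. if odd (1 + d (\<sigma> (fst p)) * d (\<sigma> (snd p))) then - 1 else 1)"
    unfolding koszul_sign_def sign_invs[OF assms(2)] invs_def[symmetric]
    by (simp add: case_prod_unfold prod_constant[symmetric] prod.distrib[symmetric] del: prod_constant)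
      (intro prod.cong, auto)
  then show ?thesis
    using scale_prod_sg[OF assms(1) finite_invs, of "\<lambda>p. 1 + d (\<sigma> (fst p)) * d (\<sigma> (snd p))" n \<sigma> v]
    by (simp add: case_prod_unfold)
qed

text \<open>
  A shuffle is encoded by the colouring that assigns to each position the block it comes from.
\<close>

definition pick :: "nat \<Rightarrow> 'x list \<Rightarrow> nat list \<Rightarrow> 'x list" where
  "pick k xs w = map fst (filter (\<lambda>(x, c). c = k) (zip xs w))"

lemma pick_simps [simp]:
  "pick k [] w = []" "pick k (x # xs) (c # w) = (if c = k then x # pick k xs w else pick k xs w)"
  by (simp_all add: pick_def)

text \<open>The exponent of the shuffle sign: one summand for every pair of letters whose later
  member goes to an earlier part.\<close>

fun colour_sign :: "('x \<Rightarrow> grade) \<Rightarrow> 'x list \<Rightarrow> nat list \<Rightarrow> int" where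
  "colour_sign dg (x # xs) (c # w)
     = (\<Sum>(y, c')\<leftarrow>zip xs w. if c' < c then eps (dg y) (dg x) else 0) + colour_sign dg xs w"
| "colour_sign dg _ _ = 0"

definition colourings :: "nat \<Rightarrow> nat list set" where
  "colourings n = {w. set w \<subseteq> {..<3} \<and> length w = n}"

lemma colourings_Suc: "colourings (Suc n) = (#) 0 ` colourings n \<union> (#) 1 ` colourings n \<union> (#) 2 ` colourings n"
  by (auto simp: colourings_def length_Suc_conv image_iff)

lemma finite_colourings [simp]: "finite (colourings n)"
  by (induction n) (simp_all add: colourings_Suc colourings_def[of 0] Collect_conv_if)

lemma colour_sum:
  assumes "w \<in> colourings (length xs)"
  shows "(\<Sum>(y, c)\<leftarrow>zip xs w. if c < 0 then eps (dg y) \<gamma> else 0) = 0"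
    "(\<Sum>(y, c)\<leftarrow>zip xs w. if c < 1 then eps (dg y) \<gamma> else 0) = eps \<gamma> (degs dg (pick 0 xs w))"
    "(\<Sum>(y, c)\<leftarrow>zip xs w. if c < 2 then eps (dg y) \<gamma> else 0)
      = eps \<gamma> (degs dg (pick 0 xs w) + degs dg (pick 1 xs w))"
proof -
  have "length xs = length w" "set w \<subseteq> {..<3}" using assms by (auto simp: colourings_def)
  then show "(\<Sum>(y, c)\<leftarrow>zip xs w. if c < 0 then eps (dg y) \<gamma> else 0) = 0"
    "(\<Sum>(y, c)\<leftarrow>zip xs w. if c < 1 then eps (dg y) \<gamma> else 0) = eps \<gamma> (degs dg (pick 0 xs w))"
    "(\<Sum>(y, c)\<leftarrow>zip xs w. if c < 2 then eps (dg y) \<gamma> else 0)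
      = eps \<gamma> (degs dg (pick 0 xs w) + degs dg (pick 1 xs w))"
    by (induction xs w rule: list_induct2) (auto simp: eps_simps eps_commute[of \<gamma>])
qed

lemma colour_sign_Cons:
  assumes "w \<in> colourings (length xs)"
  shows "colour_sign dg (x # xs) (0 # w) = colour_sign dg xs w"
    "colour_sign dg (x # xs) (1 # w) = eps (dg x) (degs dg (pick 0 xs w)) + colour_sign dg xs w"
    "colour_sign dg (x # xs) (2 # w)
      = eps (dg x) (degs dg (pick 0 xs w) + degs dg (pick 1 xs w)) + colour_sign dg xs w"
  unfolding colour_sign.simps(1) colour_sum[OF assms] by simp_all

text \<open>Turns the recursion into a sum over a finite index set, which can then be reindexed by
  shuffles.\<close>

lemma sh3_colourings:
  "sh3 dg xs f = (\<Sum>w\<in>colourings (length xs).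
     sg (colour_sign dg xs w) (f (pick 0 xs w) (pick 1 xs w) (pick 2 xs w)))"
proof (induction xs arbitrary: f)
  case Nil
  have "colourings 0 = {[]}" by (auto simp: colourings_def)
  then show ?case by simp
next
  case (Cons x xs)
  let ?C = "colourings (length xs)"
  have "(\<Sum>w\<in>colourings (length (x # xs)). sg (colour_sign dg (x # xs) w)
        (f (pick 0 (x # xs) w) (pick 1 (x # xs) w) (pick 2 (x # xs) w)))
      = (\<Sum>w\<in>?C. sg (colour_sign dg (x # xs) (0 # w)) (f (x # pick 0 xs w) (pick 1 xs w) (pick 2 xs w)))
      + (\<Sum>w\<in>?C. sg (colour_sign dg (x # xs) (1 # w)) (f (pick 0 xs w) (x # pick 1 xs w) (pick 2 xs w)))
      + (\<Sum>w\<in>?C. sg (colour_sign dg (x # xs) (2 # w)) (f (pick 0 xs w) (pick 1 xs w) (x # pick 2 xs w)))"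
    unfolding list.size(4) add_0_right add_Suc_right colourings_Suc
    by (subst sum.union_disjoint, simp, simp, fastforce)+ (simp add: sum.reindex)
  also have "\<dots> = sh3 dg (x # xs) f"
    by (simp only: Cons.IH sh3.simps colour_sign_Cons sg_simps sg_commute cong: sum.cong)
  finally show ?case by simp
qed

definition places :: "nat \<Rightarrow> nat list \<Rightarrow> nat list" where
  "places k w = filter (\<lambda>x. w ! x = k) [0..<length w]"

lemma pick_places: "length xs = length w \<Longrightarrow> pick k xs w = map ((!) xs) (places k w)"
proof (induction xs w rule: list_induct2)
  case (Cons x xs c w)
  have "places k (c # w) = (if c = k then [0] else []) @ map Suc (places k w)"
    by (simp add: places_def upt_conv_Cons filter_map comp_def map_Suc_upt[symmetric] del: upt_Suc)
  with Cons show ?case by (simp add: comp_def)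
qed (simp add: places_def)

lemma colour_sign_eq:
  "length xs = length w \<Longrightarrow> colour_sign dg xs w
    = (\<Sum>(x, y)\<in>{(x, y). y < x \<and> x < length w \<and> w ! x < w ! y}. eps (dg (xs ! x)) (dg (xs ! y)))"
proof (induction xs w rule: list_induct2)
  case (Cons x xs c w)
  let ?P = "{(x, y). y < x \<and> x < length w \<and> w ! x < w ! y}"
  let ?Q = "{x. x < length w \<and> w ! x < c}"
  have fin: "finite ?P" by (rule finite_subset[of _ "{..<length w} \<times> {..<length w}"]) auto
  have P: "{(x, y). y < x \<and> x < length (c # w) \<and> (c # w) ! x < (c # w) ! y}
      = map_prod Suc Suc ` ?P \<union> (\<lambda>x. (Suc x, 0)) ` ?Q"
    by (auto simp: image_iff less_Suc_eq_0_disj nth_Cons' map_prod_def)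
  have "(\<Sum>(y, c')\<leftarrow>zip xs w. if c' < c then eps (dg y) (dg x) else 0)
      = (\<Sum>i<length w. if w ! i < c then eps (dg (xs ! i)) (dg x) else 0)"
    using Cons.hyps by (simp add: sum_list_sum_nth lessThan_atLeast0)
  also have "\<dots> = (\<Sum>i\<in>?Q. eps (dg (xs ! i)) (dg x))"
    by (simp add: sum.inter_filter[symmetric] flip: lessThan_def)
  finally show ?case
    unfolding P
    by (subst sum.union_disjoint)
      (use fin in \<open>auto simp: sum.reindex inj_on_def Cons.IH case_prod_unfold intro!: finite_imageI\<close>)
qed simp

text \<open>Slot i of the shuffled word holds the letter at \<sigma> i, so the letter at x belongs
  to the block that contains \<open>inv \<sigma> x\<close>.\<close>

definition shuffle_colouring :: "nat \<Rightarrow> nat \<Rightarrow> nat \<Rightarrow> (nat \<Rightarrow> nat) \<Rightarrow> nat list" where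
  "shuffle_colouring a b c \<sigma> = map (\<lambda>x. let i = inv \<sigma> x in
     if i < a then 0 else if i < a + b then 1 else 2) [0..<a + b + c]"

text \<open>The positions of each colour in increasing order, one colour after another. Being the
  identity beyond the word makes it a permutation in the sense of \<open>permutes\<close>.\<close>

definition colouring_shuffle :: "nat list \<Rightarrow> nat \<Rightarrow> nat" where
  "colouring_shuffle w i = (if i < length w then (places 0 w @ places 1 w @ places 2 w) ! i else i)"

lemma places_sorted: "sorted_wrt (<) (places k w)"
  unfolding places_def by (rule sorted_wrt_filter) simp

text \<open>Both sides list the same set in increasing order, since a shuffle increases on each
  block.\<close>

lemma Sh3_places:
  assumes "\<sigma> \<in> Sh3 a b (int c)"
  defines "w \<equiv> shuffle_colouring a b c \<sigma>"
  shows "places 0 w = map \<sigma> [0..<a]" "places 1 w = map \<sigma> [a..<a + b]"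
    "places 2 w = map \<sigma> [a + b..<a + b + c]"
proof -
  have \<sigma>: "\<sigma> permutes {..<a + b + c}" "strict_mono_on {..<a} \<sigma>" "strict_mono_on {a..<a + b} \<sigma>"
    "strict_mono_on {a + b..<a + b + c} \<sigma>" using assms(1) by (auto simp: Sh3_def)
  note inv = permutes_inverses[OF \<sigma>(1)]
  have lt: "\<sigma> i < a + b + c \<longleftrightarrow> i < a + b + c" for i using permutes_in_image[OF \<sigma>(1), of i] by simp
  have w: "length w = a + b + c" "w ! x = (if inv \<sigma> x < a then 0 else if inv \<sigma> x < a + b then 1 else 2)"
    if "x < a + b + c" for x using that by (simp_all add: w_def shuffle_colouring_def Let_def)
  have len: "length w = a + b + c" by (simp add: w_def shuffle_colouring_def)
  have eq: "places k w = map \<sigma> [i..<j]"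
    if "strict_mono_on {i..<j} \<sigma>" "\<And>x. x < a + b + c \<Longrightarrow> w ! x = k \<longleftrightarrow> inv \<sigma> x \<in> {i..<j}" "j \<le> a + b + c"
    for i j k
  proof (rule sorted_distinct_set_unique)
    show "sorted (places k w)" "distinct (places k w)"
      using places_sorted by (auto simp: strict_sorted_iff)
    show "sorted (map \<sigma> [i..<j])" "distinct (map \<sigma> [i..<j])"
      using that(1) permutes_inj[OF \<sigma>(1)]
      by (auto simp: sorted_wrt_map distinct_map inj_on_def strict_mono_on_def
          intro!: sorted_wrt_mono_rel[of _ "(<)" "\<lambda>x y. \<sigma> x \<le> \<sigma> y"] less_imp_le)
    show "set (places k w) = set (map \<sigma> [i..<j])"
    proof (intro set_eqI iffI)
      fix x assume "x \<in> set (places k w)"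
      then have "inv \<sigma> x \<in> {i..<j}" using that(2) by (auto simp: places_def len)
      then have "\<sigma> (inv \<sigma> x) \<in> \<sigma> ` {i..<j}" by (rule imageI)
      then show "x \<in> set (map \<sigma> [i..<j])" by (simp add: inv)
    next
      fix x assume "x \<in> set (map \<sigma> [i..<j])"
      then obtain y where "x = \<sigma> y" "y \<in> {i..<j}" by auto
      then show "x \<in> set (places k w)" using that(2,3) lt[of y] by (auto simp: places_def len inv)
    qed
  qed
  have il: "inv \<sigma> x < a + b + c" if "x < a + b + c" for x
    using permutes_in_image[OF permutes_inv[OF \<sigma>(1)], of x] that by simp
  show "places 0 w = map \<sigma> [0..<a]"
    by (rule eq) (use \<sigma>(2) in \<open>auto simp: w lessThan_atLeast0\<close>)
  show "places 1 w = map \<sigma> [a..<a + b]"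
    by (rule eq) (use \<sigma>(3) in \<open>auto simp: w\<close>)
  show "places 2 w = map \<sigma> [a + b..<a + b + c]"
    by (rule eq) (use \<sigma>(4) il in \<open>auto simp: w\<close>)
qed

lemma colouring_shuffle_inverse:
  assumes "\<sigma> \<in> Sh3 a b (int c)"
  shows "colouring_shuffle (shuffle_colouring a b c \<sigma>) = \<sigma>"
proof
  fix i
  have \<sigma>: "\<sigma> permutes {..<a + b + c}" using assms by (auto simp: Sh3_def)
  have "map \<sigma> [0..<a] @ map \<sigma> [a..<a + b] @ map \<sigma> [a + b..<a + b + c] = map \<sigma> [0..<a + b + c]"
    by (simp flip: map_append) (metis add.assoc le_add1 le_add_same_cancel1 upt_add_eq_append zero_le)
  then show "colouring_shuffle (shuffle_colouring a b c \<sigma>) i = \<sigma> i"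
    using \<sigma> unfolding colouring_shuffle_def Sh3_places[OF assms]
    by (auto simp: shuffle_colouring_def permutes_def)
qed

lemma colouring_shuffle_Sh3:
  assumes w: "w \<in> colourings n" and len: "length (places 0 w) = a" "length (places 1 w) = b"
    "length (places 2 w) = c"
  shows "n = a + b + c" "colouring_shuffle w \<in> Sh3 a b (int c)"
    "shuffle_colouring a b c (colouring_shuffle w) = w"
proof -
  let ?L = "places 0 w @ places 1 w @ places 2 w"
  have wn: "length w = n" "set w \<subseteq> {..<3}" using w by (auto simp: colourings_def)
  have dist: "distinct ?L"
    using places_sorted[of _ w] by (auto simp: strict_sorted_iff) (auto simp: places_def)
  have "w ! x = 0 \<or> w ! x = 1 \<or> w ! x = 2" if "x < n" for x
    using wn that nth_mem[of x w] by fastforce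
  then have "{x. x < n \<and> (w ! x = 0 \<or> w ! x = 1 \<or> w ! x = 2)} = {..<n}" by blast
  moreover have "set ?L = {x. x < n \<and> (w ! x = 0 \<or> w ! x = 1 \<or> w ! x = 2)}"
    by (auto simp: places_def wn)
  \<comment> \<open>The three position lists partition the positions of the word, so that their
    concatenation is a permutation.\<close>
  ultimately have set: "set ?L = {..<n}" by (simp only:)
  have "length ?L = n" using distinct_card[OF dist] set by simp
  then show n: "n = a + b + c" using len by simp
  define \<sigma> where "\<sigma> = colouring_shuffle w"
  have \<sigma>: "\<sigma> i = ?L ! i" if "i < n" for i using that by (simp add: \<sigma>_def colouring_shuffle_def wn)
  have "bij_betw ((!) ?L) {..<n} {..<n}"
    using bij_betw_nth[OF dist] set \<open>length ?L = n\<close> by metis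
  then have "bij_betw \<sigma> {..<n} {..<n}" using bij_betw_cong[of "{..<n}" \<sigma> "(!) ?L"] \<sigma> by blast
  then have perm: "\<sigma> permutes {..<n}"
    by (rule bij_imp_permutes) (simp add: \<sigma>_def colouring_shuffle_def wn)
  note mono = sorted_wrt_nth_less[OF places_sorted]
  have "strict_mono_on {..<a} \<sigma>" "strict_mono_on {a..<a + b} \<sigma>" "strict_mono_on {a + b..<a + b + c} \<sigma>"
    using len n by (auto simp: strict_mono_on_def \<sigma> nth_append intro!: mono)
  then show "colouring_shuffle w \<in> Sh3 a b (int c)"
    using perm n by (simp add: Sh3_def \<sigma>_def)
  show "shuffle_colouring a b c (colouring_shuffle w) = w"
  proof (rule nth_equalityI)
    show "length (shuffle_colouring a b c (colouring_shuffle w)) = length w"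
      by (simp add: shuffle_colouring_def wn n)
    fix x assume "x < length (shuffle_colouring a b c (colouring_shuffle w))"
    then have x: "x < n" by (simp add: shuffle_colouring_def n)
    define i where "i = inv \<sigma> x"
    have i: "i < n" "\<sigma> i = x"
      using x permutes_in_image[OF permutes_inv[OF perm], of x] permutes_inverses[OF perm] by (auto simp: i_def)
    then have "w ! x = (if i < a then 0 else if i < a + b then 1 else 2)"
      using nth_mem[of i "places 0 w"] nth_mem[of "i - a" "places 1 w"] nth_mem[of "i - (a + b)" "places 2 w"]
        len n by (auto simp: \<sigma> nth_append places_def split: if_splits)
    then show "shuffle_colouring a b c (colouring_shuffle w) ! x = w ! x"
      using x by (simp add: shuffle_colouring_def Let_def n i_def \<sigma>_def)
  qed
qed

text \<open>A shuffle has no inversions inside a block, so its inversions correspond to the pairs of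
  letters with colours out of order.\<close>

lemma Sh3_sign:
  assumes "\<sigma> \<in> Sh3 a b (int c)" "length xs = a + b + c"
  shows "colour_sign dg xs (shuffle_colouring a b c \<sigma>)
    = (\<Sum>(i, j)\<in>invs (a + b + c) \<sigma>. eps (dg (xs ! \<sigma> i)) (dg (xs ! \<sigma> j)))"
proof -
  let ?w = "shuffle_colouring a b c \<sigma>"
  have \<sigma>: "\<sigma> permutes {..<a + b + c}" "strict_mono_on {..<a} \<sigma>" "strict_mono_on {a..<a + b} \<sigma>"
    "strict_mono_on {a + b..<a + b + c} \<sigma>" using assms(1) by (auto simp: Sh3_def)
  define blk :: "nat \<Rightarrow> nat" where "blk i = (if i < a then 0 else if i < a + b then 1 else 2)" for i
  have lt: "\<sigma> i < a + b + c \<longleftrightarrow> i < a + b + c" for i using permutes_in_image[OF \<sigma>(1), of i] by simp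
  have w: "?w ! \<sigma> i = blk i" if "i < a + b + c" for i
    using that lt[of i] by (simp add: shuffle_colouring_def Let_def blk_def permutes_inverses[OF \<sigma>(1)])
  have blk: "blk i < blk j \<longleftrightarrow> i < j" if "i < a + b + c" "j < a + b + c" "\<sigma> j < \<sigma> i" for i j
  proof
    show "i < j" if "blk i < blk j" using that by (auto simp: blk_def split: if_splits)
    have "\<sigma> i < \<sigma> j" if "i < j" "blk i = blk j"
      using that \<open>j < a + b + c\<close> \<sigma>(2-4) by (auto simp: blk_def strict_mono_on_def split: if_splits)
    then show "blk i < blk j" if "i < j"
      using that \<open>\<sigma> j < \<sigma> i\<close> by (fastforce simp: blk_def split: if_splits)
  qed
  have "bij_betw (\<lambda>(i, j). (\<sigma> i, \<sigma> j)) (invs (a + b + c) \<sigma>)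
      {(x, y). y < x \<and> x < a + b + c \<and> ?w ! x < ?w ! y}"
  proof (rule bij_betwI[where g = "\<lambda>(x, y). (inv \<sigma> x, inv \<sigma> y)"])
    show "(\<lambda>(i, j). (\<sigma> i, \<sigma> j)) \<in> invs (a + b + c) \<sigma>
        \<rightarrow> {(x, y). y < x \<and> x < a + b + c \<and> ?w ! x < ?w ! y}"
      using w blk lt by (auto simp: invs_def)
    show "(\<lambda>(x, y). (inv \<sigma> x, inv \<sigma> y)) \<in> {(x, y). y < x \<and> x < a + b + c \<and> ?w ! x < ?w ! y}
        \<rightarrow> invs (a + b + c) \<sigma>"
    proof
      fix p assume "p \<in> {(x, y). y < x \<and> x < a + b + c \<and> ?w ! x < ?w ! y}"
      then obtain x y where p: "p = (x, y)" "y < x" "x < a + b + c" "?w ! x < ?w ! y" by auto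
      obtain i j where ij: "x = \<sigma> i" "y = \<sigma> j" by (metis permutes_inverses(1)[OF \<sigma>(1)])
      with p lt have "i < a + b + c" "j < a + b + c" using order.strict_trans by blast+
      with p ij w[of i] w[of j] blk[of i j] show "(\<lambda>(x, y). (inv \<sigma> x, inv \<sigma> y)) p \<in> invs (a + b + c) \<sigma>"
        by (auto simp: invs_def permutes_inverses[OF \<sigma>(1)])
    qed
  qed (auto simp: permutes_inverses[OF \<sigma>(1)])
  from sum.reindex_bij_betw[OF this, of "\<lambda>(x, y). eps (dg (xs ! x)) (dg (xs ! y))"]
  show ?thesis
    using colour_sign_eq[of xs ?w dg] assms(2) by (simp add: shuffle_colouring_def case_prod_unfold)
qed

theorem Sh3_sum:
  assumes "length xs = a + b + c"
  shows "(\<Sum>\<sigma>\<in>Sh3 a b (int c). sg (\<Sum>(i, j)\<in>invs (a + b + c) \<sigma>. eps (dg (xs ! \<sigma> i)) (dg (xs ! \<sigma> j)))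
      (f (block xs \<sigma> 0 a) (block xs \<sigma> a (a + b)) (block xs \<sigma> (a + b) (a + b + c))))
    = sh3 dg xs (\<lambda>x y z. if length x = a \<and> length y = b \<and> length z = c then f x y z else 0)"
proof -
  let ?W = "{w \<in> colourings (length xs). length (places 0 w) = a \<and> length (places 1 w) = b
    \<and> length (places 2 w) = c}"
  have pl: "pick k xs w = map ((!) xs) (places k w)" if "w \<in> colourings (length xs)" for k w
    using that by (intro pick_places) (simp add: colourings_def)
  have "sh3 dg xs (\<lambda>x y z. if length x = a \<and> length y = b \<and> length z = c then f x y z else 0)
      = (\<Sum>w\<in>colourings (length xs). if length (places 0 w) = a \<and> length (places 1 w) = b
          \<and> length (places 2 w) = c then sg (colour_sign dg xs w)
            (f (map ((!) xs) (places 0 w)) (map ((!) xs) (places 1 w)) (map ((!) xs) (places 2 w))) else 0)"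
    unfolding sh3_colourings by (rule sum.cong) (auto simp: pl)
  also have "\<dots> = (\<Sum>w\<in>?W. sg (colour_sign dg xs w)
      (f (map ((!) xs) (places 0 w)) (map ((!) xs) (places 1 w)) (map ((!) xs) (places 2 w))))"
    by (rule sum.inter_filter[symmetric]) simp
  also have "\<dots> = (\<Sum>\<sigma>\<in>Sh3 a b (int c). sg (\<Sum>(i, j)\<in>invs (a + b + c) \<sigma>. eps (dg (xs ! \<sigma> i)) (dg (xs ! \<sigma> j)))
      (f (block xs \<sigma> 0 a) (block xs \<sigma> a (a + b)) (block xs \<sigma> (a + b) (a + b + c))))"
  proof (rule sum.reindex_bij_witness[where i = "shuffle_colouring a b c" and j = colouring_shuffle])
    fix \<sigma> assume \<sigma>: "\<sigma> \<in> Sh3 a b (int c)"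
    show "colouring_shuffle (shuffle_colouring a b c \<sigma>) = \<sigma>" by (rule colouring_shuffle_inverse[OF \<sigma>])
    show "shuffle_colouring a b c \<sigma> \<in> ?W"
      unfolding mem_Collect_eq Sh3_places[OF \<sigma>]
      by (auto simp: colourings_def shuffle_colouring_def assms Let_def)
  next
    fix w assume "w \<in> ?W"
    then have w: "w \<in> colourings (a + b + c)" "length (places 0 w) = a" "length (places 1 w) = b"
      "length (places 2 w) = c" by (simp_all add: assms)
    note cs = colouring_shuffle_Sh3[OF w]
    show "colouring_shuffle w \<in> Sh3 a b (int c)" and "shuffle_colouring a b c (colouring_shuffle w) = w"
      by (rule cs)+
    show "sg (\<Sum>(i, j)\<in>invs (a + b + c) (colouring_shuffle w).
          eps (dg (xs ! colouring_shuffle w i)) (dg (xs ! colouring_shuffle w j)))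
        (f (block xs (colouring_shuffle w) 0 a) (block xs (colouring_shuffle w) a (a + b))
          (block xs (colouring_shuffle w) (a + b) (a + b + c)))
      = sg (colour_sign dg xs w)
        (f (map ((!) xs) (places 0 w)) (map ((!) xs) (places 1 w)) (map ((!) xs) (places 2 w)))"
      using Sh3_places[OF cs(2)] Sh3_sign[OF cs(2) assms, of dg] unfolding cs(3)
      by (simp add: block_def comp_def)
  qed
  finally show ?thesis ..
qed

section \<open>The brackets in terms of insertions\<close>

lemma alt_mapsD:
  assumes "f \<in> alt_maps sM M sW W n"
  shows "us \<notin> tuples M n \<Longrightarrow> f us = 0" "f us \<in> W \<or> us \<notin> tuples M n"
    "set a \<subseteq> M \<Longrightarrow> set b \<subseteq> M \<Longrightarrow> length a + length b + 1 = n \<Longrightarrow> u \<in> M \<Longrightarrow> v \<in> M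
      \<Longrightarrow> f (a @ (u + v) # b) = f (a @ u # b) + f (a @ v # b)"
    "set a \<subseteq> M \<Longrightarrow> set b \<subseteq> M \<Longrightarrow> length a + length b + 1 = n \<Longrightarrow> u \<in> M
      \<Longrightarrow> f (a @ sM c u # b) = sW c (f (a @ u # b))"
    "f (a @ u # u # b) = 0"
proof -
  show *: "us \<notin> tuples M n \<Longrightarrow> f us = 0" "f us \<in> W \<or> us \<notin> tuples M n" for us
    using assms by (auto simp: alt_maps_def)
  have ml: "multilinear_on sM M sW n f" using assms by (simp add: alt_maps_def)
  show "f (a @ (u + v) # b) = f (a @ u # b) + f (a @ v # b)"
    if "set a \<subseteq> M" "set b \<subseteq> M" "length a + length b + 1 = n" "u \<in> M" "v \<in> M"
  proof -
    have t: "a @ u # b \<in> tuples M n" "length a < n" using that by (auto simp: tuples_def)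
    have "\<forall>us\<in>tuples M n. \<forall>i<n. \<forall>u\<in>M. \<forall>v\<in>M. f (us[i := u + v]) = f (us[i := u]) + f (us[i := v])"
      using ml unfolding multilinear_on_def by blast
    from this[rule_format, OF t that(4,5)] show ?thesis by simp
  qed
  show "f (a @ sM c u # b) = sW c (f (a @ u # b))"
    if "set a \<subseteq> M" "set b \<subseteq> M" "length a + length b + 1 = n" "u \<in> M"
  proof -
    have t: "a @ u # b \<in> tuples M n" "length a < n" using that by (auto simp: tuples_def)
    have "\<forall>us\<in>tuples M n. \<forall>i<n. \<forall>u\<in>M. \<forall>c. f (us[i := sM c u]) = sW c (f (us[i := u]))"
      using ml unfolding multilinear_on_def by blast
    from this[rule_format, OF t that(4)] show ?thesis by simp
  qed
  show "f (a @ u # u # b) = 0"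
  proof (cases "a @ u # u # b \<in> tuples M n")
    case True
    moreover have "\<forall>us\<in>tuples M n. \<forall>i j. i < j \<and> j < n \<and> us ! i = us ! j \<longrightarrow> f us = 0"
      using assms by (simp add: alt_maps_def)
    moreover have "(a @ u # u # b) ! length a = (a @ u # u # b) ! Suc (length a)"
      by (simp add: nth_append)
    moreover have "Suc (length a) < n" using True by (simp add: tuples_def)
    ultimately show ?thesis by blast
  qed (rule *)
qed

text \<open>Expand the vanishing value at two equal neighbours u + v.\<close>

lemma alt_maps_swap:
  assumes f: "f \<in> alt_maps sM M sW W n" and M: "\<And>u v. u \<in> M \<Longrightarrow> v \<in> M \<Longrightarrow> u + v \<in> M"
  shows "f (a @ u # v # b) = - f (a @ v # u # b)"
proof (cases "a @ u # v # b \<in> tuples M n")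
  case True
  note A = alt_mapsD[OF f]
  have t: "set a \<subseteq> M" "set b \<subseteq> M" "u \<in> M" "v \<in> M" "length a + length b + 2 = n"
    using True by (auto simp: tuples_def)
  have uv: "u + v \<in> M" using t M by blast
  have "0 = f (a @ (u + v) # (u + v) # b)" by (simp add: A(5))
  also have "\<dots> = f (a @ u # (u + v) # b) + f (a @ v # (u + v) # b)"
    using A(3)[of a "(u + v) # b" u v] t uv by simp
  also have "\<dots> = f (a @ u # v # b) + f (a @ v # u # b)"
    using A(3)[of "a @ [u]" b u v] A(3)[of "a @ [v]" b u v] A(5) t by simp
  finally show ?thesis by (simp add: eq_neg_iff_add_eq_0)
next
  case False
  then have "a @ v # u # b \<notin> tuples M n" by (auto simp: tuples_def)
  with False show ?thesis using alt_mapsD(1)[OF f] by simp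
qed

context twisted_calculus
begin

abbreviation AM where "AM n \<equiv> alt_maps (fst MS) (snd MS) scale (UNIV :: 'g set) n"

lemma hom_if_AM:
  assumes "P \<in> AM n"
  shows "hom (int n) P"
proof (rule OmI)
  note A = alt_mapsD[OF assms]
  have nz: "\<exists>us\<in>tuples (snd MS) n. ws = map Inr us" if "lift P ws \<noteq> 0" for ws :: "(nat + 'm) list"
  proof -
    have "label_free ws" "map projr ws \<in> tuples (snd MS) n"
      using that A(1) by (auto simp: lift_def split: if_splits)
    moreover from this(1) have "map Inr (map projr ws) = ws" by (auto simp: comp_def intro!: map_idI)
    ultimately show ?thesis by metis
  qed
  show "is_space GS" by (rule GS)
  show "lift P ws \<in> snd GS" for ws by simp
  show "degs dg ws = (0, int n)" if "lift P ws \<noteq> 0" for ws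
  proof -
    obtain us where us: "us \<in> tuples (snd MS) n" "ws = map Inr us" using nz[OF \<open>lift P ws \<noteq> 0\<close>] by blast
    have "degs dg (map Inr us) = (0, int (length us))" by (induction us) (auto simp: zero_prod_def)
    with us show ?thesis by (simp add: tuples_def)
  qed
  show "v \<in> snd MS" if "lift P ws \<noteq> 0" "Inr v \<in> set ws" for ws v
    using nz[OF that(1)] that(2) by (auto simp: tuples_def)
  show "lift P (a @ x # y # b) = sg (eps (dg x) (dg y)) (lift P (a @ y # x # b))" for a x y b
    using alt_maps_swap[OF assms is_spaceD(2)[OF MS], of "map projr a" "projr x" "projr y" "map projr b"]
    by (cases "set (a @ x # y # b) \<subseteq> range Inr") (auto simp: lift_def eps_def sg_def)
  show "lift P (a @ Inr (fst MS c u + v) # b) = fst GS c (lift P (a @ Inr u # b)) + lift P (a @ Inr v # b)"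
    if uv: "u \<in> snd MS" "v \<in> snd MS" for a b u v c
  proof (cases "set a \<subseteq> range Inr \<and> set b \<subseteq> range Inr")
    case True
    let ?a = "map projr a" and ?b = "map projr b"
    have cu: "fst MS c u \<in> snd MS" using uv is_spaceD(4)[OF MS] by blast
    have "P (?a @ (fst MS c u + v) # ?b) = scale c (P (?a @ u # ?b)) + P (?a @ v # ?b)"
    proof (cases "set ?a \<subseteq> snd MS \<and> set ?b \<subseteq> snd MS \<and> length ?a + length ?b + 1 = n")
      case True
      then show ?thesis using A(3)[of ?a ?b "fst MS c u" v] A(4)[of ?a ?b u c] uv cu by metis
    next
      case False
      then have "?a @ w # ?b \<notin> tuples (snd MS) n" for w by (auto simp: tuples_def)
      then show ?thesis using A(1) by simp
    qed
    with True show ?thesis by (simp add: lift_def image_subset_iff)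
  qed (auto simp: lift_def)
qed

text \<open>The letters between the two copies are moved out of the way. Equal neighbouring vectors
  then give a value equal to its negative, which vanishes in characteristic zero.\<close>

lemma Om_repeat: "Om GS \<gamma> F \<Longrightarrow> F (a @ Inr w # b @ Inr w # c) = 0"
proof (induction b arbitrary: a)
  case Nil
  have "F (a @ Inr w # Inr w # c) = - F (a @ Inr w # Inr w # c)"
    using OmD(5)[OF Nil, of a "Inr w" "Inr w" c] by (simp add: eps_def)
  then show ?case
    using is_space_cancel(1)[OF GS, of "F (a @ Inr w # Inr w # c)" 0] by (simp add: eq_neg_iff_add_eq_0)
next
  case (Cons y b)
  show ?case
    using OmD(5)[OF Cons.prems, of a "Inr w" y "b @ Inr w # c"] Cons.IH[OF Cons.prems, of "a @ [y]"] by simp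
qed

lemma degs_Inr: "degs dg (map Inr us) = (0, int (length us))" "degs (dg \<circ> Inr) us = (0, int (length us))"
  by (induction us) (auto simp: zero_prod_def)

lemma AM_if_hom:
  assumes "hom (int n) P"
  shows "P \<in> AM n"
proof -
  note h = OmD[OF assms]
  have nz: "us \<in> tuples (snd MS) n" if "P us \<noteq> 0" for us
    using h(3)[of "map Inr us"] h(4)[of "map Inr us"] that by (auto simp: degs_Inr tuples_def)
  have slot: "P (us[i := fst MS c u + v]) = scale c (P (us[i := u])) + P (us[i := v])"
    if "i < length us" "u \<in> snd MS" "v \<in> snd MS" for us i u v c
    using h(7)[OF that(2,3), of "map Inr (take i us)" c "map Inr (drop (Suc i) us)"] that(1)
    by (simp add: upd_conv_take_nth_drop flip: list.map(2) map_append)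
  note M = is_spaceD[OF MS]
  have z: "P (us[i := 0]) = 0" if "i < length us" for us i
    using slot[OF that M(1) M(1), of 1] M(7,10) by simp
  have "multilinear_on (fst MS) (snd MS) scale n P"
    unfolding multilinear_on_def
  proof (intro conjI ballI allI impI)
    fix us i u assume us: "us \<in> tuples (snd MS) n" "i < n" "u \<in> snd MS"
    then have i: "i < length us" by (simp add: tuples_def)
    show "P (us[i := u + v]) = P (us[i := u]) + P (us[i := v])" if "v \<in> snd MS" for v
      using slot[OF i us(3) that, of 1] M(10) by simp
    show "P (us[i := fst MS c u]) = scale c (P (us[i := u]))" for c
      using slot[OF i us(3) M(1), of c] z[OF i] by simp
  qed
  moreover have "P us = 0" if "us \<in> tuples (snd MS) n" "i < j \<and> j < n \<and> us ! i = us ! j" for us i j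
  proof -
    have l: "length us = n" using that(1) by (simp add: tuples_def)
    define b where "b = take (j - Suc i) (drop (Suc i) us)"
    have "us = take i us @ us ! i # drop (Suc i) us" using that(2) l by (intro id_take_nth_drop) simp
    also have "drop (Suc i) us = b @ drop j us"
      using that(2) unfolding b_def by (metis Suc_leI append_take_drop_id drop_drop le_add_diff_inverse2)
    also have "drop j us = us ! i # drop (Suc j) us" using that(2) l by (metis Cons_nth_drop_Suc)
    finally have us: "us = take i us @ us ! i # b @ us ! i # drop (Suc j) us" .
    have "lift P (map Inr us) = 0"
      by (subst us) (simp only: map_append list.map Om_repeat[OF assms])
    then show ?thesis by simp
  qed
  ultimately show ?thesis using nz by (auto simp: alt_maps_def)
qed

text \<open>Through this equivalence the brackets inherit alternation and multilinearity of their
  values from \<open>Om_U2\<close> and \<open>Om_U3\<close>.\<close>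

lemma hom_iff_AM: "hom (int n) P \<longleftrightarrow> P \<in> AM n"
  using AM_if_hom hom_if_AM by blast

lemma lift_zero: "lift 0 = 0" "lift (\<lambda>_. 0) = 0"
  by (auto simp: lift_def fun_eq_iff)

lemma hom_negative: "p < 0 \<Longrightarrow> hom p P \<longleftrightarrow> P = 0"
proof
  assume p: "p < 0" "hom p P"
  have "P us = 0" for us
    using OmD(3)[OF p(2), of "map Inr us"] p(1) by (auto simp: degs_Inr)
  then show "P = 0" by (simp add: fun_eq_iff)
qed (simp add: lift_zero Om_zero[OF GS])

lemma D_pr_sh3:
  assumes "Om S \<alpha> F" "Om T \<beta> G" "bilin S T MS b" "Om GS \<kappa> K"
  shows "D (pr b F G) K ws = sh3 dg ws (\<lambda>x y z. K (Inr (b (F x) (G y)) # z))"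
proof -
  note F = OmD[OF assms(1)] and G = OmD[OF assms(2)]
  have "K (Inr (sh dg x (\<lambda>a c. b (F a) (G c))) # y) = sh dg x (\<lambda>a c. K (Inr (b (F a) (G c)) # y))" for x y
    by (rule sh_hom_on[OF MS, of "\<lambda>v. K (Inr v # y)", THEN conjunct1])
      (rule Om_linear(1)[OF assms(4)] bilinD(1)[OF assms(3) F(1) G(1) F(2) G(2)]; assumption)+
  then show ?thesis by (simp add: D_def pr_def sh_sh_left)
qed

lemma scale_power: "scale ((- 1) ^ n) v = sg (int n) v"
  by (cases "even n") (simp_all add: sg_def)

text \<open>All letters are vectors here: since \<open>eps nu nu\<close> is 1, every inversion
  counts once and the shuffle sign is the signature.\<close>

lemma Sh3_sum_sign:
  assumes "length us = a + b + c"
  shows "(\<Sum>\<sigma>\<in>Sh3 a b (int c). scale (of_int (sign \<sigma>))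
      (f (block us \<sigma> 0 a) (block us \<sigma> a (a + b)) (block us \<sigma> (a + b) (a + b + c))))
    = sh3 (\<lambda>_. nu) us (\<lambda>x y z. if length x = a \<and> length y = b \<and> length z = c then f x y z else 0)"
  unfolding Sh3_sum[OF assms, of "\<lambda>_. nu", symmetric]
proof (rule sum.cong)
  fix \<sigma> assume "\<sigma> \<in> Sh3 a b (int c)"
  then have "\<sigma> permutes {..<a + b + c}" by (simp add: Sh3_def)
  moreover have "eps nu nu = 1" by (simp add: eps_def)
  ultimately show "scale (of_int (sign \<sigma>)) (f (block us \<sigma> 0 a) (block us \<sigma> a (a + b)) (block us \<sigma> (a + b) (a + b + c)))
      = sg (\<Sum>(i, j)\<in>invs (a + b + c) \<sigma>. eps nu nu) (f (block us \<sigma> 0 a) (block us \<sigma> a (a + b)) (block us \<sigma> (a + b) (a + b + c)))"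
    using scale_sign[OF vector_space_axioms] by (simp only: case_prod_unfold)
qed simp

lemma sh3_lift_map: "sh3 dg (map Inr us) f = sh3 (\<lambda>_. nu) us (\<lambda>x y z. f (map Inr x) (map Inr y) (map Inr z))"
  by (simp add: sh3_map comp_def)

lemma Cons_eq_lift: "lift P (Inr v # map Inr us) = P (v # us)"
  using lift_Inr[of P "v # us"] by (simp del: lift_Inr)

lemma insert_act_eq:
  assumes P: "P \<in> AM p" and Q: "Q \<in> AM q" and us: "us \<in> tuples (snd MS) (p + q)"
  shows "insert_act scale act p q P Q us = D (pr act (lift Q) base) (lift P) (map Inr us)"
proof (cases p)
  case 0
  \<comment> \<open>For p = 0 the set of shuffles is empty because its last size is -1, and the
    insertion vanishes because \<open>P\<close> takes no arguments.\<close>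
  have "P (v # ws) = 0" for v ws using alt_mapsD(1)[OF P] 0 by (simp add: tuples_def)
  then show ?thesis
    unfolding D_pr_sh3[OF hom_if_AM[OF Q] Om_base bilin_act hom_if_AM[OF P]] sh3_lift_map Cons_eq_lift
    by (simp add: insert_act_def Sh3_def 0)
next
  case (Suc p')
  have len: "length us = q + 1 + p'" and setus: "set us \<subseteq> snd MS" using us Suc by (auto simp: tuples_def)
  have blk: "block us \<sigma> q (q + 1) = [us ! \<sigma> q]" for \<sigma> by (simp add: block_def)
  have z: "P (0 # ws) = 0" for ws
    using Om_linear(2)[OF hom_if_AM[OF P], of "map Inr ws"] by (simp add: Cons_eq_lift)
  have "insert_act scale act p q P Q us = (\<Sum>\<sigma>\<in>Sh3 q 1 (int p'). scale (of_int (sign \<sigma>))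
      ((\<lambda>x y z. P (act (Q x) (y ! 0) # z)) (block us \<sigma> 0 q) (block us \<sigma> q (q + 1)) (block us \<sigma> (q + 1) (q + 1 + p'))))"
    unfolding insert_act_def blk Suc by (simp add: add.commute)
  also have "\<dots> = sh3 (\<lambda>_. nu) us (\<lambda>x y z. if length x = q \<and> length y = 1 \<and> length z = p' then P (act (Q x) (y ! 0) # z) else 0)"
    by (rule Sh3_sum_sign[OF len])
  also have "\<dots> = sh3 (\<lambda>_. nu) us (\<lambda>x y z. P (act (Q x) (base (map Inr y)) # z))"
  proof (rule sh3_cong, goal_cases)
    case (1 x y z)
    then have s: "set x \<subseteq> snd MS" "set y \<subseteq> snd MS" "set z \<subseteq> snd MS" using setus by auto
    note b = bilinD(6,7)[OF bilin_act GS MS]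
    show ?case
    proof (cases "length x = q \<and> length y = 1 \<and> length z = p'")
      case True
      then have "base (map Inr y) = y ! 0" using s by (cases y) (auto simp: base_def)
      with True show ?thesis by simp
    next
      case False
      consider "length x \<noteq> q" | "length y \<noteq> 1" | "length z \<noteq> p'" using False by blast
      then have "P (act (Q x) (base (map Inr y)) # z) = 0"
      proof cases
        case 1
        then have "Q x = 0" using alt_mapsD(1)[OF Q] by (auto simp: tuples_def)
        then show ?thesis using b(1)[of 0] OmD(2)[OF Om_base] z by simp
      next
        case 2
        then have "base (map Inr y) = 0" by (auto simp: base_def)
        then show ?thesis using b(2)[of _ 0] is_spaceD(1)[OF MS] z by simp
      next
        case 3
        then show ?thesis using alt_mapsD(1)[OF P] Suc by (auto simp: tuples_def)
      qed
      with False show ?thesis by auto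
    qed
  qed
  also have "\<dots> = D (pr act (lift Q) base) (lift P) (map Inr us)"
    unfolding D_pr_sh3[OF hom_if_AM[OF Q] Om_base bilin_act hom_if_AM[OF P]] sh3_lift_map Cons_eq_lift
    by simp
  finally show ?thesis .
qed

lemma insert_H_eq:
  assumes P: "P \<in> AM p" and Q: "Q \<in> AM q" and R: "R \<in> AM r" and us: "length us = p + q + r - 1"
  shows "insert_H scale H p q r P Q R us
    = D (ph (lift Q) (lift R)) (lift P) (map Inr us)"
proof (cases p)
  case 0
  have "P (v # ws) = 0" for v ws using alt_mapsD(1)[OF P] 0 by (simp add: tuples_def)
  then show ?thesis
    unfolding D_pr_sh3[OF hom_if_AM[OF Q] hom_if_AM[OF R] bilin_H hom_if_AM[OF P]] sh3_lift_map Cons_eq_lift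
    by (simp add: insert_H_def Sh3_def 0)
next
  case (Suc p')
  have len: "length us = q + r + p'" using us Suc by simp
  have z: "P (0 # ws) = 0" for ws
    using Om_linear(2)[OF hom_if_AM[OF P], of "map Inr ws"] by (simp add: Cons_eq_lift)
  have "insert_H scale H p q r P Q R us = (\<Sum>\<sigma>\<in>Sh3 q r (int p'). scale (of_int (sign \<sigma>))
      ((\<lambda>x y z. P (H [Q x, R y] # z)) (block us \<sigma> 0 q) (block us \<sigma> q (q + r)) (block us \<sigma> (q + r) (q + r + p'))))"
    unfolding insert_H_def Suc by (simp add: ac_simps)
  also have "\<dots> = sh3 (\<lambda>_. nu) us (\<lambda>x y z. if length x = q \<and> length y = r \<and> length z = p' then P (H [Q x, R y] # z) else 0)"
    by (rule Sh3_sum_sign[OF len])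
  also have "\<dots> = sh3 (\<lambda>_. nu) us (\<lambda>x y z. P (H [Q x, R y] # z))"
  proof (rule sh3_cong)
    fix x y z
    have "P (H [Q x, R y] # z) = 0" if "length x \<noteq> q \<or> length y \<noteq> r \<or> length z \<noteq> p'"
    proof -
      have "Q x = 0 \<or> R y = 0 \<or> P (H [Q x, R y] # z) = 0"
        using that alt_mapsD(1)[OF P] alt_mapsD(1)[OF Q] alt_mapsD(1)[OF R] Suc by (auto simp: tuples_def)
      then show ?thesis using bilinD(6,7)[OF bilin_H GS GS, simplified] z by auto
    qed
    then show "(if length x = q \<and> length y = r \<and> length z = p' then P (H [Q x, R y] # z) else 0)
      = P (H [Q x, R y] # z)" by auto
  qed
  also have "\<dots> = D (ph (lift Q) (lift R)) (lift P) (map Inr us)"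
    unfolding D_pr_sh3[OF hom_if_AM[OF Q] hom_if_AM[OF R] bilin_H hom_if_AM[OF P]] sh3_lift_map Cons_eq_lift
    by simp
  finally show ?thesis .
qed

lemma Sh2_eq_Sh3: "Sh2 a b = Sh3 a b (int 0)"
  by (auto simp: Sh2_def Sh3_def strict_mono_on_def)

lemma br_sum_eq:
  assumes P: "P \<in> AM p" and Q: "Q \<in> AM q" and us: "length us = p + q"
  shows "(\<Sum>\<sigma>\<in>Sh2 p q. scale (of_int (sign \<sigma>)) (br (P (block us \<sigma> 0 p)) (Q (block us \<sigma> p (p + q)))))
    = pr br (lift P) (lift Q) (map Inr us)"
proof -
  note b = bilinD(6,7)[OF bilin_br GS GS, simplified]
  have len: "length us = p + q + 0" using us by simp
  have "(\<Sum>\<sigma>\<in>Sh2 p q. scale (of_int (sign \<sigma>)) (br (P (block us \<sigma> 0 p)) (Q (block us \<sigma> p (p + q)))))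
      = sh3 (\<lambda>_. nu) us (\<lambda>x y z. if length x = p \<and> length y = q \<and> length z = 0 then br (P x) (Q y) else 0)"
    unfolding Sh2_eq_Sh3 using Sh3_sum_sign[OF len, of "\<lambda>x y z. br (P x) (Q y)"] by simp
  also have "\<dots> = sh3 (\<lambda>_. nu) us (\<lambda>x y z. if z = [] then br (P x) (Q y) else 0)"
    using alt_mapsD(1)[OF P] alt_mapsD(1)[OF Q] b
    by (intro sh3_cong) (auto simp: tuples_def)
  also have "\<dots> = pr br (lift P) (lift Q) (map Inr us)"
    by (simp add: pr_def sh_map comp_def flip: sh_eq_sh3)
  finally show ?thesis .
qed

lemma bracket2_eq:
  assumes P: "P \<in> AM p" and Q: "Q \<in> AM q" and us: "us \<in> tuples (snd MS) (p + q)"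
  shows "bracket2 scale br (snd MS) act p q P Q us = L2 (int p) (int q) P Q us"
proof -
  have us': "us \<in> tuples (snd MS) (q + p)" using us by (simp add: add.commute)
  have len: "length us = p + q" using us by (simp add: tuples_def)
  show ?thesis
    unfolding bracket2_def insert_act_eq[OF P Q us] insert_act_eq[OF Q P us'] br_sum_eq[OF P Q len]
      L2_def U2_def
    using us by (simp add: scale_power eps_def sg_apply sg_simps)
qed

text \<open>Antisymmetry of \<open>H\<close> makes the six terms equal in pairs, which cancels the
  1/2; \<open>outer_sign\<close> then yields the signs of the three terms of
  \<open>L3\<close>.\<close>

lemma bracket3_eq:
  assumes P: "P \<in> AM p" and Q: "Q \<in> AM q" and R: "R \<in> AM r"
    and us: "us \<in> tuples (snd MS) (p + q + r - 1)"
  shows "bracket3 scale (snd MS) H p q r P Q R us = L3 (int p) (int q) (int r) P Q R us"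
proof -
  have len: "length us = p + q + r - 1" using us by (simp add: tuples_def)
  note hP = hom_if_AM[OF P] and hQ = hom_if_AM[OF Q] and hR = hom_if_AM[OF R]
  have half: "scale (1/2) (v + v) = v" for v by (simp add: scale_double)
  define X Y Z where "X = D (ph (lift Q) (lift R)) (lift P) (map Inr us)"
    and "Y = D (ph (lift P) (lift R)) (lift Q) (map Inr us)"
    and "Z = D (ph (lift P) (lift Q)) (lift R) (map Inr us)"
  have o: "scale (outer_sign a b c) v = - sg (int (a + b * c)) v" for a b c v
    by (simp add: outer_sign_def scale_power)
  have "insert_H scale H p q r P Q R us = X" "insert_H scale H p r q P R Q us = - sg (int (q * r)) X"
    "insert_H scale H q p r Q P R us = Y" "insert_H scale H q r p Q R P us = - sg (int (p * r)) Y"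
    "insert_H scale H r p q R P Q us = Z" "insert_H scale H r q p R Q P us = - sg (int (p * q)) Z"
    using insert_H_eq[OF P Q R] insert_H_eq[OF P R Q] insert_H_eq[OF Q P R] insert_H_eq[OF Q R P]
      insert_H_eq[OF R P Q] insert_H_eq[OF R Q P] len
      D_ph_swap[OF hQ hR hP] D_ph_swap[OF hP hR hQ] D_ph_swap[OF hP hQ hR]
    by (simp_all add: X_def Y_def Z_def ac_simps eps_def sg_apply)
  then have "bracket3 scale (snd MS) H p q r P Q R us
      = scale (1/2) ((- sg (p + q * r) X - sg (q + p * r + p * q) (- Y) - sg (r + p * q + p * r + q * r) Z)
          + (- sg (p + q * r) X - sg (q + p * r + p * q) (- Y) - sg (r + p * q + p * r + q * r) Z))"
    using us unfolding bracket3_def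
    by (auto simp: o scale_power sg_def intro!: arg_cong[where f = "scale (1/2)"])
  also have "\<dots> = L3 (int p) (int q) (int r) P Q R us"
    unfolding half L3_def U3_def by (auto simp: eps_def sg_def X_def Y_def Z_def)
  finally show ?thesis .
qed

end

section \<open>The $L_\infty$-structure\<close>

lemma sum_apply_fun: "(\<Sum>i\<in>I. F i) x = (\<Sum>i\<in>I. F i x)"
  by (induction I rule: infinite_finite_induct) simp_all

lemma sum_invs_2:
  "(\<Sum>(i, j)\<in>invs 2 \<sigma>. f i j) = (if \<sigma> 1 < \<sigma> 0 then f 0 1 else (0::int))"
proof -
  have "invs 2 \<sigma> = (if \<sigma> 1 < \<sigma> 0 then {(0, 1)} else {})"
    by (auto simp: invs_def less_2_cases_iff)
  then show ?thesis by simp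
qed

lemma sum_invs_3:
  "(\<Sum>(i, j)\<in>invs 3 \<sigma>. f i j) = (if \<sigma> 1 < \<sigma> 0 then f 0 1 else 0) + (if \<sigma> 2 < \<sigma> 0 then f 0 2 else 0)
    + (if \<sigma> 2 < \<sigma> 1 then f 1 2 else (0::int))"
proof -
  have "invs 3 \<sigma> = {z \<in> {(0, 1), (0, 2), (1, 2)}. \<sigma> (snd z) < \<sigma> (fst z)}"
    by (auto simp: invs_def)
  then have "(\<Sum>(i, j)\<in>invs 3 \<sigma>. f i j)
      = (\<Sum>z\<in>{(0, 1), (0, 2), (1, 2)}. if \<sigma> (snd z) < \<sigma> (fst z) then f (fst z) (snd z) else 0)"
    by (simp only: sum.inter_filter[symmetric] finite.intros case_prod_unfold)
  then show ?thesis by simp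
qed

context twisted_module
begin

definition graded :: "int \<Rightarrow> ('m list \<Rightarrow> 'g) set" where
  "graded i = (if i < 0 then {0} else alt_maps (fst MS) (snd MS) scale UNIV (nat i))"

abbreviation (input) "tb2 \<equiv> total_bracket2 scale br (snd MS) act"
abbreviation (input) "tb3 \<equiv> total_bracket3 scale (snd MS) H"
abbreviation l where "l \<equiv> brackets scale br (snd MS) act H"

lemma vector_space_pointwise: "vector_space (pointwise scale :: 'k \<Rightarrow> ('m list \<Rightarrow> 'g) \<Rightarrow> 'm list \<Rightarrow> 'g)"
  by unfold_locales (auto simp: pointwise_def fun_eq_iff algebra_simps)

end

section \<open>Linearity and the total brackets\<close>

context twisted_calculus
begin

lemma graded_iff: "P \<in> graded p \<longleftrightarrow> hom p P"
proof (cases "p < 0")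
  case False
  then have "hom p P \<longleftrightarrow> hom (int (nat p)) P" by simp
  then show ?thesis using False by (simp only: graded_def hom_iff_AM if_False)
qed (simp add: graded_def hom_negative)

lemma component_linear: "component n (pointwise scale c P + Q) = pointwise scale c (component n P) + component n Q"
  by (auto simp: component_def pointwise_def fun_eq_iff)

lemma lift_linear: "lift (pointwise scale c P + Q) = pointwise scale c (lift P) + lift Q"
  by (auto simp: lift_def pointwise_def fun_eq_iff)

lemma hom_linear: "hom p P \<Longrightarrow> hom p Q \<Longrightarrow> hom p (pointwise scale c P + Q)"
  unfolding lift_linear using Om_pointwise[of GS _ "lift P" c] by (intro Om_add) simp_all

lemma hom_zero: "hom p 0"
  by (simp add: lift_zero Om_zero[OF GS])

lemma U2_add:
  assumes F: "Om GS \<alpha> F" and F': "Om GS \<alpha> F'" and G: "Om GS \<beta> G"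
  shows "U2 \<alpha> \<beta> (F + F') G = U2 \<alpha> \<beta> F G + U2 \<alpha> \<beta> F' G"
proof -
  note pF = Om_pr[OF F Om_base bilin_act MS] Om_pr[OF F' Om_base bilin_act MS]
  show ?thesis
    unfolding U2_def pr_linear(1)[OF bilin_act F F' Om_base Om_base MS]
      pr_linear(1)[OF bilin_br F F' G G GS] D_linear_left(1)[OF G pF] D_linear_right(1)
    by (simp add: sg_simps algebra_simps)
qed

lemma U3_add:
  assumes F: "Om GS \<alpha> F" and F': "Om GS \<alpha> F'" and G: "Om GS \<beta> G" and K: "Om GS \<kappa> K"
  shows "U3 \<alpha> \<beta> \<kappa> (F + F') G K = U3 \<alpha> \<beta> \<kappa> F G K + U3 \<alpha> \<beta> \<kappa> F' G K"
proof -
  note h = Om_pr[OF _ _ bilin_H MS]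
  show ?thesis
    unfolding U3_def pr_linear(1)[OF bilin_H F F' G G MS] pr_linear(1)[OF bilin_H F F' K K MS]
      D_linear_left(1)[OF K h[OF F G] h[OF F' G]] D_linear_left(1)[OF G h[OF F K] h[OF F' K]]
      D_linear_right(1)
    by (simp add: sg_simps algebra_simps)
qed

lemma L2_linear_left:
  assumes P: "hom p P" and P': "hom p P'" and Q: "hom q Q"
  shows "L2 p q (pointwise scale c P + P') Q us = scale c (L2 p q P Q us) + L2 p q P' Q us"
  unfolding L2_def lift_linear
    U2_add[OF Om_pointwise[OF P, of c, simplified] P' Q] U2_scale[OF P Q]
  using is_spaceD(9)[OF GS] by (simp add: sg_simps pointwise_def)

text \<open>Transported from the first argument by \<open>L2_swap\<close>; the other slots of
  \<open>L3\<close> are treated in the same way.\<close>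

lemma L2_linear_right:
  assumes P: "hom p P" and P': "hom p P'" and Q: "hom q Q"
  shows "L2 q p Q (pointwise scale c P + P') us = scale c (L2 q p Q P us) + L2 q p Q P' us"
  unfolding L2_swap[OF hom_linear[OF P P'] Q] L2_swap[OF P Q] L2_swap[OF P' Q] L2_linear_left[OF assms]
  using is_spaceD(8,9)[OF GS] by (simp add: sg_simps)

lemma L3_linear_1:
  assumes P: "hom p P" and P': "hom p P'" and Q: "hom q Q" and R: "hom r R"
  shows "L3 p q r (pointwise scale c P + P') Q R us = scale c (L3 p q r P Q R us) + L3 p q r P' Q R us"
  unfolding L3_def lift_linear
    U3_add[OF Om_pointwise[OF P, of c, simplified] P' Q R] U3_scale[OF P Q R]
  using is_spaceD(8,9)[OF GS] by (simp add: sg_simps pointwise_def)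

lemma L3_linear_2:
  assumes P: "hom p P" and P': "hom p P'" and Q: "hom q Q" and R: "hom r R"
  shows "L3 q p r Q (pointwise scale c P + P') R us = scale c (L3 q p r Q P R us) + L3 q p r Q P' R us"
  unfolding L3_swap12[OF hom_linear[OF P P'] Q R] L3_swap12[OF P Q R] L3_swap12[OF P' Q R] L3_linear_1[OF assms]
  using is_spaceD(8,9)[OF GS] by (simp add: sg_simps)

lemma L3_linear_3:
  assumes P: "hom p P" and P': "hom p P'" and Q: "hom q Q" and R: "hom r R"
  shows "L3 q r p Q R (pointwise scale c P + P') us = scale c (L3 q r p Q R P us) + L3 q r p Q R P' us"
  unfolding L3_swap23[OF Q hom_linear[OF P P'] R] L3_swap23[OF Q P R] L3_swap23[OF Q P' R] L3_linear_2[OF assms]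
  using is_spaceD(8,9)[OF GS] by (simp add: sg_simps)

lemma pointwise_zero: "pointwise scale c 0 = (0 :: 'a \<Rightarrow> 'g)"
  by (simp add: pointwise_def fun_eq_iff)

lemma L2_zero:
  assumes Q: "hom q Q"
  shows "L2 p q 0 Q us = 0" "L2 q p Q 0 us = 0"
  using L2_linear_left[OF hom_zero hom_zero Q, of p 1 us] L2_linear_right[OF hom_zero hom_zero Q, of p 1 us]
  by (simp_all add: pointwise_zero)

lemma L3_zero:
  assumes Q: "hom q Q" and R: "hom r R"
  shows "L3 p q r 0 Q R us = 0" "L3 q p r Q 0 R us = 0" "L3 q r p Q R 0 us = 0"
  using L3_linear_1[OF hom_zero hom_zero Q R, of p 1 us] L3_linear_2[OF hom_zero hom_zero Q R, of p 1 us]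
    L3_linear_3[OF hom_zero hom_zero Q R, of p 1 us]
  by (simp_all add: pointwise_zero)

lemma hom_L2:
  assumes "hom p P" "hom q Q"
  shows "hom (p + q) (L2 p q P Q)"
proof -
  have "Om GS (0, p + q) (sg (p * q) (U2 (0, p) (0, q) (lift P) (lift Q)))"
    using Om_sg[OF Om_U2[OF assms], of "p * q"] by simp
  with Om_eq_lift[OF this] show ?thesis by (simp add: L2_def sg_apply)
qed

lemma hom_L3:
  assumes "hom p P" "hom q Q" "hom r R"
  shows "hom (p + q + r - 1) (L3 p q r P Q R)"
proof -
  have "Om GS (0, p + q + r - 1) (- sg (p * q + p * r + q * r + r) (U3 (0, p) (0, q) (0, r) (lift P) (lift Q) (lift R)))"
    using Om_uminus[OF Om_sg[OF Om_U3[OF assms], of "p * q + p * r + q * r + r"]] by simp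
  with Om_eq_lift[OF this] show ?thesis by (simp add: L3_def sg_apply)
qed

lemma hom_support: "hom p P \<Longrightarrow> P us \<noteq> 0 \<Longrightarrow> int (length us) = p \<and> us \<in> tuples (snd MS) (nat p)"
  using OmD(3,4)[of GS "(0, p)" "lift P" "map Inr us"] by (auto simp: degs_Inr tuples_def)

text \<open>
  On arbitrary functions the total brackets are not linear; the span of the homogeneous elements
  lies in the following space.
\<close>

definition decomposable where
  "decomposable P \<longleftrightarrow> (\<forall>n. component n P \<in> AM n)"

lemma component_hom: "hom p P \<Longrightarrow> component n P = (if p = int n then P else 0)"
proof
  show "component n P us = (if p = int n then P else 0) us" if "hom p P" for us
    using hom_support[OF that, of us] by (cases "P us = 0") (auto simp: component_def)
qed

lemma zero_AM: "0 \<in> AM n"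
  using hom_zero[of "int n"] by (simp add: hom_iff_AM)

lemma decomposable_hom: "hom p P \<Longrightarrow> decomposable P"
  unfolding decomposable_def by (auto simp: component_hom zero_AM hom_iff_AM)

lemma decomposable_linear:
  assumes "decomposable P" "decomposable Q"
  shows "decomposable (pointwise scale c P + Q)"
  using assms hom_linear[of "int _" "component _ P" "component _ Q" c]
  unfolding decomposable_def hom_iff_AM by (simp add: component_linear)

lemma total_bracket2_eq:
  assumes "decomposable P" "decomposable Q"
  shows "tb2 P Q us
    = (\<Sum>(p, q)\<in>{(p, q). p + q = length us}. L2 (int p) (int q) (component p P) (component q Q) us)"
  unfolding total_bracket2_def
proof (rule sum.cong, goal_cases)
  case (2 z)
  obtain p q where z: "z = (p, q)" "p + q = length us" using 2 by auto
  have PQ: "component p P \<in> AM p" "component q Q \<in> AM q" using assms by (auto simp: decomposable_def)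
  show ?case
  proof (cases "us \<in> tuples (snd MS) (p + q)")
    case True
    then show ?thesis by (simp add: z bracket2_eq[OF PQ])
  next
    case False
    then have "L2 (int p) (int q) (component p P) (component q Q) us = 0"
      using hom_support[OF hom_L2[OF hom_if_AM[OF PQ(1)] hom_if_AM[OF PQ(2)]], of us]
      by (metis nat_int of_nat_add)
    with False show ?thesis by (simp add: z bracket2_def)
  qed
qed simp

lemma total_bracket3_eq:
  assumes "decomposable P" "decomposable Q" "decomposable R"
  shows "tb3 P Q R us
    = (\<Sum>(p, q, r)\<in>{(p, q, r). p + q + r = length us + 1}.
        L3 (int p) (int q) (int r) (component p P) (component q Q) (component r R) us)"
  unfolding total_bracket3_def
proof (rule sum.cong, goal_cases)
  case (2 z)
  obtain p q r where z: "z = (p, q, r)" "p + q + r = length us + 1" using 2 by auto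
  have PQR: "component p P \<in> AM p" "component q Q \<in> AM q" "component r R \<in> AM r"
    using assms by (auto simp: decomposable_def)
  show ?case
  proof (cases "us \<in> tuples (snd MS) (p + q + r - 1)")
    case True
    then show ?thesis by (simp add: z bracket3_eq[OF PQR])
  next
    case False
    have "nat (int p + int q + int r - 1) = p + q + r - 1" by simp
    then have "L3 (int p) (int q) (int r) (component p P) (component q Q) (component r R) us = 0"
      using hom_support[OF hom_L3[OF hom_if_AM[OF PQR(1)] hom_if_AM[OF PQR(2)] hom_if_AM[OF PQR(3)]], of us] False
      by metis
    with False show ?thesis by (simp add: z bracket3_def)
  qed
qed simp

lemma total_bracket2_hom:
  assumes P: "hom p P" and Q: "hom q Q"
  shows "tb2 P Q = L2 p q P Q"
proof
  fix us :: "'m list"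
  let ?S = "{(p, q). p + q = length us}"
  have fin: "finite ?S" by (rule finite_subset[of _ "{..length us} \<times> {..length us}"]) auto
  have "tb2 P Q us
      = (\<Sum>z\<in>?S. if z = (nat p, nat q) \<and> 0 \<le> p \<and> 0 \<le> q then L2 p q P Q us else 0)"
    unfolding total_bracket2_eq[OF decomposable_hom[OF P] decomposable_hom[OF Q]]
  proof (rule sum.cong, goal_cases)
    case (2 z)
    obtain a b where z: "z = (a, b)" by (cases z)
    have h: "hom (int a) (component a P)" "hom (int b) (component b Q)"
      using decomposable_hom[OF P] decomposable_hom[OF Q] by (auto simp: decomposable_def hom_iff_AM)
    show ?case
    proof (cases "p = int a \<and> q = int b")
      case True
      then show ?thesis using P Q by (simp add: z component_hom)
    next
      case False
      then have "component a P = 0 \<or> component b Q = 0"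
        by (simp add: component_hom[OF P] component_hom[OF Q])
      then have "L2 (int a) (int b) (component a P) (component b Q) us = 0"
        using L2_zero(1)[OF h(2)] L2_zero(2)[OF h(1)] by metis
      with False show ?thesis by (auto simp: z)
    qed
  qed simp
  also have "\<dots> = L2 p q P Q us"
  \<comment> \<open>A non-zero value forces non-negative degrees and the right length, so that the
    pair of degrees does occur in the sum.\<close>
  proof (cases "L2 p q P Q us = 0")
    case False
    have "p < 0 \<Longrightarrow> P = 0" "q < 0 \<Longrightarrow> Q = 0" using hom_negative P Q by blast+
    then have "0 \<le> p" "0 \<le> q"
      using False L2_zero(1)[OF Q, of p us] L2_zero(2)[OF P, of q us] by (atomize (full), metis not_le)
    moreover have "int (length us) = p + q" using hom_support[OF hom_L2[OF P Q] False] by simp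
    ultimately have "(nat p, nat q) \<in> ?S" "0 \<le> p" "0 \<le> q" by auto
    then show ?thesis using fin by (simp add: sum.delta)
  qed (auto intro!: sum.neutral)
  finally show "tb2 P Q us = L2 p q P Q us" .
qed

lemma total_bracket3_hom:
  assumes P: "hom p P" and Q: "hom q Q" and R: "hom r R"
  shows "tb3 P Q R = L3 p q r P Q R"
proof
  fix us :: "'m list"
  let ?S = "{(p, q, r). p + q + r = length us + 1}"
  have fin: "finite ?S"
    by (rule finite_subset[of _ "{..length us + 1} \<times> {..length us + 1} \<times> {..length us + 1}"]) auto
  have "tb3 P Q R us
      = (\<Sum>z\<in>?S. if z = (nat p, nat q, nat r) \<and> 0 \<le> p \<and> 0 \<le> q \<and> 0 \<le> r then L3 p q r P Q R us else 0)"
    unfolding total_bracket3_eq[OF decomposable_hom[OF P] decomposable_hom[OF Q] decomposable_hom[OF R]]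
  proof (rule sum.cong, goal_cases)
    case (2 z)
    obtain a b c where z: "z = (a, b, c)" by (cases z)
    have h: "hom (int a) (component a P)" "hom (int b) (component b Q)" "hom (int c) (component c R)"
      using decomposable_hom[OF P] decomposable_hom[OF Q] decomposable_hom[OF R]
      by (auto simp: decomposable_def hom_iff_AM)
    show ?case
    proof (cases "p = int a \<and> q = int b \<and> r = int c")
      case True
      then show ?thesis using P Q R by (simp add: z component_hom)
    next
      case False
      then have "component a P = 0 \<or> component b Q = 0 \<or> component c R = 0"
        by (auto simp: component_hom[OF P] component_hom[OF Q] component_hom[OF R])
      then have "L3 (int a) (int b) (int c) (component a P) (component b Q) (component c R) us = 0"
        using L3_zero(1)[OF h(2,3)] L3_zero(2)[OF h(1,3)] L3_zero(3)[OF h(1,2)] by metis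
      with False show ?thesis by (auto simp: z)
    qed
  qed simp
  also have "\<dots> = L3 p q r P Q R us"
  proof (cases "L3 p q r P Q R us = 0")
    case False
    have "p < 0 \<Longrightarrow> P = 0" "q < 0 \<Longrightarrow> Q = 0" "r < 0 \<Longrightarrow> R = 0" using hom_negative P Q R by blast+
    then have pqr: "0 \<le> p" "0 \<le> q" "0 \<le> r"
      using False L3_zero(1)[OF Q R, of p us] L3_zero(2)[OF P R, of q us] L3_zero(3)[OF P Q, of r us]
      by (atomize (full), metis not_le)
    moreover have "int (length us) = p + q + r - 1" using hom_support[OF hom_L3[OF P Q R] False] by simp
    ultimately have "(nat p, nat q, nat r) \<in> ?S" by auto
    with pqr show ?thesis using fin by (simp add: sum.delta)
  qed (auto intro!: sum.neutral)
  finally show "tb3 P Q R us = L3 p q r P Q R us" .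
qed

lemma pointwise_apply: "pointwise s c F x = s c (F x)"
  by (simp add: pointwise_def)

lemma total_bracket2_linear:
  assumes P: "decomposable P" and P': "decomposable P'" and Q: "decomposable Q"
  shows "tb2 (pointwise scale c P + P') Q
      = pointwise scale c (tb2 P Q) + tb2 P' Q"
    "tb2 Q (pointwise scale c P + P')
      = pointwise scale c (tb2 Q P) + tb2 Q P'"
proof -
  have h: "hom (int n) (component n P)" "hom (int n) (component n P')" "hom (int n) (component n Q)" for n
    using assms by (auto simp: decomposable_def hom_iff_AM)
  note dl = decomposable_linear[OF P P']
  show "tb2 (pointwise scale c P + P') Q
      = pointwise scale c (tb2 P Q) + tb2 P' Q"
    by (rule ext) (simp add: total_bracket2_eq[OF dl Q] total_bracket2_eq[OF P Q] total_bracket2_eq[OF P' Q]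
        component_linear L2_linear_left[OF h(1) h(2) h(3)] case_prod_unfold sum.distrib pointwise_apply scale_sum_right)
  show "tb2 Q (pointwise scale c P + P')
      = pointwise scale c (tb2 Q P) + tb2 Q P'"
    by (rule ext) (simp add: total_bracket2_eq[OF Q dl] total_bracket2_eq[OF Q P] total_bracket2_eq[OF Q P']
        component_linear L2_linear_right[OF h(1) h(2) h(3)] case_prod_unfold sum.distrib pointwise_apply scale_sum_right)
qed

lemma total_bracket3_linear:
  assumes P: "decomposable P" and P': "decomposable P'" and Q: "decomposable Q" and R: "decomposable R"
  shows "tb3 (pointwise scale c P + P') Q R
      = pointwise scale c (tb3 P Q R) + tb3 P' Q R"
    "tb3 Q (pointwise scale c P + P') R
      = pointwise scale c (tb3 Q P R) + tb3 Q P' R"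
    "tb3 Q R (pointwise scale c P + P')
      = pointwise scale c (tb3 Q R P) + tb3 Q R P'"
proof -
  have h: "hom (int n) (component n P)" "hom (int n) (component n P')" "hom (int n) (component n Q)"
    "hom (int n) (component n R)" for n
    using assms by (auto simp: decomposable_def hom_iff_AM)
  note dl = decomposable_linear[OF P P']
  show "tb3 (pointwise scale c P + P') Q R
      = pointwise scale c (tb3 P Q R) + tb3 P' Q R"
    by (rule ext) (simp add: total_bracket3_eq[OF dl Q R] total_bracket3_eq[OF P Q R] total_bracket3_eq[OF P' Q R]
        component_linear L3_linear_1[OF h(1) h(2) h(3) h(4)] case_prod_unfold sum.distrib pointwise_apply scale_sum_right)
  show "tb3 Q (pointwise scale c P + P') R
      = pointwise scale c (tb3 Q P R) + tb3 Q P' R"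
    by (rule ext) (simp add: total_bracket3_eq[OF Q dl R] total_bracket3_eq[OF Q P R] total_bracket3_eq[OF Q P' R]
        component_linear L3_linear_2[OF h(1) h(2) h(3) h(4)] case_prod_unfold sum.distrib pointwise_apply scale_sum_right)
  show "tb3 Q R (pointwise scale c P + P')
      = pointwise scale c (tb3 Q R P) + tb3 Q R P'"
    by (rule ext) (simp add: total_bracket3_eq[OF Q R dl] total_bracket3_eq[OF Q R P] total_bracket3_eq[OF Q R P']
        component_linear L3_linear_3[OF h(1) h(2) h(3) h(4)] case_prod_unfold sum.distrib pointwise_apply scale_sum_right)
qed

section \<open>The axioms of an \<open>L_infinity_algebra\<close>\<close>

lemma l_linear:
  assumes "length Ps = k" "\<And>P. P \<in> set Ps \<Longrightarrow> decomposable P" "i < k" "decomposable P" "decomposable P'"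
  shows "l k (Ps[i := pointwise scale c P + P']) = pointwise scale c (l k (Ps[i := P])) + l k (Ps[i := P'])"
proof -
  consider "k = 2" | "k = 3" | "k \<noteq> 2" "k \<noteq> 3" by blast
  then show ?thesis
  proof cases
    case 1
    then obtain Q R where Ps: "Ps = [Q, R]" using assms(1) by (auto simp: length_Suc_conv numeral_2_eq_2)
    have dec: "decomposable Q" "decomposable R" using assms(2) Ps by simp_all
    have "i = 0 \<or> i = 1" using assms(3) 1 by auto
    then show ?thesis unfolding 1 Ps
      by (elim disjE)
        (simp_all add: brackets_def total_bracket2_linear[OF assms(4,5) dec(1)] total_bracket2_linear[OF assms(4,5) dec(2)])
  next
    case 2
    then obtain Q R S where Ps: "Ps = [Q, R, S]" using assms(1) by (auto simp: length_Suc_conv numeral_3_eq_3)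
    have dec: "decomposable Q" "decomposable R" "decomposable S" using assms(2) Ps by simp_all
    have "i = 0 \<or> i = 1 \<or> i = 2" using assms(3) 2 by auto
    then show ?thesis unfolding 2 Ps
      by (elim disjE) (simp_all add: brackets_def numeral_2_eq_2 numeral_3_eq_3
          total_bracket3_linear[OF assms(4,5) dec(2,3)] total_bracket3_linear[OF assms(4,5) dec(1,3)]
          total_bracket3_linear[OF assms(4,5) dec(1,2)])
  next
    case 3
    then show ?thesis by (simp add: brackets_def pointwise_def fun_eq_iff)
  qed
qed

lemma l_zero:
  assumes "length Ps = k" "\<And>P. P \<in> set Ps \<Longrightarrow> decomposable P" "i < k" "Ps ! i = 0"
  shows "l k Ps = 0"
proof -
  have z: "decomposable 0" using decomposable_hom[OF hom_zero] .
  have Ps: "Ps[i := 0] = Ps" using assms(4) by (metis list_update_id)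
  show ?thesis
    using l_linear[OF assms(1-3) z z, of 1] by (simp add: pointwise_zero Ps) (simp add: pointwise_def)
qed

lemma l_2: "hom p P \<Longrightarrow> hom q Q \<Longrightarrow> l 2 [P, Q] = L2 p q P Q"
  by (simp add: brackets_def total_bracket2_hom)

lemma l_3: "hom p P \<Longrightarrow> hom q Q \<Longrightarrow> hom r R \<Longrightarrow> l 3 [P, Q, R] = L3 p q r P Q R"
  by (simp add: brackets_def total_bracket3_hom)

lemma l_other: "k \<noteq> 2 \<Longrightarrow> k \<noteq> 3 \<Longrightarrow> l k Ps = 0"
  by (simp add: brackets_def)

lemma l_degree:
  assumes "length xs = k" "\<And>i. i < k \<Longrightarrow> hom (d i) (xs ! i)"
  shows "hom ((\<Sum>i<k. d i) + 2 - int k) (l k xs)"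
proof -
  consider "k = 2" | "k = 3" | "k \<noteq> 2" "k \<noteq> 3" by blast
  then show ?thesis
  proof cases
    case 1
    then obtain P Q where xs: "xs = [P, Q]" using assms(1) by (auto simp: length_Suc_conv numeral_2_eq_2)
    have h: "hom (d 0) P" "hom (d 1) Q" using assms(2)[of 0] assms(2)[of 1] 1 xs by simp_all
    have "(\<Sum>i<2. d i) + 2 - int 2 = d 0 + d 1" by (simp add: numeral_2_eq_2)
    with hom_L2[OF h] show ?thesis by (simp only: xs 1 l_2[OF h])
  next
    case 2
    then obtain P Q R where xs: "xs = [P, Q, R]" using assms(1) by (auto simp: length_Suc_conv numeral_3_eq_3)
    have h: "hom (d 0) P" "hom (d 1) Q" "hom (d 2) R"
      using assms(2)[of 0] assms(2)[of 1] assms(2)[of 2] 2 xs by simp_all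
    have "(\<Sum>i<3. d i) + 2 - int 3 = d 0 + d 1 + d 2 - 1" by (simp add: numeral_3_eq_3 numeral_2_eq_2)
    with hom_L3[OF h] show ?thesis by (simp only: xs 2 l_3[OF h])
  next
    case 3
    then show ?thesis by (simp add: l_other hom_zero)
  qed
qed

text \<open>For three arguments the six permutations are composed of exchanges of neighbours, and
  the collected signs are compared with the list of inversions.\<close>

lemma l_antisymmetric:
  assumes "length xs = k" "\<And>i. i < k \<Longrightarrow> hom (d i) (xs ! i)" "\<sigma> permutes {..<k}"
  shows "l k (block xs \<sigma> 0 k) = pointwise scale (of_int (sign \<sigma> * koszul_sign d k \<sigma>)) (l k xs)"
proof
  fix us
  have s: "scale (of_int (sign \<sigma> * koszul_sign d k \<sigma>)) v = sg (\<Sum>(i, j)\<in>invs k \<sigma>. 1 + d (\<sigma> i) * d (\<sigma> j)) v" for v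
    by (rule scale_koszul[OF vector_space_axioms assms(3)])
  have inj: "\<sigma> i = \<sigma> j \<longleftrightarrow> i = j" for i j using permutes_inj[OF assms(3)] by (auto dest: injD)
  have lt: "\<sigma> i < k" if "i < k" for i using permutes_in_image[OF assms(3), of i] that by simp
  consider "k = 2" | "k = 3" | "k \<noteq> 2" "k \<noteq> 3" by blast
  then show "l k (block xs \<sigma> 0 k) us = pointwise scale (of_int (sign \<sigma> * koszul_sign d k \<sigma>)) (l k xs) us"
  proof cases
    case 1
    have xs: "xs = [xs ! 0, xs ! 1]" using assms(1) 1 by (auto simp: length_Suc_conv numeral_2_eq_2)
    have h: "hom (d 0) (xs ! 0)" "hom (d 1) (xs ! 1)" using assms(2) 1 by simp_all
    have b: "block xs \<sigma> 0 2 = [xs ! \<sigma> 0, xs ! \<sigma> 1]" by (simp add: block_def numeral_2_eq_2)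
    have "\<sigma> 0 < 2" "\<sigma> 1 < 2" "\<sigma> 0 \<noteq> \<sigma> 1" using lt[of 0] lt[of 1] inj[of 0 1] 1 by simp_all
    then consider "\<sigma> 0 = 0" "\<sigma> 1 = 1" | "\<sigma> 0 = 1" "\<sigma> 1 = 0" by linarith
    moreover have "l 2 xs = L2 (d 0) (d 1) (xs ! 0) (xs ! 1)" by (subst xs) (rule l_2[OF h])
    ultimately show ?thesis
      unfolding 1 b pointwise_def s[unfolded 1] sum_invs_2
      by cases (simp_all add: l_2[OF h] l_2[OF h(2) h(1)] L2_swap[OF h] sg_simps mult.commute del: One_nat_def)
  next
    case 2
    have xs: "xs = [xs ! 0, xs ! 1, xs ! 2]" using assms(1) 2 by (auto simp: length_Suc_conv numeral_3_eq_3)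
    have h: "hom (d 0) (xs ! 0)" "hom (d 1) (xs ! 1)" "hom (d 2) (xs ! 2)" using assms(2) 2 by simp_all
    have b: "block xs \<sigma> 0 3 = [xs ! \<sigma> 0, xs ! \<sigma> 1, xs ! \<sigma> 2]" by (simp add: block_def numeral_3_eq_3 numeral_2_eq_2)
    have "\<sigma> 0 < 3" "\<sigma> 1 < 3" "\<sigma> 2 < 3" "\<sigma> 0 \<noteq> \<sigma> 1" "\<sigma> 0 \<noteq> \<sigma> 2" "\<sigma> 1 \<noteq> \<sigma> 2"
      using lt[of 0] lt[of 1] lt[of 2] inj[of 0 1] inj[of 0 2] inj[of 1 2] 2 by simp_all
    moreover from this(1-3) have "\<sigma> 0 = 0 \<or> \<sigma> 0 = 1 \<or> \<sigma> 0 = 2" "\<sigma> 1 = 0 \<or> \<sigma> 1 = 1 \<or> \<sigma> 1 = 2"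
      "\<sigma> 2 = 0 \<or> \<sigma> 2 = 1 \<or> \<sigma> 2 = 2" by linarith+
    ultimately have "\<sigma> 0 = 0 \<and> \<sigma> 1 = 1 \<and> \<sigma> 2 = 2 \<or> \<sigma> 0 = 1 \<and> \<sigma> 1 = 0 \<and> \<sigma> 2 = 2
        \<or> \<sigma> 0 = 0 \<and> \<sigma> 1 = 2 \<and> \<sigma> 2 = 1 \<or> \<sigma> 0 = 1 \<and> \<sigma> 1 = 2 \<and> \<sigma> 2 = 0
        \<or> \<sigma> 0 = 2 \<and> \<sigma> 1 = 0 \<and> \<sigma> 2 = 1 \<or> \<sigma> 0 = 2 \<and> \<sigma> 1 = 1 \<and> \<sigma> 2 = 0"
      by (elim disjE) simp_all
    then consider "\<sigma> 0 = 0" "\<sigma> 1 = 1" "\<sigma> 2 = 2" | "\<sigma> 0 = 1" "\<sigma> 1 = 0" "\<sigma> 2 = 2" | "\<sigma> 0 = 0" "\<sigma> 1 = 2" "\<sigma> 2 = 1"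
      | "\<sigma> 0 = 1" "\<sigma> 1 = 2" "\<sigma> 2 = 0" | "\<sigma> 0 = 2" "\<sigma> 1 = 0" "\<sigma> 2 = 1" | "\<sigma> 0 = 2" "\<sigma> 1 = 1" "\<sigma> 2 = 0"
      by (elim disjE conjE) metis+
    moreover have "l 3 xs = L3 (d 0) (d 1) (d 2) (xs ! 0) (xs ! 1) (xs ! 2)" by (subst xs) (rule l_3[OF h])
    moreover have swaps:
      "L3 (d 1) (d 0) (d 2) (xs ! 1) (xs ! 0) (xs ! 2) us = - sg (d 0 * d 1) (l 3 xs us)"
      "L3 (d 0) (d 2) (d 1) (xs ! 0) (xs ! 2) (xs ! 1) us = - sg (d 1 * d 2) (l 3 xs us)"
      "L3 (d 1) (d 2) (d 0) (xs ! 1) (xs ! 2) (xs ! 0) us = sg (d 0 * d 2) (sg (d 0 * d 1) (l 3 xs us))"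
      "L3 (d 2) (d 0) (d 1) (xs ! 2) (xs ! 0) (xs ! 1) us = sg (d 0 * d 2) (sg (d 1 * d 2) (l 3 xs us))"
      "L3 (d 2) (d 1) (d 0) (xs ! 2) (xs ! 1) (xs ! 0) us = - sg (d 1 * d 2) (sg (d 0 * d 2) (sg (d 0 * d 1) (l 3 xs us)))"
      using L3_swap12[OF h, of us] L3_swap23[OF h, of us] L3_swap23[OF h(2,1,3), of us]
        L3_swap12[OF h(1,3,2), of us] L3_swap12[OF h(2,3,1), of us] calculation(2)
      by (simp_all add: sg_simps)
    ultimately show ?thesis
      unfolding 2 b pointwise_def s[unfolded 2] sum_invs_3
      by cases (simp_all add: l_3[OF h] l_3[OF h(2,1,3)] l_3[OF h(1,3,2)] l_3[OF h(2,3,1)] l_3[OF h(3,1,2)]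
          l_3[OF h(3,2,1)] sg_simps del: One_nat_def, simp_all add: sg_def mult.commute)
  next
    case 3
    then show ?thesis by (simp add: l_other pointwise_def)
  qed
qed

text \<open>Labels take the place of the arguments, so that the sum over unshuffles becomes a signed
  splitting of the word 0, ..., i + m - 1 of parameters.\<close>

lemma Sh2_koszul_sum:
  assumes "length xs = i + m"
  shows "(\<Sum>\<sigma>\<in>Sh2 i m. scale (of_int (sign \<sigma> * koszul_sign d (i + m) \<sigma>)) (f (block xs \<sigma> 0 i) (block xs \<sigma> i (i + m))))
    = sh dgl [0..<i + m] (\<lambda>a b. if length a = i \<and> length b = m then f (map ((!) xs) a) (map ((!) xs) b) else 0)"
proof -
  let ?ls = "[0..<i + m]"
  have "(\<Sum>\<sigma>\<in>Sh2 i m. scale (of_int (sign \<sigma> * koszul_sign d (i + m) \<sigma>)) (f (block xs \<sigma> 0 i) (block xs \<sigma> i (i + m))))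
    = (\<Sum>\<sigma>\<in>Sh3 i m (int 0). sg (\<Sum>(j, k)\<in>invs (i + m + 0) \<sigma>. eps (dgl (?ls ! \<sigma> j)) (dgl (?ls ! \<sigma> k)))
      ((\<lambda>a b c. f (map ((!) xs) a) (map ((!) xs) b)) (block ?ls \<sigma> 0 i) (block ?ls \<sigma> i (i + m)) (block ?ls \<sigma> (i + m) (i + m + 0))))"
    unfolding Sh2_eq_Sh3
  proof (rule sum.cong)
    fix \<sigma> assume "\<sigma> \<in> Sh3 i m (int 0)"
    then have \<sigma>: "\<sigma> permutes {..<i + m}" by (simp add: Sh3_def)
    have lt: "\<sigma> j < i + m \<longleftrightarrow> j < i + m" for j using permutes_in_image[OF \<sigma>, of j] by simp
    have "(\<Sum>(j, k)\<in>invs (i + m + 0) \<sigma>. eps (dgl (?ls ! \<sigma> j)) (dgl (?ls ! \<sigma> k)))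
        = (\<Sum>(j, k)\<in>invs (i + m) \<sigma>. 1 + d (\<sigma> j) * d (\<sigma> k))"
      by (intro sum.cong) (auto simp: invs_def lt eps_def)
    moreover have "block xs \<sigma> 0 i = map ((!) xs) (block ?ls \<sigma> 0 i)" "block xs \<sigma> i (i + m) = map ((!) xs) (block ?ls \<sigma> i (i + m))"
      by (auto simp: block_def lt)
    ultimately show "scale (of_int (sign \<sigma> * koszul_sign d (i + m) \<sigma>)) (f (block xs \<sigma> 0 i) (block xs \<sigma> i (i + m)))
      = sg (\<Sum>(j, k)\<in>invs (i + m + 0) \<sigma>. eps (dgl (?ls ! \<sigma> j)) (dgl (?ls ! \<sigma> k)))
      ((\<lambda>a b c. f (map ((!) xs) a) (map ((!) xs) b)) (block ?ls \<sigma> 0 i) (block ?ls \<sigma> i (i + m)) (block ?ls \<sigma> (i + m) (i + m + 0)))"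
      by (simp only: scale_koszul[OF vector_space_axioms \<sigma>])
  qed simp
  also have "\<dots> = sh dgl ?ls (\<lambda>a b. if length a = i \<and> length b = m then f (map ((!) xs) a) (map ((!) xs) b) else 0)"
    unfolding sh_eq_sh3 by (subst Sh3_sum) (auto intro!: sh3_cong)
  finally show ?thesis .
qed

lemma l_jacobi:
  assumes "length xs = n" "\<And>i. i < n \<Longrightarrow> hom (d i) (xs ! i)"
  shows "(\<Sum>(i, j)\<in>{(i, j). 1 \<le> i \<and> 1 \<le> j \<and> i + j = n + 1}. \<Sum>\<sigma>\<in>Sh2 i (n - i).
      pointwise scale (of_int (sign \<sigma> * koszul_sign d n \<sigma> * (-1) ^ (i * (j - 1))))
        (l j (l i (block xs \<sigma> 0 i) # block xs \<sigma> i n))) = 0"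
proof
  fix us
  \<comment> \<open>The calculus works with a family indexed by all natural numbers; zero has every
    degree and pads the list.\<close>
  define x where "x i = (if i < n then xs ! i else 0)" for i
  have x: "hom (d i) (x i)" for i using assms(2) by (simp add: x_def hom_zero)
  note dec = decomposable_hom[OF x]
  define T where "T i j = (\<Sum>\<sigma>\<in>Sh2 i (n - i). scale (of_int (sign \<sigma> * koszul_sign d n \<sigma>))
        (l j (l i (block xs \<sigma> 0 i) # block xs \<sigma> i n) us))" for i j
  have T: "T i j = sh dgl [0..<n] (\<lambda>a b. if length a = i \<and> length b = n - i
      then l j (l i (map x a) # map x b) us else 0)" if "i \<le> n" for i j
  proof -
    have "T i j = sh dgl [0..<n] (\<lambda>a b. if length a = i \<and> length b = n - i
      then l j (l i (map ((!) xs) a) # map ((!) xs) b) us else 0)"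
      using Sh2_koszul_sum[of xs i "n - i" "\<lambda>a b. l j (l i a # b) us"] assms(1) that by (simp add: T_def)
    also have "\<dots> = sh dgl [0..<n] (\<lambda>a b. if length a = i \<and> length b = n - i
      then l j (l i (map x a) # map x b) us else 0)"
    proof (rule sh_cong, goal_cases)
      case (1 a b)
      then have "set a \<subseteq> {..<n}" "set b \<subseteq> {..<n}" by (auto simp: lessThan_atLeast0)
      then have "map ((!) xs) a = map x a" "map ((!) xs) b = map x b"
        by (auto simp: x_def)
      then show ?case by (simp only:)
    qed
    finally show ?thesis .
  qed
  \<comment> \<open>A composition survives only if both brackets have arity 2 or 3; if the inner one
    vanishes, the outer one has a zero argument.\<close>
  have T_0: "T i j = 0" if "i \<le> n" "j = n + 1 - i" "\<not> (i \<in> {2, 3} \<and> j \<in> {2, 3})" for i j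
  proof -
    have "l j (l i (map x a) # map x b) = 0" if b: "length b = n - i" for a b
    proof (cases "i \<in> {2, 3}")
      case True
      then show ?thesis using that \<open>\<not> (i \<in> {2, 3} \<and> j \<in> {2, 3})\<close> by (simp add: l_other)
    next
      case False
      then have "l i (map x a) = 0" by (simp add: l_other)
      then show ?thesis
        using b \<open>i \<le> n\<close> \<open>j = n + 1 - i\<close> decomposable_hom[OF hom_zero] dec
        by (intro l_zero[of _ _ 0]) auto
    qed
    then show ?thesis unfolding T[OF \<open>i \<le> n\<close>] by (simp cong: if_cong)
  qed
  have y2: "l 2 (map x a) = y2 x a" "hom (\<Sum>k\<leftarrow>a. d k) (y2 x a)" if a: "length a = 2" for a
  proof -
    obtain i j where "a = [i, j]" using a by (auto simp: length_Suc_conv numeral_2_eq_2)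
    then show "l 2 (map x a) = y2 x a" "hom (\<Sum>k\<leftarrow>a. d k) (y2 x a)"
      using hom_L2[OF x x, of i j] by (simp_all add: l_2[OF x x] y2_def[OF x])
  qed
  have y3: "l 3 (map x a) = y3 x a" "hom (- 1 + (\<Sum>k\<leftarrow>a. d k)) (y3 x a)" if a: "length a = 3" for a
  proof -
    obtain i j k where "a = [i, j, k]" using a by (auto simp: length_Suc_conv numeral_3_eq_3)
    then show "l 3 (map x a) = y3 x a" "hom (- 1 + (\<Sum>k\<leftarrow>a. d k)) (y3 x a)"
      using hom_L3[OF x x x, of i j k] by (simp_all add: l_3[OF x x x] y3_def[OF x] algebra_simps)
  qed
  have l1: "map x b = [x (b ! 0)]" if "length b = 1" for b
    using that by (auto simp: length_Suc_conv)
  have l2': "map x b = [x (b ! 0), x (b ! 1)]" if "length b = 2" for b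
    using that by (auto simp: length_Suc_conv numeral_2_eq_2)
  have sub: "set [0..<n] \<subseteq> {..<n}" by auto
  have T22: "T 2 2 = 0" if "n = 3"
  proof -
    have *: "l 2 (l 2 (map x a) # map x b) us = L2 (\<Sum>k\<leftarrow>a. d k) (d (b ! 0)) (y2 x a) (x (b ! 0)) us"
      if "length a = 2" "length b = 1" for a b
      unfolding y2(1)[OF that(1)] l1[OF that(2)] by (rule fun_cong[OF l_2[OF y2(2)[OF that(1)] x]])
    have "T 2 2 = sh dgl [0..<n] (\<lambda>a b. if length a = 2 \<and> length b = 1
        then L2 (\<Sum>k\<leftarrow>a. d k) (d (b ! 0)) (y2 x a) (x (b ! 0)) us else 0)"
      using that by (subst T) (auto intro!: sh_cong simp: *)
    then show ?thesis by (simp only: jacobi_3[OF x sub])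
  qed
  \<comment> \<open>The two terms enter with opposite signs: i * (j - 1) is 4 for (2, 3) and 3 for
    (3, 2).\<close>
  have T4: "T 2 3 = T 3 2" if "n = 4"
  proof -
    have *: "l 3 (l 2 (map x a) # map x b) us = L3 (\<Sum>k\<leftarrow>a. d k) (d (b ! 0)) (d (b ! 1)) (y2 x a) (x (b ! 0)) (x (b ! 1)) us"
      if "length a = 2" "length b = 2" for a b
      unfolding y2(1)[OF that(1)] l2'[OF that(2)] by (rule fun_cong[OF l_3[OF y2(2)[OF that(1)] x x]])
    have **: "l 2 (l 3 (map x a) # map x b) us = L2 (- 1 + (\<Sum>k\<leftarrow>a. d k)) (d (b ! 0)) (y3 x a) (x (b ! 0)) us"
      if "length a = 3" "length b = 1" for a b
      unfolding y3(1)[OF that(1)] l1[OF that(2)] by (rule fun_cong[OF l_2[OF y3(2)[OF that(1)] x]])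
    have "T 2 3 = sh dgl [0..<n] (\<lambda>a b. if length a = 2 \<and> length b = 2
        then L3 (\<Sum>k\<leftarrow>a. d k) (d (b ! 0)) (d (b ! 1)) (y2 x a) (x (b ! 0)) (x (b ! 1)) us else 0)"
      using that by (subst T) (auto intro!: sh_cong simp: *)
    moreover have "T 3 2 = sh dgl [0..<n] (\<lambda>a b. if length a = 3 \<and> length b = 1
        then L2 (- 1 + (\<Sum>k\<leftarrow>a. d k)) (d (b ! 0)) (y3 x a) (x (b ! 0)) us else 0)"
      using that by (subst T) (auto intro!: sh_cong simp: **)
    ultimately show ?thesis by (simp only: jacobi_4[OF x sub])
  qed
  have T33: "T 3 3 = 0" if "n = 5"
  proof -
    have *: "l 3 (l 3 (map x a) # map x b) us = L3 (- 1 + (\<Sum>k\<leftarrow>a. d k)) (d (b ! 0)) (d (b ! 1)) (y3 x a) (x (b ! 0)) (x (b ! 1)) us"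
      if "length a = 3" "length b = 2" for a b
      unfolding y3(1)[OF that(1)] l2'[OF that(2)] by (rule fun_cong[OF l_3[OF y3(2)[OF that(1)] x x]])
    have "T 3 3 = sh dgl [0..<n] (\<lambda>a b. if length a = 3 \<and> length b = 2
        then L3 (- 1 + (\<Sum>k\<leftarrow>a. d k)) (d (b ! 0)) (d (b ! 1)) (y3 x a) (x (b ! 0)) (x (b ! 1)) us else 0)"
      using that by (subst T) (auto intro!: sh_cong simp: *)
    then show ?thesis by (simp only: jacobi_5[OF x sub])
  qed
  let ?I = "{(i, j). 1 \<le> i \<and> 1 \<le> j \<and> i + j = n + 1}"
  have fin: "finite ?I" by (rule finite_subset[of _ "{..n} \<times> {..n}"]) auto
  have "(\<Sum>(i, j)\<in>?I. \<Sum>\<sigma>\<in>Sh2 i (n - i).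
      pointwise scale (of_int (sign \<sigma> * koszul_sign d n \<sigma> * (-1) ^ (i * (j - 1))))
        (l j (l i (block xs \<sigma> 0 i) # block xs \<sigma> i n))) us
      = (\<Sum>(i, j)\<in>?I. scale ((- 1) ^ (i * (j - 1))) (T i j))"
    unfolding T_def
    by (simp add: sum_apply_fun case_prod_unfold pointwise_def scale_sum_right mult.commute)
  also have "\<dots> = (\<Sum>(i, j)\<in>?I \<inter> {(2, 2), (2, 3), (3, 2), (3, 3)}. scale ((- 1) ^ (i * (j - 1))) (T i j))"
  proof (rule sum.mono_neutral_right[OF fin])
    show "\<forall>z\<in>?I - ?I \<inter> {(2, 2), (2, 3), (3, 2), (3, 3)}. (case z of (i, j) \<Rightarrow> scale ((- 1) ^ (i * (j - 1))) (T i j)) = 0"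
    proof
      fix z assume z: "z \<in> ?I - ?I \<inter> {(2, 2), (2, 3), (3, 2), (3, 3)}"
      obtain i j where ij: "z = (i, j)" by (cases z)
      have "i \<le> n" "j = n + 1 - i" "\<not> (i \<in> {2, 3} \<and> j \<in> {2, 3})" using z by (auto simp: ij)
      from T_0[OF this] show "(case z of (i, j) \<Rightarrow> scale ((- 1) ^ (i * (j - 1))) (T i j)) = 0"
        by (simp only: ij prod.case scale_zero_right)
    qed
  qed simp
  also have "\<dots> = 0"
  proof -
    consider "n = 3" | "n = 4" | "n = 5" | "n \<notin> {3, 4, 5}" by blast
    then show ?thesis
    proof cases
      case 1
      then have "?I \<inter> {(2, 2), (2, 3), (3, 2), (3, 3)} = {(2, 2)}" by auto
      then show ?thesis using T22 1 by simp
    next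
      case 2
      then have "?I \<inter> {(2, 2), (2, 3), (3, 2), (3, 3)} = {(2, 3), (3, 2)}" by auto
      then show ?thesis using T4 2 by simp
    next
      case 3
      then have "?I \<inter> {(2, 2), (2, 3), (3, 2), (3, 3)} = {(3, 3)}" by auto
      then show ?thesis using T33 3 by simp
    next
      case 4
      then have "?I \<inter> {(2, 2), (2, 3), (3, 2), (3, 3)} = {}" by auto
      then show ?thesis by (simp only: sum.empty)
    qed
  qed
  finally show "(\<Sum>(i, j)\<in>?I. \<Sum>\<sigma>\<in>Sh2 i (n - i).
      pointwise scale (of_int (sign \<sigma> * koszul_sign d n \<sigma> * (-1) ^ (i * (j - 1))))
        (l j (l i (block xs \<sigma> 0 i) # block xs \<sigma> i n))) us = 0 us" by simp
qed

end

context twisted_module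
begin

theorem L_infinity: "L_infinity_algebra (pointwise scale) graded l"
proof -
  interpret pw: vector_space "pointwise scale :: 'k \<Rightarrow> ('m list \<Rightarrow> 'g) \<Rightarrow> 'm list \<Rightarrow> 'g"
    by (rule vector_space_pointwise)
  have C: "twisted_calculus scale br MS act H"
    by (intro twisted_calculus.intro twisted_module_axioms insertion_calculus.intro MS)
  \<comment> \<open>Statements about forms without parameters use parameter grades built from zero;
    the axioms about elements of given degrees interpret the calculus again with those
    degrees.\<close>
  interpret c: twisted_calculus scale br MS act H "\<lambda>_. 0" by (rule C)
  have lin: "pointwise scale c P + Q \<in> graded i" if "P \<in> graded i" "Q \<in> graded i" for c P Q i
    using that c.hom_linear unfolding c.graded_iff by blast
  have zero: "0 \<in> graded i" for i using c.hom_zero unfolding c.graded_iff .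
  show ?thesis
  proof
    show "pw.subspace (graded i)" for i
      unfolding pw.subspace_def
      using zero lin[of _ i _ 1] lin[OF _ zero, of _ i] by simp
  next
    fix I and x :: "int \<Rightarrow> 'm list \<Rightarrow> 'g"
    assume I: "finite I" and x: "\<And>i. i \<in> I \<Longrightarrow> x i \<in> graded i" and s: "(\<Sum>i\<in>I. x i) = 0"
    show "\<forall>i\<in>I. x i = 0"
    proof (intro ballI ext)
      fix i us assume i: "i \<in> I"
      show "x i us = 0 us"
      proof (rule ccontr)
        assume "x i us \<noteq> 0 us"
        \<comment> \<open>A homogeneous element is supported on lists whose length is its degree, so
          all other summands vanish at \<open>us\<close>.\<close>
        then have "int (length us) = i" using c.hom_support x[OF i] unfolding c.graded_iff by auto
        then have "x j us = 0" if "j \<in> I" "j \<noteq> i" for j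
          using c.hom_support[of j "x j" us] x[OF that(1)] that(2) unfolding c.graded_iff by blast
        then have "(\<Sum>i\<in>I. x i) us = x i us"
          unfolding sum_apply_fun using I i by (simp add: sum.remove[of _ i])
        with s \<open>x i us \<noteq> 0 us\<close> show False by simp
      qed
    qed
  next
    fix k :: nat
    have dec: "c.decomposable P" if "P \<in> pw.span (\<Union>i. graded i)" for P
      using that
    proof (induction rule: pw.span_induct_alt)
      case base
      show ?case by (rule c.decomposable_hom[OF c.hom_zero])
    next
      case (step c' P Q)
      then show ?case
        using c.decomposable_linear c.decomposable_hom c.graded_iff by blast
    qed
    show "multilinear_on (pointwise scale) (pw.span (\<Union>i. graded i)) (pointwise scale) k (l k)"
      unfolding multilinear_on_def
    proof (intro conjI ballI allI impI)
      fix Ps i P assume Ps: "Ps \<in> tuples (pw.span (\<Union>i. graded i)) k" and i: "i < k"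
        and P: "P \<in> pw.span (\<Union>i. graded i)"
      then have *: "length Ps = k" "\<And>P. P \<in> set Ps \<Longrightarrow> c.decomposable P"
        using dec by (auto simp: tuples_def)
      have ll: "l k (Ps[i := pointwise scale e P + Q]) = pointwise scale e (l k (Ps[i := P])) + l k (Ps[i := Q])"
        if "c.decomposable Q" for e Q
        by (rule c.l_linear[OF *(1) _ i dec[OF P] that]) (rule *(2))
      show "l k (Ps[i := P + Q]) = l k (Ps[i := P]) + l k (Ps[i := Q])"
        if "Q \<in> pw.span (\<Union>i. graded i)" for Q
        using ll[OF dec[OF that], of 1] by simp
      have z: "l k (Ps[i := 0]) = 0"
        using * i c.decomposable_hom[OF c.hom_zero]
        by (intro c.l_zero[of _ _ i]) (auto dest!: set_update_subset_insert[THEN subsetD])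
      show "l k (Ps[i := pointwise scale e P]) = pointwise scale e (l k (Ps[i := P]))" for e
        using ll[OF c.decomposable_hom[OF c.hom_zero], of e] z by simp
    qed
  next
    fix k xs and d :: "nat \<Rightarrow> int"
    assume k: "length xs = k" "\<And>i. i < k \<Longrightarrow> xs ! i \<in> graded (d i)"
    interpret e: twisted_calculus scale br MS act H d by (rule C)
    have h: "e.hom (d i) (xs ! i)" if "i < k" for i using k(2)[OF that] unfolding e.graded_iff .
    show "l k xs \<in> graded ((\<Sum>i<k. d i) + 2 - int k)"
      unfolding e.graded_iff by (rule e.l_degree[OF k(1) h])
    show "l k (block xs \<sigma> 0 k) = pointwise scale (of_int (sign \<sigma> * koszul_sign d k \<sigma>)) (l k xs)"
      if "\<sigma> permutes {..<k}" for \<sigma>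
      by (rule e.l_antisymmetric[OF k(1) h that])
    show "(\<Sum>(i, j)\<in>{(i, j). 1 \<le> i \<and> 1 \<le> j \<and> i + j = k + 1}. \<Sum>\<sigma>\<in>Sh2 i (k - i).
        pointwise scale (of_int (sign \<sigma> * koszul_sign d k \<sigma> * (-1) ^ (i * (j - 1))))
          (l j (l i (block xs \<sigma> 0 i) # block xs \<sigma> i k))) = 0"
      by (rule e.l_jacobi[OF k(1) h])
  qed
qed

end

section \<open>The coadjoint module\<close>

lemma in_dual_iff:
  fixes scale :: "'k::field \<Rightarrow> 'g::ab_group_add \<Rightarrow> 'g"
  assumes "vector_space scale"
  shows "\<alpha> \<in> dual scale \<longleftrightarrow> (\<forall>x y. \<alpha> (x + y) = \<alpha> x + \<alpha> y) \<and> (\<forall>c x. \<alpha> (scale c x) = c * \<alpha> x)"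
proof
  assume *: "(\<forall>x y. \<alpha> (x + y) = \<alpha> x + \<alpha> y) \<and> (\<forall>c x. \<alpha> (scale c x) = c * \<alpha> x)"
  interpret g: vector_space scale by fact
  interpret k: vector_space "(*) :: 'k \<Rightarrow> 'k \<Rightarrow> 'k" by unfold_locales (auto simp: algebra_simps)
  have "Vector_Spaces.linear scale (*) \<alpha>" by unfold_locales (use * in blast)+
  then show "\<alpha> \<in> dual scale" by (simp add: dual_def)
qed (simp add: dual_simps)

lemma dual_space: "is_space (pointwise (*), dual scale)" if "vector_space scale"
  for scale :: "'k::field \<Rightarrow> 'g::ab_group_add \<Rightarrow> 'g"
proof -
  interpret g: vector_space scale by fact
  have p: "vector_space (pointwise (*) :: 'k \<Rightarrow> ('g \<Rightarrow> 'k) \<Rightarrow> 'g \<Rightarrow> 'k)"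
  proof
    fix a b :: 'k and x y :: "'g \<Rightarrow> 'k"
    show "pointwise (*) a (x + y) = pointwise (*) a x + pointwise (*) a y"
      by (rule ext) (simp add: pointwise_def distrib_left)
    show "pointwise (*) (a + b) x = pointwise (*) a x + pointwise (*) b x"
      by (rule ext) (simp add: pointwise_def distrib_right)
    show "pointwise (*) a (pointwise (*) b x) = pointwise (*) (a * b) x"
      by (rule ext) (simp add: pointwise_def)
    show "pointwise (*) 1 x = x" by (rule ext) (simp add: pointwise_def)
  qed
  interpret p: vector_space "pointwise (*) :: 'k \<Rightarrow> ('g \<Rightarrow> 'k) \<Rightarrow> 'g \<Rightarrow> 'k" by (rule p)
  have "p.subspace (dual scale)"
    unfolding p.subspace_def by (auto simp: in_dual_iff[OF that] pointwise_def algebra_simps)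
  then show ?thesis by (simp add: is_space_def p.vector_space_axioms)
qed

lemma dual_minus: "\<alpha> \<in> dual scale \<Longrightarrow> \<alpha> (- x) = - \<alpha> x" "\<alpha> \<in> dual scale \<Longrightarrow> \<alpha> (x - y) = \<alpha> x - \<alpha> y"
proof -
  show *: "\<alpha> (- x) = - \<alpha> x" if "\<alpha> \<in> dual scale" for x
    using dual_simps(1)[OF that, of x "- x"] dual_simps(3)[OF that] by (simp add: add_eq_0_iff)
  show "\<alpha> (x - y) = \<alpha> x - \<alpha> y" if "\<alpha> \<in> dual scale"
    using dual_simps(1)[OF that, of x "- y"] *[OF that] by simp
qed

locale three_cocycle = lie_algebra scale br
  for scale :: "'k::field_char_0 \<Rightarrow> 'g::ab_group_add \<Rightarrow> 'g" and br +
  fixes \<psi> :: "'g list \<Rightarrow> 'k"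
  assumes cocycle: "\<psi> \<in> trivial_cocycles scale br 3"
begin

lemma psi_alt: "\<psi> \<in> alt_maps scale UNIV (*) UNIV 3"
  and psi_closed: "ce_differential br (*) (\<lambda>x c. 0) 3 \<psi> = 0"
  using cocycle by (auto simp: trivial_cocycles_def ce_cocycles_def)

lemma psi_swap: "\<psi> [x, y, z] = - \<psi> [y, x, z]" "\<psi> [x, y, z] = - \<psi> [x, z, y]"
  using alt_maps_swap[OF psi_alt, of "[]" x y "[z]"] alt_maps_swap[OF psi_alt, of "[x]" y z "[]"] by simp_all

lemma psi_linear:
  "\<psi> [x + y, z, w] = \<psi> [x, z, w] + \<psi> [y, z, w]" "\<psi> [z, x + y, w] = \<psi> [z, x, w] + \<psi> [z, y, w]"
  "\<psi> [z, w, x + y] = \<psi> [z, w, x] + \<psi> [z, w, y]" "\<psi> [scale c x, z, w] = c * \<psi> [x, z, w]"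
  "\<psi> [z, scale c x, w] = c * \<psi> [z, x, w]" "\<psi> [z, w, scale c x] = c * \<psi> [z, w, x]"
  using alt_mapsD(3)[OF psi_alt, of "[]" "[z, w]" x y] alt_mapsD(3)[OF psi_alt, of "[z]" "[w]" x y]
    alt_mapsD(3)[OF psi_alt, of "[z, w]" "[]" x y] alt_mapsD(4)[OF psi_alt, of "[]" "[z, w]" x c]
    alt_mapsD(4)[OF psi_alt, of "[z]" "[w]" x c] alt_mapsD(4)[OF psi_alt, of "[z, w]" "[]" x c]
  by simp_all

text \<open>With trivial coefficients the action terms of the differential drop out, leaving one
  term for each of the six pairs.\<close>

lemma psi_cocycle:
  "- \<psi> [br x y, z, w] + \<psi> [br x z, y, w] - \<psi> [br x w, y, z] - \<psi> [br y z, x, w] + \<psi> [br y w, x, z]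
   - \<psi> [br z w, x, y] = 0"
proof -
  have S: "{(i, j). i < j \<and> j \<le> (3::nat)} = {(0, 1), (0, 2), (0, 3), (1, 2), (1, 3), (2, 3)}" by auto
  have n: "nths [x, y, z, w] (- {0, Suc 0}) = [z, w]" "nths [x, y, z, w] (- {0, 2}) = [y, w]"
    "nths [x, y, z, w] (- {0, 3}) = [y, z]" "nths [x, y, z, w] (- {Suc 0, 2}) = [x, w]"
    "nths [x, y, z, w] (- {Suc 0, 3}) = [x, z]" "nths [x, y, z, w] (- {2, 3}) = [x, y]"
    by (simp_all add: nths_Cons)
  show ?thesis
    using fun_cong[OF psi_closed, of "[x, y, z, w]"]
    unfolding ce_differential_def S by (simp add: n algebra_simps)
qed

abbreviation DS where "DS \<equiv> (pointwise (*) :: 'k \<Rightarrow> ('g \<Rightarrow> 'k) \<Rightarrow> 'g \<Rightarrow> 'k, dual scale)"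

lemma DS: "is_space DS"
  by (rule dual_space) (rule vector_space_axioms)

lemma in_dual: "\<alpha> \<in> dual scale \<longleftrightarrow> (\<forall>x y. \<alpha> (x + y) = \<alpha> x + \<alpha> y) \<and> (\<forall>c x. \<alpha> (scale c x) = c * \<alpha> x)"
  by (rule in_dual_iff) (rule vector_space_axioms)

lemma psi_sharp_apply: "psi_sharp \<psi> [x, y] z = \<psi> [x, y, z]"
  by (simp add: psi_sharp_def)

text \<open>The Jacobi identity makes \<open>coad\<close> an action, and closedness of \<psi>, read
  as a function of its fourth argument, is the cocycle condition for
  \<open>psi_sharp\<close>.\<close>

sublocale twisted_module scale br DS "coad br" "psi_sharp \<psi>"
proof
  show "is_space DS" by (rule DS)
  show "bilin (scale, UNIV) DS DS (coad br)"
    unfolding bilin_def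
    by (auto simp: in_dual coad_def br_bilinear pointwise_def fun_eq_iff algebra_simps)
  show "coad br (br x y) m = coad br x (coad br y m) - coad br y (coad br x m)" if "m \<in> snd DS" for x y m
  proof
    fix z
    have m: "m \<in> dual scale" using that by simp
    have "br (br x y) z = br x (br y z) - br y (br x z)"
      using jacobi[of x y z] br_bilinear(4)[of y "- 1" "br x z"]
      unfolding br_swap[of z x] br_swap[of z "br x y"] by (simp add: algebra_simps)
    then show "coad br (br x y) m z = (coad br x (coad br y m) - coad br y (coad br x m)) z"
      by (simp add: coad_def dual_minus[OF m])
  qed
  show "bilin (scale, UNIV) (scale, UNIV) DS (\<lambda>x y. psi_sharp \<psi> [x, y])"
    unfolding bilin_def
    by (auto simp: in_dual psi_sharp_apply psi_linear pointwise_def fun_eq_iff)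
  show "psi_sharp \<psi> [y, x] = - psi_sharp \<psi> [x, y]" for x y
    by (rule ext) (simp add: psi_sharp_apply psi_swap(1)[of y x])
  show "coad br x (psi_sharp \<psi> [y, z]) - coad br y (psi_sharp \<psi> [x, z]) + coad br z (psi_sharp \<psi> [x, y])
      - psi_sharp \<psi> [br x y, z] + psi_sharp \<psi> [br x z, y] - psi_sharp \<psi> [br y z, x] = 0" for x y z
  proof
    fix w
    \<comment> \<open>The coadjoint terms carry the bracket in the last argument of \<psi>,
      \<open>psi_cocycle\<close> in the first; a rotation, being even, moves it.\<close>
    have c: "\<psi> [a, b, c] = \<psi> [c, a, b]" for a b c
      using psi_swap(2)[of a b c] psi_swap(1)[of a c b] by simp
    show "(coad br x (psi_sharp \<psi> [y, z]) - coad br y (psi_sharp \<psi> [x, z]) + coad br z (psi_sharp \<psi> [x, y])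
      - psi_sharp \<psi> [br x y, z] + psi_sharp \<psi> [br x z, y] - psi_sharp \<psi> [br y z, x]) w = 0 w"
      using psi_cocycle[of x y z w] c[of y z "br x w"] c[of x z "br y w"] c[of x y "br z w"]
      by (simp add: coad_def psi_sharp_apply algebra_simps)
  qed
qed

lemma psi_sharp_cocycle: "psi_sharp \<psi> \<in> coadjoint_cocycles scale br 2"
proof -
  have dual: "psi_sharp \<psi> [x, y] \<in> dual scale" for x y
    by (simp add: in_dual psi_sharp_apply psi_linear)
  have two: "\<exists>x y. us = [x, y]" if "us \<in> tuples UNIV 2" for us :: "'g list"
    using that by (auto simp: tuples_def length_Suc_conv numeral_2_eq_2)
  have "psi_sharp \<psi> \<in> alt_maps scale UNIV (pointwise (*)) (dual scale) 2"
    unfolding alt_maps_def mem_Collect_eq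
  proof (intro conjI ballI allI impI)
    show "psi_sharp \<psi> us \<in> dual scale" if "us \<in> tuples UNIV 2" for us using two[OF that] dual by auto
    show "psi_sharp \<psi> us = 0" if "us \<notin> tuples UNIV 2" for us
      using that by (auto simp: tuples_def psi_sharp_def)
    show "multilinear_on scale UNIV (pointwise (*)) 2 (psi_sharp \<psi>)"
      unfolding multilinear_on_def
    proof (intro conjI ballI allI impI; (drule two; elim exE))
      fix us :: "'g list" and i and u v x y :: 'g assume "i < (2::nat)" and us: "us = [x, y]"
      then have "i = 0 \<or> i = 1" by auto
      then show "psi_sharp \<psi> (us[i := u + v]) = psi_sharp \<psi> (us[i := u]) + psi_sharp \<psi> (us[i := v])"
        by (auto simp: us psi_sharp_apply psi_linear)
    next
      fix us :: "'g list" and i c and u x y :: 'g assume "i < (2::nat)" and us: "us = [x, y]"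
      then have "i = 0 \<or> i = 1" by auto
      then show "psi_sharp \<psi> (us[i := scale c u]) = pointwise (*) c (psi_sharp \<psi> (us[i := u]))"
        by (auto simp: us psi_sharp_apply psi_linear pointwise_def)
    qed
    show "psi_sharp \<psi> us = 0" if us: "us \<in> tuples UNIV 2" and ij: "i < j \<and> j < 2 \<and> us ! i = us ! j" for us i j
    proof -
      obtain x y where xy: "us = [x, y]" using two[OF us] by blast
      have "i = 0" "j = 1" using ij by auto
      with ij have "us ! 0 = us ! 1" by simp
      then have "us = [x, x]" by (simp add: xy)
      then show ?thesis using alt_mapsD(5)[OF psi_alt, of "[]" x] by (auto simp: psi_sharp_apply)
    qed
  qed
  moreover have "ce_differential br (pointwise (*)) (coad br) 2 (psi_sharp \<psi>) = 0"
  proof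
    fix xs
    have S: "{(i, j). i < j \<and> j \<le> (2::nat)} = {(0, 1), (0, 2), (1, 2)}" by auto
    have A: "{..2::nat} = {0, 1, 2}" by auto
    have n: "nths [x, y, z] (- {0}) = [y, z]" "nths [x, y, z] (- {Suc 0}) = [x, z]"
      "nths [x, y, z] (- {2}) = [x, y]" "nths [x, y, z] (- {0, Suc 0}) = [z]"
      "nths [x, y, z] (- {0, 2}) = [y]" "nths [x, y, z] (- {Suc 0, 2}) = [x]" for x y z :: 'g
      by (simp_all add: nths_Cons)
    show "ce_differential br (pointwise (*)) (coad br) 2 (psi_sharp \<psi>) xs = 0 xs"
    proof (cases "length xs = 3")
      case True
      then obtain x y z where xs: "xs = [x, y, z]" by (auto simp: length_Suc_conv numeral_3_eq_3)
      have "pointwise (*) (- 1) F = - F" "pointwise (*) 1 F = F" for F :: "'g \<Rightarrow> 'k"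
        by (simp_all add: pointwise_def fun_eq_iff)
      then show ?thesis
        using H_cocycle[of x y z]
        by (simp add: ce_differential_def xs S A n numeral_3_eq_3 algebra_simps)
    qed (simp add: ce_differential_def)
  qed
  ultimately show ?thesis by (simp add: coadjoint_cocycles_def ce_cocycles_def)
qed

lemma coadjoint_L_infinity: "L_infinity_algebra (pointwise scale) (hom_graded scale) (coadjoint_brackets scale br \<psi>)"
proof -
  have "hom_graded scale = graded" by (auto simp: hom_graded_def graded_def fun_eq_iff)
  then show ?thesis using L_infinity by (simp add: coadjoint_brackets_def)
qed

end

section \<open>Maurer--Cartan elements\<close>

context twisted_calculus
begin

text \<open>The factors 2 and -6 are those that the coefficients 1/2 and -1/6 of the Maurer-Cartan
  equation cancel.\<close>

lemma diagonal_brackets: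
  assumes R: "hom 1 R" and ab: "\<alpha> \<in> snd MS" "\<beta> \<in> snd MS"
  defines "u \<equiv> R [act (R [\<alpha>]) \<beta>] - R [act (R [\<beta>]) \<alpha>] - br (R [\<alpha>]) (R [\<beta>])"
    and "w \<equiv> R [H [R [\<alpha>], R [\<beta>]]]"
  shows "L2 1 1 R R [\<alpha>, \<beta>] = u + u"
    "L3 1 1 1 R R R [\<alpha>, \<beta>] = - ((w + w + w) + (w + w + w))"
proof -
  have R0: "R us = 0" if "length us \<noteq> 1" for us using hom_support[OF R, of us] that by auto
  have base: "base [Inr \<alpha>] = \<alpha>" "base [Inr \<beta>] = \<beta>" "base [] = 0" "base [x, y] = 0" for x y
    using ab by (auto simp: base_def)
  note b = bilinD(6,7)[OF bilin_br GS GS, simplified] and h = bilinD(6,7)[OF bilin_H GS GS, simplified]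
    and a = bilinD(6,7)[OF bilin_act GS MS, simplified]
  have Rz: "R [0] = 0" using Om_linear(2)[OF R, of "[]"] Cons_eq_lift[of R 0 "[]"] by simp
  have nu: "eps nu nu = 1" by (simp add: eps_def)
  have H': "R [H [R [\<beta>], R [\<alpha>]]] = - w"
    using Om_linear(4)[OF R bilinD(1)[OF bilin_H GS GS], of "R [\<alpha>]" "R [\<beta>]" "[]"]
      Cons_eq_lift[of R "H [R [\<alpha>], R [\<beta>]]" "[]"] Cons_eq_lift[of R "- H [R [\<alpha>], R [\<beta>]]" "[]"]
    by (simp add: H_swap[of "R [\<alpha>]" "R [\<beta>]"] w_def)
  have 1: "D (pr act (lift R) base) (lift R) (map Inr [\<alpha>, \<beta>]) = R [act (R [\<alpha>]) \<beta>] - R [act (R [\<beta>]) \<alpha>]"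
    unfolding D_pr_sh3[OF R Om_base bilin_act R] sh3_lift_map Cons_eq_lift lift_Inr
    by (simp add: R0 base nu eps_simps Rz a is_spaceD(1)[OF MS])
  have 2: "pr br (lift R) (lift R) (map Inr [\<alpha>, \<beta>]) = br (R [\<alpha>]) (R [\<beta>]) + br (R [\<alpha>]) (R [\<beta>])"
    unfolding pr_def sh_map lift_Inr comp_def dg_simps using br_swap[of "R [\<alpha>]" "R [\<beta>]"]
    by (simp add: R0 nu eps_simps b)
  show "L2 1 1 R R [\<alpha>, \<beta>] = u + u"
    unfolding L2_def U2_def u_def fun_diff_def plus_fun_apply sg_apply 1 2 by (simp add: eps_def)
  have "D (ph (lift R) (lift R)) (lift R) (map Inr [\<alpha>, \<beta>]) = w + w"
    unfolding D_pr_sh3[OF R R bilin_H R] sh3_lift_map Cons_eq_lift lift_Inr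
    by (simp add: R0 nu eps_simps Rz h H' flip: w_def)
  then show "L3 1 1 1 R R R [\<alpha>, \<beta>] = - ((w + w + w) + (w + w + w))"
    unfolding L3_def U3_def by (simp add: eps_def sg_apply sg_def algebra_simps)
qed

end

context twisted_module
begin

text \<open>The condition on the right says that \<open>R\<close> is an H-twisted Rota-Baxter
  operator.\<close>

theorem maurer_cartan_iff:
  assumes R: "R \<in> graded 1"
  shows "maurer_cartan (pointwise scale) graded l R \<longleftrightarrow>
    (\<forall>\<alpha>\<in>snd MS. \<forall>\<beta>\<in>snd MS. R [act (R [\<alpha>]) \<beta>] - R [act (R [\<beta>]) \<alpha>] - br (R [\<alpha>]) (R [\<beta>])
      + R [H [R [\<alpha>], R [\<beta>]]] = 0)"
proof -
  interpret c: twisted_calculus scale br MS act H "\<lambda>_. 0"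
    by (intro twisted_calculus.intro twisted_module_axioms insertion_calculus.intro MS)
  have h: "c.hom 1 R" using R unfolding c.graded_iff .
  let ?S = "{k. 1 \<le> k \<and> l k (replicate k R) \<noteq> 0}"
  define t where "t k = pointwise scale ((-1) ^ ((k - 1) * (k - 2) div 2) / fact k) (l k (replicate k R))" for k
  have S: "?S \<subseteq> {2, 3}" using c.l_other by auto
  then have fin: "finite ?S" by (rule finite_subset) simp
  have "(\<Sum>k\<in>?S. t k) = (\<Sum>k\<in>{2, 3}. t k)"
    by (rule sum.mono_neutral_left[OF _ S]) (auto simp: t_def pointwise_def fun_eq_iff)
  also have "\<dots> = t 2 + t 3" by simp
  finally have sum: "(\<Sum>k\<in>?S. t k) = t 2 + t 3" .
  have l2: "l 2 (replicate 2 R) = c.L2 1 1 R R" and l3: "l 3 (replicate 3 R) = c.L3 1 1 1 R R R"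
    using c.l_2[OF h h] c.l_3[OF h h h] by (simp_all add: numeral_2_eq_2 numeral_3_eq_3)
  \<comment> \<open>The exponent (k - 1)(k - 2)/2 is 0 for k = 2 and 1 for k = 3.\<close>
  have t2: "t 2 us = scale (1/2) (c.L2 1 1 R R us)" and t3: "t 3 us = scale (- (1/6)) (c.L3 1 1 1 R R R us)" for us
    unfolding t_def l2 l3 by (simp_all add: pointwise_def fact_numeral)
  have t: "(t 2 + t 3) [\<alpha>, \<beta>] = R [act (R [\<alpha>]) \<beta>] - R [act (R [\<beta>]) \<alpha>] - br (R [\<alpha>]) (R [\<beta>])
      + R [H [R [\<alpha>], R [\<beta>]]]" if "\<alpha> \<in> snd MS" "\<beta> \<in> snd MS" for \<alpha> \<beta>
    unfolding plus_fun_apply t2 t3 c.diagonal_brackets[OF h that] c.scale_sixth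
    by (simp only: c.scale_double) simp
  have "(t 2 + t 3) us = 0" if "us \<notin> tuples (snd MS) 2" for us
  proof -
    have "c.L2 1 1 R R us = 0" "c.L3 1 1 1 R R R us = 0"
      using c.hom_support[OF c.hom_L2[OF h h], of us] c.hom_support[OF c.hom_L3[OF h h h], of us] that
      by auto
    then show ?thesis by (simp add: t2 t3)
  qed
  moreover have "\<exists>\<alpha> \<beta>. us = [\<alpha>, \<beta>] \<and> \<alpha> \<in> snd MS \<and> \<beta> \<in> snd MS" if "us \<in> tuples (snd MS) 2" for us
    using that by (auto simp: tuples_def length_Suc_conv numeral_2_eq_2)
  ultimately have "t 2 + t 3 = 0 \<longleftrightarrow> (\<forall>\<alpha>\<in>snd MS. \<forall>\<beta>\<in>snd MS. (t 2 + t 3) [\<alpha>, \<beta>] = 0)"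
    by (metis (full_types) ext zero_fun_apply)
  then show ?thesis
    unfolding maurer_cartan_def t_def[symmetric] sum using R fin t by simp
qed

end

context three_cocycle
begin

lemma graded_eq: "hom_graded scale = graded"
  by (auto simp: hom_graded_def graded_def fun_eq_iff)

text \<open>A presentation of r turns \<open>sharp\<close> into a finite sum; the second property is
  the skew-symmetry of r.\<close>

lemma sharp_properties:
  assumes r: "r \<in> wedge2 scale" and a: "\<alpha> \<in> dual scale"
  shows "\<beta> \<in> dual scale \<Longrightarrow> \<beta> (sharp scale r \<alpha>) = r \<alpha> \<beta>"
    "\<beta> \<in> dual scale \<Longrightarrow> \<beta> (sharp scale r \<alpha>) = - \<alpha> (sharp scale r \<beta>)"
    "\<beta> \<in> dual scale \<Longrightarrow> sharp scale r (\<alpha> + \<beta>) = sharp scale r \<alpha> + sharp scale r \<beta>"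
    "sharp scale r (pointwise (*) c \<alpha>) = scale c (sharp scale r \<alpha>)"
proof -
  obtain ts where ts: "r = tensor2 scale ts" using r by (auto simp: wedge2_def)
  have vs: "vector_space scale" by (rule vector_space_axioms)
  have s: "sharp scale r \<delta> = (\<Sum>(a, b)\<leftarrow>ts. scale (\<delta> a) b)" if "\<delta> \<in> dual scale" for \<delta>
    unfolding ts by (rule sharp_tensor2[OF vs that])
  have e: "\<epsilon> (sharp scale r \<delta>) = r \<delta> \<epsilon>" if "\<delta> \<in> dual scale" "\<epsilon> \<in> dual scale" for \<delta> \<epsilon>
    unfolding s[OF that(1)] unfolding ts
    using that by (simp add: dual_sum_list dual_simps tensor2_apply pure2_def case_prod_unfold)
  show "\<beta> (sharp scale r \<alpha>) = r \<alpha> \<beta>" if "\<beta> \<in> dual scale" by (rule e[OF a that])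
  show "\<beta> (sharp scale r \<alpha>) = - \<alpha> (sharp scale r \<beta>)" if "\<beta> \<in> dual scale"
    unfolding e[OF a that] e[OF that a] using r unfolding wedge2_def by blast
  show "sharp scale r (\<alpha> + \<beta>) = sharp scale r \<alpha> + sharp scale r \<beta>" if b: "\<beta> \<in> dual scale"
    using is_spaceD(2)[OF DS, of \<alpha> \<beta>] a b
    by (simp add: s case_prod_unfold sum_list_addf scale_left_distrib)
  have "scale c (\<Sum>x\<leftarrow>ts. f x) = (\<Sum>x\<leftarrow>ts. scale c (f x))" for f :: "'g \<times> 'g \<Rightarrow> 'g"
    by (induction ts) (simp_all add: scale_right_distrib)
  then show "sharp scale r (pointwise (*) c \<alpha>) = scale c (sharp scale r \<alpha>)"
    using is_spaceD(4)[OF DS, of \<alpha> c] a by (simp add: s case_prod_unfold) (simp add: pointwise_def)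
qed

lemma sharp_hom_graded:
  assumes r: "r \<in> wedge2 scale"
  shows "sharp_hom scale r \<in> graded 1"
proof -
  note s = sharp_properties[OF r]
  have one: "\<exists>\<alpha>\<in>dual scale. us = [\<alpha>]" if "us \<in> tuples (dual scale) 1" for us
    using that by (auto simp: tuples_def length_Suc_conv)
  have ap: "sharp_hom scale r [\<alpha>] = sharp scale r \<alpha>" if "\<alpha> \<in> dual scale" for \<alpha>
    using that by (simp add: sharp_hom_def tuples_def)
  note M = is_spaceD(2,4)[OF DS, simplified]
  have "sharp_hom scale r \<in> alt_maps (pointwise (*)) (dual scale) scale UNIV 1"
    unfolding alt_maps_def mem_Collect_eq
  proof (intro conjI ballI allI impI)
    show "sharp_hom scale r us = 0" if "us \<notin> tuples (dual scale) 1" for us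
      using that by (simp add: sharp_hom_def)
    show "multilinear_on (pointwise (*)) (dual scale) scale 1 (sharp_hom scale r)"
      unfolding multilinear_on_def
    proof (intro conjI ballI allI impI; (drule one; elim bexE))
      show "sharp_hom scale r (us[i := u + v]) = sharp_hom scale r (us[i := u]) + sharp_hom scale r (us[i := v])"
        if "i < (1::nat)" "u \<in> dual scale" "v \<in> dual scale" "us = [\<alpha>]" for us i u v \<alpha>
        using that s(3)[OF that(2,3)] by (simp add: ap M)
      show "sharp_hom scale r (us[i := pointwise (*) c u]) = scale c (sharp_hom scale r (us[i := u]))"
        if "i < (1::nat)" "u \<in> dual scale" "us = [\<alpha>]" for us i u c \<alpha>
        using that s(4)[OF that(2), of c] by (simp add: ap M)
    qed
  qed auto
  then show ?thesis by (simp add: graded_def)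
qed

theorem twisted_triangular_iff_maurer_cartan:
  assumes r: "r \<in> wedge2 scale"
  shows "twisted_triangular scale br \<psi> r \<longleftrightarrow>
    maurer_cartan (pointwise scale) (hom_graded scale) (coadjoint_brackets scale br \<psi>) (sharp_hom scale r)"
proof -
  note s = sharp_properties[OF r]
  have vs: "vector_space scale" by (rule vector_space_axioms)
  define S where "S = sharp scale r"
  have ap: "sharp_hom scale r [\<alpha>] = S \<alpha>" if "\<alpha> \<in> dual scale" for \<alpha>
    using that by (simp add: sharp_hom_def tuples_def S_def)
  have cl: "coad br x \<alpha> \<in> dual scale" "psi_sharp \<psi> [x, y] \<in> dual scale" if "\<alpha> \<in> dual scale" for x y \<alpha>
    using that by (auto simp: in_dual coad_def br_bilinear psi_sharp_apply psi_linear)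
  have S: "\<gamma> (S \<delta>) = - \<delta> (S \<gamma>)" if "\<delta> \<in> dual scale" "\<gamma> \<in> dual scale" for \<gamma> \<delta>
    unfolding S_def by (rule s(2)[OF that])
  define J where "J \<alpha> \<beta> = S (coad br (S \<alpha>) \<beta>) - S (coad br (S \<beta>) \<alpha>) - br (S \<alpha>) (S \<beta>) + S (psi_sharp \<psi> [S \<alpha>, S \<beta>])"
    for \<alpha> \<beta>
  \<comment> \<open>Each outer \<open>S\<close> is moved to the other side of the pairing by
    skewness, and \<open>coad\<close> then turns into a bracket.\<close>
  have J: "\<gamma> (J \<alpha> \<beta>) = \<beta> (br (S \<alpha>) (S \<gamma>)) - \<alpha> (br (S \<beta>) (S \<gamma>)) - \<gamma> (br (S \<alpha>) (S \<beta>)) - \<psi> [S \<alpha>, S \<beta>, S \<gamma>]"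
    if d: "\<alpha> \<in> dual scale" "\<beta> \<in> dual scale" "\<gamma> \<in> dual scale" for \<alpha> \<beta> \<gamma>
    using S[OF cl(1)[OF d(2)] d(3)] S[OF cl(1)[OF d(1)] d(3)] S[OF cl(2)[OF d(1)] d(3)]
    by (simp add: J_def dual_simps(1)[OF d(3)] dual_minus[OF d(3)] coad_def psi_sharp_apply)
  have mc: "maurer_cartan (pointwise scale) (hom_graded scale) (coadjoint_brackets scale br \<psi>) (sharp_hom scale r)
      \<longleftrightarrow> (\<forall>\<alpha>\<in>dual scale. \<forall>\<beta>\<in>dual scale. J \<alpha> \<beta> = 0)"
    using maurer_cartan_iff[OF sharp_hom_graded[OF r]]
    by (simp add: graded_eq coadjoint_brackets_def ap cl J_def)
  have cyb: "(r12_r13 scale br ts + r12_r23 scale br ts + r13_r23 scale br ts) \<alpha> \<beta> \<gamma>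
      = \<alpha> (br (S \<beta>) (S \<gamma>)) - \<beta> (br (S \<alpha>) (S \<gamma>)) + \<gamma> (br (S \<alpha>) (S \<beta>))"
    if ts: "r = tensor2 scale ts" and d: "\<alpha> \<in> dual scale" "\<beta> \<in> dual scale" "\<gamma> \<in> dual scale" for ts \<alpha> \<beta> \<gamma>
  proof -
    have l: "(\<Sum>t\<leftarrow>ts. scale (\<delta> (fst t)) (snd t)) = S \<delta>" if "\<delta> \<in> dual scale" for \<delta>
      using sharp_tensor2[OF vs that, of ts] by (simp add: S_def ts case_prod_unfold)
    \<comment> \<open>Contracting the second leg of r in place of the first changes the sign, by
      skew-symmetry.\<close>
    have rr: "(\<Sum>t\<leftarrow>ts. scale (\<delta> (snd t)) (fst t)) = - S \<delta>" if "\<delta> \<in> dual scale" for \<delta>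
    proof (rule dual_separates[OF vs])
      fix \<epsilon> assume e: "\<epsilon> \<in> dual scale"
      have "\<epsilon> (\<Sum>t\<leftarrow>ts. scale (\<delta> (snd t)) (fst t)) = r \<epsilon> \<delta>"
        using that e unfolding ts
        by (simp add: dual_sum_list dual_simps tensor2_apply pure2_def case_prod_unfold mult.commute)
      also have "\<dots> = \<epsilon> (- S \<delta>)"
        using s(1)[OF e that] S[OF e that] by (simp add: S_def dual_minus[OF e])
      finally show "\<epsilon> (\<Sum>t\<leftarrow>ts. scale (\<delta> (snd t)) (fst t)) = \<epsilon> (- S \<delta>)" .
    qed
    have m: "br (- x) y = - br x y" "br x (- y) = - br x y" for x y
      using br_scale[of "- 1" x 1 y] br_scale[of 1 x "- 1" y] by simp_all
    show ?thesis
      using d by (simp add: cyb_apply[OF d] l rr m dual_minus)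
  qed
  have "twisted_triangular scale br \<psi> r \<longleftrightarrow>
      (\<forall>\<alpha>\<in>dual scale. \<forall>\<beta>\<in>dual scale. \<forall>\<gamma>\<in>dual scale. \<alpha> (br (S \<beta>) (S \<gamma>)) - \<beta> (br (S \<alpha>) (S \<gamma>)) + \<gamma> (br (S \<alpha>) (S \<beta>))
        = - \<psi> [S \<alpha>, S \<beta>, S \<gamma>])"
  proof -
    obtain ts where ts: "r = tensor2 scale ts" using r by (auto simp: wedge2_def)
    \<comment> \<open>\<open>cyb\<close> holds for every presentation of r, so the quantifier over
      presentations disappears.\<close>
    show ?thesis unfolding twisted_triangular_def S_def[symmetric]
      using r ts cyb by auto
  qed
  also have "\<dots> \<longleftrightarrow> (\<forall>\<alpha>\<in>dual scale. \<forall>\<beta>\<in>dual scale. \<forall>\<gamma>\<in>dual scale. \<gamma> (J \<alpha> \<beta>) = 0)"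
    by (intro ball_cong refl) (auto simp: J algebra_simps eq_neg_iff_add_eq_0)
  also have "\<dots> \<longleftrightarrow> (\<forall>\<alpha>\<in>dual scale. \<forall>\<beta>\<in>dual scale. J \<alpha> \<beta> = 0)"
  proof (intro ball_cong refl)
    show "(\<forall>\<gamma>\<in>dual scale. \<gamma> (J \<alpha> \<beta>) = 0) \<longleftrightarrow> J \<alpha> \<beta> = 0" for \<alpha> \<beta>
      using dual_separates[OF vs, of "J \<alpha> \<beta>" 0] dual_simps(3) by metis
  qed
  finally show ?thesis unfolding mc .
qed

end

theorem theorem5p2:
  fixes scale :: "'k::field_char_0 \<Rightarrow> 'g::ab_group_add \<Rightarrow> 'g"
    and br :: "'g \<Rightarrow> 'g \<Rightarrow> 'g"
    and \<psi> :: "'g list \<Rightarrow> 'k"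
  assumes "lie_algebra scale br"
    and "\<psi> \<in> trivial_cocycles scale br 3"
  shows "psi_sharp \<psi> \<in> coadjoint_cocycles scale br 2 \<and>
    L_infinity_algebra (pointwise scale) (hom_graded scale) (coadjoint_brackets scale br \<psi>) \<and>
    (\<forall>r\<in>wedge2 scale. twisted_triangular scale br \<psi> r \<longleftrightarrow>
       maurer_cartan (pointwise scale) (hom_graded scale) (coadjoint_brackets scale br \<psi>)
         (sharp_hom scale r))"
proof -
  interpret three_cocycle scale br \<psi>
    using assms by (simp add: three_cocycle_def three_cocycle_axioms_def)
  show ?thesis
    using psi_sharp_cocycle coadjoint_L_infinity twisted_triangular_iff_maurer_cartan by blast
qed

end
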